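(* Let $m\ge1$. (i) For all $1\le i,j\le m+2n$, $J_{ij}\circ\pi^\sharp_{\mathbb{S}^{m-1|2n}}=\pi^\sharp_{\mathbb{S}^{m-1|2n}}\circ L_{ij}$ as maps $\mathcal{O}(\mathbb{R}^{m|2n})\to\mathcal{O}(\mathbb{S}^{m-1|2n})$. (ii) For all $1\le i,j,k,l\le m+2n$, $\langle J_{ij},J_{kl}\rangle_{\mathbb{S}^{m-1|2n}}=\pi^\sharp_{\mathbb{S}^{m-1|2n}}\big(\langle L_{ij},L_{kl}\rangle\big)$, i.e. the metric of $\mathbb{S}^{m-1|2n}$ is the one induced by the embedding $\pi_{\mathbb{S}^{m-1|2n}}$ into $\mathbb{R}^{m|2n}$.
   Context: $\mathbb{R}^{m|2n}$: even $x_1..x_m$, odd $\grave{x}_1..\grave{x}_{2n}$, $(X_1,\dots,X_{m+2n})$ all coordinates, $[i]=0$ if $i\le m$ else $1$; $\partial_{X^i}=\partial_{x_i}$ ($i\le m$), $\partial_{X^{m+2k-1}}=2\partial_{\grave{x}_{2k}}$, $\partial_{X^{m+2k}}=-2\partial_{\grave{x}_{2k-1}}$; $L_{ij}=X_i\partial_{X^j}-(-1)^{[i][j]}X_j\partial_{X^i}$. The metric on $\mathbb{R}^{m|2n}$ is the graded $\mathcal{O}$-bilinear form on vector fields with $\langle f\partial_{X_j}|h\partial_{X^k}\rangle=(-1)^{|h|[j]}\delta_j^k fh$. $r=|\underline x|$, $\theta^2=-\sum_k\grave{x}_{2k-1}\grave{x}_{2k}$, $\phi^\sharp(f)=\sum_{j=0}^n\frac{(-1)^j\theta^{2j}}{j!}(\frac{1}{2r}\partial_r)^jf$.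 The supersphere $\mathbb{S}^{m-1|2n}=(\mathbb{S}^{m-1},\mathcal{C}^\infty_{\mathbb{S}^{m-1}}\otimes\Lambda_{2n})$ with odd generators $\grave{y}_1..\grave{y}_{2n}$, $\theta_y^2=-\sum_k\grave{y}_{2k-1}\grave{y}_{2k}$, coordinate functions $\xi_i$ on $\mathbb{S}^{m-1}$. $\pi^\sharp_{\mathbb{S}^{m-1|2n}}=(\mathrm{res}_{r=1}\otimes\rho)\circ\phi^\sharp$, where $\mathrm{res}_{r=1}$ restricts each coefficient to the unit sphere and $\rho$ sends $\grave{x}_j\mapsto\grave{y}_j$. On $\mathbb{S}^{m-1|2n}$: $\partial_{\grave{y}^{2k-1}}=2\partial_{\grave{y}_{2k}}$, $\partial_{\grave{y}^{2k}}=-2\partial_{\grave{y}_{2k-1}}$, $\grave{y}^{2k-1}=\frac12\grave{y}_{2k}$, $\grave{y}^{2k}=-\frac12\grave{y}_{2k-1}$; $J_{ij}=L_{ij}$ (standard $\mathfrak{o}(m)$ fields on $\mathbb{S}^{m-1}$) for $i,j\le m$; $J_{ij}=\grave{y}_{i-m}\partial_{\grave{y}^{j-m}}+\grave{y}_{j-m}\partial_{\grave{y}^{i-m}}$ for $i,j>m$; $J_{ij}=\xi_i\sqrt{1-\theta^2_y}\partial_{\grave{y}^{j-m}}-\frac{\grave{y}_{j-m}}{\sqrt{1-\theta_y^2}}\sum_{l=1}^m\xi_lL_{li}$ for $i\le m<j$ (and $J_{ji}=-(-1)^{[i][j]}J_{ij}$). The metric on $\mathbb{S}^{m-1|2n}$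 is the graded $\mathcal{O}$-bilinear form with $\langle L_{ij},L_{kl}\rangle_{\mathbb{S}^{m-1|2n}}=(1-\theta^2_y)\langle L_{ij},L_{kl}\rangle_{\mathbb{S}^{m-1}}$ (round metric) for $i,j,k,l\le m$, $\langle L_{ij},\partial_{\grave{y}_l}\rangle=0$, $\langle\partial_{\grave{y}_k},\partial_{\grave{y}_l}\rangle=J^{lk}+\frac{\grave{y}^k\grave{y}^l}{1-\theta_y^2}$, where $J^{lk}$ are the entries of $J=\frac12\mathrm{diag}\big(\begin{smallmatrix}0&-1\\1&0\end{smallmatrix},\dots\big)$. *)

theory Defs
  imports "HOL-Analysis.Analysis"
begin

text \<open>An element of the Grassmann algebra generated by odd generators indexed by
  1..2n is encoded by its coefficient function: the coefficient of the monomial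
  y_{s1} y_{s2} ... y_{sk} (s1 < s2 < ... < sk) is a S where S = {s1,...,sk}.
  Only coefficients at subsets of {1..2n} are meaningful.\<close>

type_synonym grass = "nat set \<Rightarrow> real"

definition gsign :: "nat set \<Rightarrow> nat set \<Rightarrow> real" where
  "gsign A B = (-1) ^ card {(p, q). p \<in> A \<and> q \<in> B \<and> q < p}"

definition gmul :: "grass \<Rightarrow> grass \<Rightarrow> grass" where
  "gmul a b = (\<lambda>S. \<Sum>A\<in>Pow S. gsign A (S - A) * a A * b (S - A))"

definition gconst :: "real \<Rightarrow> grass" where
  "gconst c = (\<lambda>S. if S = {} then c else 0)"

definition ggen :: "nat \<Rightarrow> grass" where
  "ggen l = (\<lambda>S. if S = {l} then 1 else 0)"

definition gpow :: "grass \<Rightarrow> nat \<Rightarrow> grass" where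
  "gpow a k = ((gmul a) ^^ k) (gconst 1)"

definition ginv :: "grass \<Rightarrow> grass" where
  "ginv a = (\<lambda>S. (-1) ^ card S * a S)"

definition gder :: "nat \<Rightarrow> grass \<Rightarrow> grass" where
  "gder l a = (\<lambda>S. if l \<in> S then 0 else (-1) ^ card {s\<in>S. s < l} * a (insert l S))"

definition theta2 :: "nat \<Rightarrow> grass" where
  "theta2 n = (\<lambda>S. - (\<Sum>k=1..n. gmul (ggen (2*k-1)) (ggen (2*k)) S))"

text \<open>sqrt(1 - theta^2), 1/sqrt(1 - theta^2), 1/(1 - theta^2): the binomial series,
  which terminate since theta^(2(n+1)) = 0.\<close>
definition sqrt1m :: "nat \<Rightarrow> grass" where
  "sqrt1m n = (\<lambda>S. \<Sum>k\<le>n. (((1/2)::real) gchoose k) * (-1) ^ k * gpow (theta2 n) k S)"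

definition invsqrt1m :: "nat \<Rightarrow> grass" where
  "invsqrt1m n = (\<lambda>S. \<Sum>k\<le>n. (((-1/2)::real) gchoose k) * (-1) ^ k * gpow (theta2 n) k S)"

definition inv1m :: "nat \<Rightarrow> grass" where
  "inv1m n = (\<lambda>S. \<Sum>k\<le>n. gpow (theta2 n) k S)"

text \<open>The even coordinates are indexed by the finite type 'm (so m = CARD('m) \<ge> 1);
  the coordinates X_1..X_{m+2n} are indexed by Inl a (a :: 'm, even) and Inr p
  (1 \<le> p \<le> 2n, odd coordinate x`_p, i.e. X_{m+p}).\<close>

type_synonym 'm sfun = "real^'m \<Rightarrow> grass"

definition Idx :: "nat \<Rightarrow> ('m::finite + nat) set" where
  "Idx n = range Inl \<union> Inr ` {1..2*n}"

definition par :: "'m + nat \<Rightarrow> nat" where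
  "par a = (case a of Inl _ \<Rightarrow> 0 | Inr _ \<Rightarrow> 1)"

definition epart :: "'m::finite \<Rightarrow> (real^'m \<Rightarrow> real) \<Rightarrow> real^'m \<Rightarrow> real" where
  "epart a g x = deriv (\<lambda>t. g (x + t *\<^sub>R axis a 1)) 0"

fun iterp :: "'m::finite list \<Rightarrow> (real^'m \<Rightarrow> real) \<Rightarrow> real^'m \<Rightarrow> real" where
  "iterp [] g = g"
| "iterp (k # ks) g = epart k (iterp ks g)"

definition smooth_coeff :: "(real^'m::finite \<Rightarrow> real) \<Rightarrow> bool" where
  "smooth_coeff g \<longleftrightarrow> (\<forall>ks x. iterp ks g differentiable (at x))"

definition sf_smooth :: "nat \<Rightarrow> 'm::finite sfun \<Rightarrow> bool" where
  "sf_smooth n f \<longleftrightarrow> (\<forall>S\<subseteq>{1..2*n}. smooth_coeff (\<lambda>x. f x S))"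

definition sf_dlow :: "'m::finite + nat \<Rightarrow> 'm sfun \<Rightarrow> 'm sfun" where
  "sf_dlow b f = (case b of Inl i \<Rightarrow> (\<lambda>x S. epart i (\<lambda>y. f y S) x)
                           | Inr p \<Rightarrow> (\<lambda>x. gder p (f x)))"

definition sf_coord :: "'m::finite + nat \<Rightarrow> 'm sfun" where
  "sf_coord a = (case a of Inl i \<Rightarrow> (\<lambda>x. gconst (x $ i)) | Inr p \<Rightarrow> (\<lambda>x. ggen p))"

text \<open>coefficient of \<partial>_{X_b} in \<partial>_{X^a}:
  \<partial>_{X^{m+2k-1}} = 2 \<partial>_{x`_{2k}},  \<partial>_{X^{m+2k}} = -2 \<partial>_{x`_{2k-1}}\<close>
definition up_coef :: "'m + nat \<Rightarrow> 'm + nat \<Rightarrow> real" where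
  "up_coef a b = (case a of Inl i \<Rightarrow> (if b = Inl i then 1 else 0)
     | Inr p \<Rightarrow> (if odd p then (if b = Inr (p+1) then 2 else 0)
                else (if b = Inr (p-1) then -2 else 0)))"

text \<open>coefficient of \<partial>_{X^k} in \<partial>_{X_b} (inverse relation)\<close>
definition low_coef :: "'m + nat \<Rightarrow> 'm + nat \<Rightarrow> real" where
  "low_coef b k = (case b of Inl i \<Rightarrow> (if k = Inl i then 1 else 0)
     | Inr q \<Rightarrow> (if even q then (if k = Inr (q-1) then 1/2 else 0)
                else (if k = Inr (q+1) then -1/2 else 0)))"

text \<open>Vector fields on R^{m|2n}: V = sum_b V b \<cdot> \<partial>_{X_b} (left coefficients).\<close>
type_synonym 'm vfR = "'m + nat \<Rightarrow> 'm sfun"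

definition vf_apply :: "nat \<Rightarrow> 'm::finite vfR \<Rightarrow> 'm sfun \<Rightarrow> 'm sfun" where
  "vf_apply n V f = (\<lambda>x S. \<Sum>b\<in>Idx n. gmul (V b x) (sf_dlow b f x) S)"

text \<open>L_{ij} = X_i \<partial>_{X^j} - (-1)^{[i][j]} X_j \<partial>_{X^i}\<close>
definition L_R :: "'m::finite + nat \<Rightarrow> 'm + nat \<Rightarrow> 'm vfR" where
  "L_R i j = (\<lambda>b x S. up_coef j b * sf_coord i x S
                       - (-1) ^ (par i * par j) * up_coef i b * sf_coord j x S)"

text \<open>Metric on R^{m|2n}: graded O-bilinear with
  <f \<partial>_{X_a} | h \<partial>_{X^k}> = (-1)^{|h|[a]} \<delta>_a^k f h.\<close>
definition metric_R :: "nat \<Rightarrow> 'm::finite vfR \<Rightarrow> 'm vfR \<Rightarrow> 'm sfun" where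
  "metric_R n V W = (\<lambda>x S. \<Sum>a\<in>Idx n. \<Sum>b\<in>Idx n.
      low_coef b a * gmul (V a x) (if par a = 1 then ginv (W b x) else W b x) S)"

definition Dr :: "'m::finite sfun \<Rightarrow> 'm sfun" where
  "Dr f = (\<lambda>x S. deriv (\<lambda>t. f (x + t *\<^sub>R ((1 / norm x) *\<^sub>R x)) S) 0 / (2 * norm x))"

text \<open>phi^#(f) = sum_{j=0}^n (-1)^j theta^{2j}/j! ((1/2r)\<partial>_r)^j f; pi^# is its restriction
  to r = 1 (points \<xi> with norm \<xi> = 1) with x`_j renamed to y`_j (identity in this encoding).\<close>
definition pi_sharp :: "nat \<Rightarrow> 'm::finite sfun \<Rightarrow> 'm sfun" where
  "pi_sharp n f = (\<lambda>\<xi> S. \<Sum>j\<le>n. ((-1) ^ j / fact j) * gmul (gpow (theta2 n) j) ((Dr ^^ j) f \<xi>) S)"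

text \<open>Functions on S^{m-1|2n} are encoded as 'm sfun, considered only at points of the
  unit sphere.  The field L_{ab} on S^{m-1} (a,b \<le> m) is the generator of the rotation
  flow of x_a \<partial>_b - x_b \<partial>_a.\<close>
definition rot :: "'m::finite \<Rightarrow> 'm \<Rightarrow> real \<Rightarrow> real^'m \<Rightarrow> real^'m" where
  "rot a b t \<xi> = (\<chi> c. if a = b then \<xi> $ c
       else if c = a then cos t * \<xi> $ a - sin t * \<xi> $ b
       else if c = b then cos t * \<xi> $ b + sin t * \<xi> $ a
       else \<xi> $ c)"

definition sphL :: "'m::finite \<Rightarrow> 'm \<Rightarrow> 'm sfun \<Rightarrow> 'm sfun" where
  "sphL a b g = (\<lambda>\<xi> S. deriv (\<lambda>t. g (rot a b t \<xi>) S) 0)"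

text \<open>Vector fields on S^{m-1|2n}: sum_{a,b} cL a b \<cdot> L_{ab} + sum_l cY l \<cdot> \<partial>_{y`_l}.\<close>
type_synonym 'm vfS = "('m \<Rightarrow> 'm \<Rightarrow> 'm sfun) \<times> (nat \<Rightarrow> 'm sfun)"

definition sv_apply :: "nat \<Rightarrow> 'm::finite vfS \<Rightarrow> 'm sfun \<Rightarrow> 'm sfun" where
  "sv_apply n V g = (\<lambda>\<xi> S. (\<Sum>a\<in>UNIV. \<Sum>b\<in>UNIV. gmul (fst V a b \<xi>) (sphL a b g \<xi>) S)
      + (\<Sum>l\<in>{1..2*n}. gmul (snd V l \<xi>) (gder l (g \<xi>)) S))"

text \<open>coefficient of \<partial>_{y`_l} in \<partial>_{y`^q}\<close>
definition upY :: "nat \<Rightarrow> nat \<Rightarrow> real" where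
  "upY q l = (if odd q then (if l = q+1 then 2 else 0) else (if l = q-1 then -2 else 0))"

definition yup :: "nat \<Rightarrow> grass" where
  "yup k = (if odd k then (\<lambda>S. (1/2) * ggen (k+1) S) else (\<lambda>S. (-1/2) * ggen (k-1) S))"

definition Jmat :: "nat \<Rightarrow> nat \<Rightarrow> real" where
  "Jmat l k = (if odd l \<and> k = l+1 then -1/2 else if even l \<and> l \<ge> 1 \<and> k = l-1 then 1/2 else 0)"

definition vfS_neg :: "'m vfS \<Rightarrow> 'm vfS" where
  "vfS_neg V = ((\<lambda>c d \<xi> S. - fst V c d \<xi> S), (\<lambda>l \<xi> S. - snd V l \<xi> S))"

text \<open>J_{ij} for i \<le> m < j:  \<xi>_i sqrt(1-\<theta>^2) \<partial>_{y`^{j-m}} - (y`_{j-m}/sqrt(1-\<theta>^2)) sum_l \<xi>_l L_{li}\<close>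
definition Jmixed :: "nat \<Rightarrow> 'm::finite \<Rightarrow> nat \<Rightarrow> 'm vfS" where
  "Jmixed n a q = ((\<lambda>c d \<xi> S. if d = a then - (\<xi> $ c) * gmul (ggen q) (invsqrt1m n) S else 0),
                   (\<lambda>l \<xi> S. upY q l * \<xi> $ a * sqrt1m n S))"

definition Jsph :: "nat \<Rightarrow> 'm::finite + nat \<Rightarrow> 'm + nat \<Rightarrow> 'm vfS" where
  "Jsph n i j = (case (i, j) of
      (Inl a, Inl b) \<Rightarrow> ((\<lambda>c d \<xi>. if c = a \<and> d = b then gconst 1 else gconst 0), (\<lambda>l \<xi>. gconst 0))
    | (Inr p, Inr q) \<Rightarrow> ((\<lambda>c d \<xi>. gconst 0),
                        (\<lambda>l \<xi> S. upY q l * ggen p S + upY p l * ggen q S))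
    | (Inl a, Inr q) \<Rightarrow> Jmixed n a q
    | (Inr p, Inl b) \<Rightarrow> vfS_neg (Jmixed n b p))"

text \<open>round metric on S^{m-1}: L_{ab} at \<xi> is the tangent vector \<xi>_a e_b - \<xi>_b e_a\<close>
definition vecL :: "'m::finite \<Rightarrow> 'm \<Rightarrow> real^'m \<Rightarrow> real^'m" where
  "vecL a b \<xi> = (\<chi> c. (if c = b then \<xi> $ a else 0) - (if c = a then \<xi> $ b else 0))"

definition round_metric :: "'m::finite \<Rightarrow> 'm \<Rightarrow> 'm \<Rightarrow> 'm \<Rightarrow> real^'m \<Rightarrow> real" where
  "round_metric a b c d \<xi> = vecL a b \<xi> \<bullet> vecL c d \<xi>"

text \<open><\<partial>_{y`_k}, \<partial>_{y`_l}> = J^{lk} + y`^k y`^l/(1 - \<theta>^2)\<close>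
definition Gy :: "nat \<Rightarrow> nat \<Rightarrow> nat \<Rightarrow> grass" where
  "Gy n k l = (\<lambda>S. Jmat l k * gconst 1 S + gmul (gmul (yup k) (yup l)) (inv1m n) S)"

definition sph_metric :: "nat \<Rightarrow> 'm::finite vfS \<Rightarrow> 'm vfS \<Rightarrow> 'm sfun" where
  "sph_metric n V W = (\<lambda>\<xi> S.
      gmul (\<lambda>T. gconst 1 T - theta2 n T)
           (\<lambda>T. \<Sum>a\<in>UNIV. \<Sum>b\<in>UNIV. \<Sum>c\<in>UNIV. \<Sum>d\<in>UNIV.
                 gmul (fst V a b \<xi>) (fst W c d \<xi>) T * round_metric a b c d \<xi>) S
    + (\<Sum>k\<in>{1..2*n}. \<Sum>l\<in>{1..2*n}. gmul (gmul (snd V k \<xi>) (ginv (snd W l \<xi>))) (Gy n k l) S))"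

end

theory Submission
  imports Defs
begin

text \<open>The operator (1/2r) d/dr is differentiation with respect to the squared radius, so on each ray the
  pullback is the (terminating) Taylor expansion about 1, evaluated at 1 - theta^2.
  Hence it multiplies a weight homogeneous of degree 2 a by the binomial series (1 - theta^2)^a. Writing
  a partial derivative as its radial part plus rotations, which commute with the radial derivative, and
  using that the odd derivative dual to y_q maps theta^2 to 2 y_q, gives (i). For (ii) the pullback sends
  X_i to xi_i (1 - theta^2)^(1/2) or to y_i, and both sides are compared for each parity of the four indices;
  the quadratic corrections in the odd coordinates cancel by anticommutativity.\<close>

text \<open>Two obstacles shape the proof. The given coefficient functions carry values at all sets
  of indices, whereas the claim concerns subsets of {1..2n} only. Cutting off the rest is an algebra
  homomorphism \<open>mkG\<close> into a type of class \<open>real_algebra_1\<close>, where both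
  sides of the claim can be compared by algebra. There t = -theta^2 is used instead of theta^2: it
  absorbs the alternating signs of the pullback and of the binomial series, and t^(n+1) = 0 makes
  the truncated series obey exact laws.

  The second obstacle is the origin. The radial operator divides by the radius, and splitting a
  partial derivative into radial and rotational parts brings in 1/|x|^2. Iterating the operator
  therefore leaves the functions smooth on the whole space, so the analysis takes place among
  functions smooth off the origin, compared off the origin; this suffices on the unit sphere. No
  homogeneity of f is available: a homogeneous weight has to be pulled out of its product with an
  arbitrary f, which is done by induction on the order, the exponent of the weight dropping by one
  at each radial derivative.\<close>

section \<open>Associativity and unit of the Grassmann product\<close>

lemma gsign_Un_left:
  assumes "finite A" "finite B" "finite C" "A \<inter> B = {}"
  shows "gsign (A \<union> B) C = gsign A C * gsign B C"
proof -
  have fin: "finite {(p, q). p \<in> X \<and> q \<in> C \<and> q < p}" if "finite X" for X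
    by (rule finite_subset[of _ "X \<times> C"]) (use that assms in auto)
  have "{(p, q). p \<in> A \<union> B \<and> q \<in> C \<and> q < p}
      = {(p, q). p \<in> A \<and> q \<in> C \<and> q < p} \<union> {(p, q). p \<in> B \<and> q \<in> C \<and> q < p}"
    by auto
  then have "card {(p, q). p \<in> A \<union> B \<and> q \<in> C \<and> q < p}
      = card {(p, q). p \<in> A \<and> q \<in> C \<and> q < p} + card {(p, q). p \<in> B \<and> q \<in> C \<and> q < p}"
    using fin[OF assms(1)] fin[OF assms(2)] assms(4) by (simp add: card_Un_disjoint disjoint_iff)
  then show ?thesis
    by (simp add: gsign_def power_add)
qed

lemma gsign_Un_right:
  assumes "finite A" "finite B" "finite C" "A \<inter> B = {}"
  shows "gsign C (A \<union> B) = gsign C A * gsign C B"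
proof -
  have fin: "finite {(p, q). p \<in> C \<and> q \<in> X \<and> q < p}" if "finite X" for X
    by (rule finite_subset[of _ "C \<times> X"]) (use that assms in auto)
  have "{(p, q). p \<in> C \<and> q \<in> A \<union> B \<and> q < p}
      = {(p, q). p \<in> C \<and> q \<in> A \<and> q < p} \<union> {(p, q). p \<in> C \<and> q \<in> B \<and> q < p}"
    by auto
  then have "card {(p, q). p \<in> C \<and> q \<in> A \<union> B \<and> q < p}
      = card {(p, q). p \<in> C \<and> q \<in> A \<and> q < p} + card {(p, q). p \<in> C \<and> q \<in> B \<and> q < p}"
    using fin[OF assms(1)] fin[OF assms(2)] assms(4) by (simp add: card_Un_disjoint disjoint_iff)
  then show ?thesis
    by (simp add: gsign_def power_add)
qed

lemma gmul_infinite: "infinite S \<Longrightarrow> gmul a b S = 0"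
  by (simp add: gmul_def)

text \<open>Both sides sum over ordered partitions of S into three blocks B, A - B, S - A. Since
  \<open>gsign\<close> counts inversions, it is multiplicative over disjoint unions, and either
  bracketing yields the product of the three pairwise signs.\<close>

lemma gmul_assoc: "gmul (gmul a b) c = gmul a (gmul b c)"
proof
  fix S
  show "gmul (gmul a b) c S = gmul a (gmul b c) S"
  proof (cases "finite S")
    case False
    then show ?thesis by (simp add: gmul_infinite)
  next
    case fin: True
    have "gmul (gmul a b) c S = (\<Sum>(A, B)\<in>Sigma (Pow S) Pow.
            gsign A (S - A) * (gsign B (A - B) * a B * b (A - B)) * c (S - A))"
      unfolding gmul_def
      using fin by (simp add: sum_distrib_left sum_distrib_right sum.Sigma finite_subset)
    also have "\<dots> = (\<Sum>(B, C)\<in>Sigma (Pow S) (\<lambda>B. Pow (S - B)).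
            gsign B (S - B) * a B * (gsign C (S - B - C) * b C * c (S - B - C)))"
    proof (rule sum.reindex_bij_witness[where i = "\<lambda>(B, C). (B \<union> C, B)" and j = "\<lambda>(A, B). (B, A - B)"],
        goal_cases)
      case (5 z)
      then obtain A B where z: "z = (A, B)" and sub: "A \<subseteq> S" "B \<subseteq> A" by auto
      have f: "finite A" "finite B" "finite (A - B)" "finite (S - A)"
        using sub fin by (auto intro: finite_subset)
      have e: "S - B - (A - B) = S - A" using sub by auto
      have A: "gsign A (S - A) = gsign B (S - A) * gsign (A - B) (S - A)"
        using gsign_Un_left[of B "A - B" "S - A"] f sub by (simp add: Un_absorb1)
      have "S - B = (A - B) \<union> (S - A)" using sub by auto
      then have "gsign B (S - B) = gsign B (A - B) * gsign B (S - A)"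
        using gsign_Un_right[of "A - B" "S - A" B] f by auto
      with A show ?case by (simp add: z e)
    qed auto
    also have "\<dots> = gmul a (gmul b c) S"
      unfolding gmul_def
      using fin by (simp add: sum_distrib_left sum_distrib_right sum.Sigma finite_subset)
    finally show ?thesis .
  qed
qed

lemma gsign_empty [simp]: "gsign {} A = 1" "gsign A {} = 1"
  by (simp_all add: gsign_def)

lemma gmul_gconst_left: "finite S \<Longrightarrow> gmul (gconst c) a S = c * a S"
proof -
  assume "finite S"
  have "gmul (gconst c) a S = (\<Sum>A\<in>Pow S. if A = {} then c * a S else 0)"
    unfolding gmul_def by (rule sum.cong) (auto simp: gconst_def)
  then show ?thesis using \<open>finite S\<close> by (simp add: sum.delta)
qed

lemma gmul_gconst_right: "finite S \<Longrightarrow> gmul a (gconst c) S = c * a S"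
proof -
  assume "finite S"
  have "gmul a (gconst c) S = (\<Sum>A\<in>Pow S. if A = S then c * a S else 0)"
    unfolding gmul_def by (rule sum.cong) (auto simp: gconst_def)
  then show ?thesis using \<open>finite S\<close> by (simp add: sum.delta)
qed

lemma gmul_one:
  assumes "\<forall>S. infinite S \<longrightarrow> a S = 0"
  shows "gmul (gconst 1) a = a" "gmul a (gconst 1) = a"
proof -
  have "gmul (gconst 1) a S = a S \<and> gmul a (gconst 1) S = a S" for S
    by (cases "finite S") (use assms in \<open>simp_all add: gmul_gconst_left gmul_gconst_right gmul_infinite\<close>)
  then show "gmul (gconst 1) a = a" "gmul a (gconst 1) = a" by auto
qed

lemma gmul_add_left: "gmul (\<lambda>S. a S + b S) c = (\<lambda>S. gmul a c S + gmul b c S)"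
  by (simp add: gmul_def fun_eq_iff algebra_simps sum.distrib)

lemma gmul_add_right: "gmul a (\<lambda>S. b S + c S) = (\<lambda>S. gmul a b S + gmul a c S)"
  by (simp add: gmul_def fun_eq_iff algebra_simps sum.distrib)

lemma gmul_scale_left: "gmul (\<lambda>S. r * a S) b = (\<lambda>S. r * gmul a b S)"
  by (simp add: gmul_def fun_eq_iff sum_distrib_left mult_ac)

lemma gmul_scale_right: "gmul a (\<lambda>S. r * b S) = (\<lambda>S. r * gmul a b S)"
  by (simp add: gmul_def fun_eq_iff sum_distrib_left mult_ac)

section \<open>The Grassmann algebra as a real algebra\<close>

text \<open>The product \<^const>\<open>gmul\<close> vanishes on infinite index sets, so the constant 1 is a unit only
  on coefficient functions that do so too.\<close>

typedef grassmann = "{a :: grass. \<forall>S. infinite S \<longrightarrow> a S = 0}"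
  morphisms gcoef Abs_grassmann
  by (rule exI[of _ "\<lambda>_. 0"]) simp

setup_lifting type_definition_grassmann

instantiation grassmann :: real_algebra_1
begin

lift_definition zero_grassmann :: grassmann is "\<lambda>_. 0" by simp
lift_definition one_grassmann :: grassmann is "gconst 1" by (auto simp: gconst_def)
lift_definition plus_grassmann :: "grassmann \<Rightarrow> grassmann \<Rightarrow> grassmann" is "\<lambda>a b S. a S + b S" by simp
lift_definition minus_grassmann :: "grassmann \<Rightarrow> grassmann \<Rightarrow> grassmann" is "\<lambda>a b S. a S - b S" by simp
lift_definition uminus_grassmann :: "grassmann \<Rightarrow> grassmann" is "\<lambda>a S. - a S" by simp
lift_definition scaleR_grassmann :: "real \<Rightarrow> grassmann \<Rightarrow> grassmann" is "\<lambda>r a S. r * a S" by simp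
lift_definition times_grassmann :: "grassmann \<Rightarrow> grassmann \<Rightarrow> grassmann" is gmul
  by (simp add: gmul_infinite)

instance
proof
  fix a b c :: grassmann and r s :: real
  show "1 * a = a"
    by transfer (rule gmul_one)
  show "a * 1 = a"
    by transfer (rule gmul_one)
  show "(0::grassmann) \<noteq> 1"
    by transfer (auto simp: gconst_def fun_eq_iff)
qed (transfer; simp add: fun_eq_iff gmul_assoc gmul_add_left gmul_add_right gmul_scale_left
    gmul_scale_right algebra_simps)+

end

section \<open>Cutting off to the generators 1..2n\<close>

lift_definition mkG :: "nat \<Rightarrow> grass \<Rightarrow> grassmann" is "\<lambda>n a S. if S \<subseteq> {1..2*n} then a S else 0"
  by (auto dest: finite_subset)

lift_definition dG :: "nat \<Rightarrow> grassmann \<Rightarrow> grassmann" is gder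
  by (simp add: gder_def)

lift_definition yG :: "nat \<Rightarrow> grassmann" is ggen
  by (auto simp: ggen_def)

lift_definition invG :: "grassmann \<Rightarrow> grassmann" is ginv
  by (simp add: ginv_def)

lemma mkG_eqI: "(\<And>S. S \<subseteq> {1..2*n} \<Longrightarrow> a S = b S) \<Longrightarrow> mkG n a = mkG n b"
  by transfer (simp add: fun_eq_iff)

lemma mkG_eqD: "mkG n a = mkG n b \<Longrightarrow> S \<subseteq> {1..2*n} \<Longrightarrow> a S = b S"
  by (metis mkG.rep_eq)

text \<open>If S lies in {1..2n}, so do both parts of every split of S; otherwise each split has a
  part outside, where a cut-off factor vanishes.\<close>

lemma mkG_gmul: "mkG n (gmul a b) = mkG n a * mkG n b"
proof (transfer, rule ext)
  fix n a b S
  show "(if S \<subseteq> {1..2*n} then gmul a b S else 0)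
      = gmul (\<lambda>S. if S \<subseteq> {1..2*n} then a S else 0) (\<lambda>S. if S \<subseteq> {1..2*n} then b S else 0) S"
  proof (cases "S \<subseteq> {1..2*n}")
    case True
    then have "A \<subseteq> {1..2*n} \<and> S - A \<subseteq> {1..2*n}" if "A \<subseteq> S" for A using that by blast
    then show ?thesis using True unfolding gmul_def by (auto intro!: sum.cong)
  next
    case False
    then have "\<not> (A \<subseteq> {1..2*n} \<and> S - A \<subseteq> {1..2*n})" for A by blast
    then have "gmul (\<lambda>S. if S \<subseteq> {1..2*n} then a S else 0)
        (\<lambda>S. if S \<subseteq> {1..2*n} then b S else 0) S = 0"
      unfolding gmul_def by (intro sum.neutral) simp
    then show ?thesis using False by simp
  qed
qed

lemma mkG_add: "mkG n (\<lambda>S. a S + b S) = mkG n a + mkG n b"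
  by transfer (simp add: fun_eq_iff)

lemma mkG_diff: "mkG n (\<lambda>S. a S - b S) = mkG n a - mkG n b"
  by transfer (simp add: fun_eq_iff)

lemma mkG_uminus: "mkG n (\<lambda>S. - a S) = - mkG n a"
  by transfer (simp add: fun_eq_iff)

lemma mkG_scale: "mkG n (\<lambda>S. r * a S) = r *\<^sub>R mkG n a"
  by transfer (simp add: fun_eq_iff)

lemma mkG_zero: "mkG n (\<lambda>S. 0) = 0"
  by transfer (simp add: fun_eq_iff)

lemma mkG_sum: "mkG n (\<lambda>S. \<Sum>i\<in>I. a i S) = (\<Sum>i\<in>I. mkG n (a i))"
  by (induction I rule: infinite_finite_induct) (simp_all add: mkG_zero mkG_add)

lemma mkG_gconst: "mkG n (gconst c) = c *\<^sub>R 1"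
  by transfer (auto simp: fun_eq_iff gconst_def)

text \<open>The derivative at S reads the coefficient at \<open>insert l S\<close>, which survives
  the cut-off only for l in range.\<close>

lemma mkG_gder: "l \<in> {1..2*n} \<Longrightarrow> mkG n (gder l a) = dG l (mkG n a)"
  by transfer (auto simp: fun_eq_iff gder_def)

lemma mkG_ggen: "p \<in> {1..2*n} \<Longrightarrow> mkG n (ggen p) = yG p"
  by transfer (auto simp: fun_eq_iff ggen_def)

lemma mkG_ginv: "mkG n (ginv a) = invG (mkG n a)"
  by transfer (auto simp: fun_eq_iff ginv_def)

lemma dG_add: "dG l (a + b) = dG l a + dG l b"
  by transfer (simp add: fun_eq_iff gder_def algebra_simps)

lemma dG_scaleR: "dG l (r *\<^sub>R a) = r *\<^sub>R dG l a"
  by transfer (simp add: fun_eq_iff gder_def algebra_simps)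

lemma dG_zero: "dG l 0 = 0"
  by transfer (simp add: fun_eq_iff gder_def)

lemma dG_sum: "dG l (\<Sum>i\<in>I. a i) = (\<Sum>i\<in>I. dG l (a i))"
  by (induction I rule: infinite_finite_induct) (simp_all add: dG_add dG_zero)

lemma invG_scaleR: "invG (r *\<^sub>R a) = r *\<^sub>R invG a"
  by transfer (simp add: fun_eq_iff ginv_def algebra_simps)

lemma invG_add: "invG (a + b) = invG a + invG b"
  by transfer (simp add: fun_eq_iff ginv_def algebra_simps)

lemma invG_zero: "invG 0 = 0"
  by transfer (simp add: fun_eq_iff ginv_def)

lemma invG_one: "invG 1 = 1"
  by transfer (auto simp add: fun_eq_iff ginv_def gconst_def)

lemma invG_sum: "invG (\<Sum>i\<in>I. a i) = (\<Sum>i\<in>I. invG (a i))"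
  by (induction I rule: infinite_finite_induct) (simp_all add: invG_add invG_zero)

lemma invG_yG: "invG (yG p) = - yG p"
  by transfer (auto simp add: fun_eq_iff ginv_def ggen_def)

text \<open>\<open>invG\<close> is the parity automorphism: cardinalities add over a split, so its
  sign is multiplicative. It encodes the sign (-1)^|h| of a graded bilinear form for coefficients h
  that need not be homogeneous.\<close>

lemma invG_mult: "invG (a * b) = invG a * invG b"
proof (transfer, rule ext)
  fix a b S
  show "ginv (gmul a b) S = gmul (ginv a) (ginv b) S"
  proof (cases "finite S")
    case False
    then show ?thesis by (simp add: ginv_def gmul_infinite)
  next
    case True
    have "(-1::real) ^ card S = (-1) ^ card A * (-1) ^ card (S - A)" if "A \<subseteq> S" for A
      using that True
      by (metis card_Diff_subset card_mono finite_subset le_add_diff_inverse power_add)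
    then show ?thesis
      unfolding ginv_def gmul_def sum_distrib_left by (intro sum.cong) auto
  qed
qed

lemma invG_power: "invG (a ^ k) = invG a ^ k"
  by (induction k) (simp_all add: invG_one invG_mult)

section \<open>Generators and odd derivatives\<close>

text \<open>The sign of moving the generator p past the generators of S with smaller index. Left
  multiplication by a generator and the odd derivative share it, so their relations reduce to how it
  changes when one index is added or removed.\<close>

definition sign_below :: "nat \<Rightarrow> nat set \<Rightarrow> real" where
  "sign_below p S = (-1) ^ card {s\<in>S. s < p}"

lemma gder_eq: "gder l a S = (if l \<in> S then 0 else sign_below l S * a (insert l S))"
  by (simp add: gder_def sign_below_def)

lemma sign_below_square: "sign_below p S * (sign_below p S * c) = c"
  unfolding sign_below_def mult.assoc[symmetric] power_add[symmetric] mult_2[symmetric] by simp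

lemma gmul_ggen_left:
  assumes "finite S"
  shows "gmul (ggen p) a S = (if p \<in> S then sign_below p S * a (S - {p}) else 0)"
proof -
  have "{(x, q). x \<in> {p} \<and> q \<in> S - {p} \<and> q < x} = Pair p ` {s\<in>S. s < p}" by auto
  then have sg: "gsign {p} (S - {p}) = sign_below p S"
    by (simp add: gsign_def sign_below_def card_image inj_on_def)
  have "gmul (ggen p) a S = (\<Sum>A\<in>Pow S. if A = {p} then gsign {p} (S - {p}) * a (S - {p}) else 0)"
    unfolding gmul_def by (rule sum.cong) (auto simp: ggen_def)
  then show ?thesis using assms by (simp add: sum.delta sg)
qed

lemma sign_below_insert:
  fixes l :: nat
  assumes "finite S" "l \<notin> S"
  shows "sign_below p (insert l S) = (if l < p then - 1 else 1) * sign_below p S"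
proof -
  have "{s\<in>insert l S. s < p} = (if l < p then insert l {s\<in>S. s < p} else {s\<in>S. s < p})"
    by auto
  then show ?thesis using assms by (auto simp: sign_below_def)
qed

lemma sign_below_remove:
  fixes l :: nat
  assumes "finite S" "l \<in> S"
  shows "sign_below p (S - {l}) = (if l < p then - 1 else 1) * sign_below p S"
  using sign_below_insert[of "S - {l}" l p] assms by (auto simp: insert_absorb)

text \<open>For distinct p and q exactly one of p < q and q < p holds, so removing the other index
  flips precisely one of the two signs. For p = q both sides vanish, since the index is already gone
  at the second removal.\<close>

lemma gmul_ggen_anticommute: "gmul (ggen p) (gmul (ggen q) a) S = - gmul (ggen q) (gmul (ggen p) a) S"
proof (cases "finite S \<and> p \<noteq> q")
  case True
  moreover have "S - {p} - {q} = S - {q} - {p}" by auto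
  ultimately show ?thesis
    by (auto simp: gmul_ggen_left sign_below_remove)
qed (cases "finite S"; auto simp: gmul_infinite gmul_ggen_left)

lemma gder_gmul_ggen:
  assumes "finite S"
  shows "gder l (gmul (ggen p) a) S = (if l = p then a S else 0) - gmul (ggen p) (gder l a) S"
  using assms
  by (auto simp: gder_eq gmul_ggen_left sign_below_remove sign_below_insert insert_Diff_if
      insert_absorb sign_below_square)

lemma yG_anticommute_left: "yG p * (yG q * a) = - (yG q * (yG p * a))"
  by transfer (rule ext, rule gmul_ggen_anticommute)

lemma yG_anticommute: "yG p * yG q = - (yG q * yG p)"
  using yG_anticommute_left[of p q 1] by simp

lemma dG_yG_mult: "dG l (yG p * a) = (if l = p then a else 0) - yG p * dG l a"
proof (transfer, rule ext)
  fix l p and a :: grass and S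
  assume a: "\<forall>S. infinite S \<longrightarrow> a S = (0::real)"
  show "gder l (gmul (ggen p) a) S = (if l = p then a else (\<lambda>_. 0)) S - gmul (ggen p) (gder l a) S"
  proof (cases "finite S")
    case True
    then show ?thesis by (simp add: gder_gmul_ggen)
  next
    case False
    then show ?thesis using a by (simp add: gder_def gmul_infinite)
  qed
qed

text \<open>The element \<open>tG n\<close> is minus theta squared.\<close>

definition tG :: "nat \<Rightarrow> grassmann" where
  "tG n = (\<Sum>k=1..n. yG (2*k-1) * yG (2*k))"

lemma mkG_theta2: "mkG n (theta2 n) = - tG n"
proof -
  have "mkG n (gmul (ggen (2*k-1)) (ggen (2*k))) = yG (2*k-1) * yG (2*k)" if "k \<in> {1..n}" for k
    using that by (subst mkG_gmul, subst (1 2) mkG_ggen) auto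
  then show ?thesis
    by (simp add: theta2_def mkG_uminus mkG_sum tG_def)
qed

lemma mkG_gpow_theta2: "mkG n (gpow (theta2 n) k) = (- tG n) ^ k"
  by (induction k) (simp_all add: gpow_def mkG_gconst mkG_gmul mkG_theta2)

text \<open>Each summand of t is a product of two generators; passing both costs two signs.\<close>

lemma yG_tG_commute: "yG p * tG n = tG n * yG p"
proof -
  have "yG p * (yG q * yG r) = yG q * yG r * yG p" for q r
    by (simp add: yG_anticommute_left[of p q] yG_anticommute[of p r] mult.assoc)
  then show ?thesis
    by (simp add: tG_def sum_distrib_left sum_distrib_right)
qed

lemma yG_tG_power_commute: "yG p * tG n ^ k = tG n ^ k * yG p"
  by (metis power_commuting_commutes yG_tG_commute)

lemma invG_tG: "invG (tG n) = tG n"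
  by (simp add: tG_def invG_sum invG_mult invG_yG)

section \<open>Degree and nilpotency\<close>

text \<open>Zero is homogeneous of every degree. This is what allows vanishing to be proved by
  counting: an element of degree above 2n has no set left to be supported on.\<close>

definition homogeneous :: "nat \<Rightarrow> nat \<Rightarrow> grassmann \<Rightarrow> bool" where
  "homogeneous n d a \<longleftrightarrow> (\<forall>S. gcoef a S \<noteq> 0 \<longrightarrow> card S = d \<and> S \<subseteq> {1..2*n})"

lemma homogeneous_mult:
  assumes "homogeneous n d a" "homogeneous n e b"
  shows "homogeneous n (d + e) (a * b)"
  unfolding homogeneous_def
proof (intro allI impI)
  fix S
  assume "gcoef (a * b) S \<noteq> 0"
  then have "gmul (gcoef a) (gcoef b) S \<noteq> 0" by (simp add: times_grassmann.rep_eq)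
  then obtain A where A: "A \<subseteq> S" "gcoef a A \<noteq> 0" "gcoef b (S - A) \<noteq> 0"
    unfolding gmul_def by (metis (no_types, lifting) PowD mult_eq_0_iff sum.neutral)
  then have *: "card A = d" "card (S - A) = e" "A \<subseteq> {1..2*n}" "S - A \<subseteq> {1..2*n}"
    using assms unfolding homogeneous_def by blast+
  then have "S \<subseteq> {1..2*n}" by blast
  moreover from this have "finite S" by (rule finite_subset) simp
  ultimately show "card S = d + e \<and> S \<subseteq> {1..2*n}"
    using A(1) *(1,2) card_Diff_subset[of A S] card_mono[of S A] finite_subset[of A S] by auto
qed

lemma homogeneous_imp_0: "homogeneous n d a \<Longrightarrow> d > 2 * n \<Longrightarrow> a = 0"
proof -
  assume a: "homogeneous n d a" "d > 2 * n"
  have "gcoef a S = 0" for S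
  proof (rule ccontr)
    assume "gcoef a S \<noteq> 0"
    then have "card S = d" "S \<subseteq> {1..2*n}" using a(1) by (auto simp: homogeneous_def)
    then show False using a(2) card_mono[of "{1..2*n}" S] by simp
  qed
  then show ?thesis by (metis gcoef_inverse zero_grassmann.abs_eq ext)
qed

lemma homogeneous_yG: "p \<in> {1..2*n} \<Longrightarrow> homogeneous n 1 (yG p)"
  by (auto simp: homogeneous_def yG.rep_eq ggen_def)

lemma homogeneous_add: "homogeneous n d a \<Longrightarrow> homogeneous n d b \<Longrightarrow> homogeneous n d (a + b)"
  unfolding homogeneous_def plus_grassmann.rep_eq by (metis add.right_neutral)

lemma homogeneous_zero: "homogeneous n d 0"
  by (simp add: homogeneous_def zero_grassmann.rep_eq)

lemma homogeneous_sum: "(\<And>i. i \<in> I \<Longrightarrow> homogeneous n d (a i)) \<Longrightarrow> homogeneous n d (\<Sum>i\<in>I. a i)"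
  by (induction I rule: infinite_finite_induct) (auto intro: homogeneous_add homogeneous_zero)

lemma homogeneous_tG: "homogeneous n 2 (tG n)"
  unfolding tG_def
  by (intro homogeneous_sum homogeneous_mult[of n 1 _ 1, unfolded one_add_one] homogeneous_yG) auto

lemma homogeneous_tG_power: "homogeneous n (2 * k) (tG n ^ k)"
proof (induction k)
  case 0
  show ?case by (auto simp: homogeneous_def one_grassmann.rep_eq gconst_def)
next
  case (Suc k)
  then show ?case using homogeneous_mult[OF homogeneous_tG Suc.IH] by simp
qed

lemma tG_power_eq_0: "k > n \<Longrightarrow> tG n ^ k = 0"
  using homogeneous_imp_0[OF homogeneous_tG_power] by simp

text \<open>The degree is 2n + 1. While t^n itself need not vanish, this lets a sum with a factor
  y_p end at n - 1 or at n alike, as needed when an odd derivative shifts the index of the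
  pullback.\<close>

lemma yG_tG_power_eq_0: "p \<in> {1..2*n} \<Longrightarrow> yG p * tG n ^ n = 0"
  using homogeneous_imp_0[OF homogeneous_mult[OF homogeneous_yG homogeneous_tG_power]] by simp

section \<open>Powers of 1 - theta^2\<close>

text \<open>This is (1 + t)^\<alpha> = (1 - theta^2)^\<alpha>. The exponents 1/2, -1/2, -1 and 1
  give the given square root, its inverse, the geometric series and the factor of the round
  metric.\<close>

definition bG :: "nat \<Rightarrow> real \<Rightarrow> grassmann" where
  "bG n \<alpha> = (\<Sum>k\<le>n. (\<alpha> gchoose k) *\<^sub>R tG n ^ k)"

text \<open>The factors h j are arbitrary, so that the same identity yields the exponent law of
  \<open>bG\<close> and the product of \<open>bG\<close> with a pullback.\<close>

lemma truncated_Cauchy_product: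
  "(\<Sum>k\<le>n. a k *\<^sub>R tG n ^ k) * (\<Sum>j\<le>n. tG n ^ j * h j)
     = (\<Sum>j\<le>n. tG n ^ j * (\<Sum>k\<le>j. a k *\<^sub>R h (j - k)))"
proof -
  let ?F = "\<lambda>k i. tG n ^ (k + i) * (a k *\<^sub>R h i)"
  have "(\<Sum>k\<le>n. a k *\<^sub>R tG n ^ k) * (\<Sum>j\<le>n. tG n ^ j * h j) = (\<Sum>k\<le>n. \<Sum>i\<le>n. ?F k i)"
    by (simp add: sum_product power_add mult.assoc)
  also have "\<dots> = (\<Sum>(k, i)\<in>{..n} \<times> {..n}. ?F k i)"
    by (simp add: sum.cartesian_product)
  \<comment> \<open>The part of the square beyond the triangle carries powers of t above n, which
    are zero.\<close>
  also have "\<dots> = (\<Sum>(k, i)\<in>{(k, i). k + i \<le> n}. ?F k i)"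
    by (rule sum.mono_neutral_right) (auto simp: tG_power_eq_0, metis mult_zero_left not_le tG_power_eq_0)
  also have "\<dots> = (\<Sum>j\<le>n. \<Sum>k\<le>j. ?F k (j - k))"
    by (rule sum.triangle_reindex_eq)
  also have "\<dots> = (\<Sum>j\<le>n. tG n ^ j * (\<Sum>k\<le>j. a k *\<^sub>R h (j - k)))"
    by (simp add: sum_distrib_left)
  finally show ?thesis .
qed

text \<open>The inner sum of the Cauchy product is Vandermonde's convolution of generalized binomial
  coefficients.\<close>

lemma bG_mult: "bG n \<alpha> * bG n \<beta> = bG n (\<alpha> + \<beta>)"
proof -
  have "bG n \<alpha> * bG n \<beta> = (\<Sum>k\<le>n. (\<alpha> gchoose k) *\<^sub>R tG n ^ k) * (\<Sum>j\<le>n. tG n ^ j * ((\<beta> gchoose j) *\<^sub>R 1))"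
    by (simp add: bG_def)
  also have "\<dots> = bG n (\<alpha> + \<beta>)"
    unfolding truncated_Cauchy_product bG_def
    by (simp add: gbinomial_Vandermonde atMost_atLeast0 flip: scaleR_sum_left)
  finally show ?thesis .
qed

lemma bG_0: "bG n 0 = 1"
proof -
  have "bG n 0 = (\<Sum>k\<le>n. if k = 0 then 1 else 0)"
    unfolding bG_def by (rule sum.cong) (auto simp: gbinomial_0_left)
  then show ?thesis by simp
qed

lemma bG_1: "bG n 1 = 1 + tG n"
proof -
  have "(1::real) gchoose k = 0" if "k \<ge> 2" for k
    using that binomial_gbinomial[of 1 k, where ?'a = real] by (simp add: binomial_eq_0)
  then have "bG n 1 = (\<Sum>k\<le>n. if k = 0 then 1 else if k = 1 then tG n else 0)"
    unfolding bG_def by (intro sum.cong) (auto simp: not_less_eq_eq numeral_2_eq_2)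
  also have "\<dots> = (\<Sum>k\<le>n. if k = 0 then 1 else 0) + (\<Sum>k\<le>n. if k = 1 then tG n else 0)"
    unfolding sum.distrib[symmetric] by (rule sum.cong) auto
  \<comment> \<open>For n = 0 the linear term is truncated from the series, but then t itself is
    zero.\<close>
  also have "\<dots> = 1 + tG n"
    using tG_power_eq_0[of n 1] by (cases n) auto
  finally show ?thesis .
qed

lemma mkG_binomial_series:
  "mkG n (\<lambda>S. \<Sum>k\<le>n. (\<alpha> gchoose k) * (-1) ^ k * gpow (theta2 n) k S) = bG n \<alpha>"
proof -
  have "(-1) ^ k *\<^sub>R (- tG n) ^ k = tG n ^ k" for k
    by (cases "even k") simp_all
  then show ?thesis
    by (simp add: mkG_sum mkG_scale mkG_gpow_theta2 bG_def flip: scaleR_scaleR)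
qed

lemma mkG_sqrt1m: "mkG n (sqrt1m n) = bG n (1/2)"
  unfolding sqrt1m_def by (rule mkG_binomial_series)

lemma mkG_invsqrt1m: "mkG n (invsqrt1m n) = bG n (-1/2)"
  unfolding invsqrt1m_def by (rule mkG_binomial_series)

lemma mkG_inv1m: "mkG n (inv1m n) = bG n (-1)"
proof -
  have "(-1::real) gchoose k = (-1) ^ k" for k
    using gbinomial_minus[of "1::real" k] binomial_gbinomial[of k k, where ?'a = real] by simp
  then have "inv1m n = (\<lambda>S. \<Sum>k\<le>n. ((-1::real) gchoose k) * (-1) ^ k * gpow (theta2 n) k S)"
    by (simp add: inv1m_def fun_eq_iff flip: power_mult_distrib)
  then show ?thesis by (simp only: mkG_binomial_series)
qed

lemma yG_bG_commute: "yG p * bG n \<alpha> = bG n \<alpha> * yG p"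
  by (simp add: bG_def sum_distrib_left sum_distrib_right yG_tG_power_commute)

lemma invG_bG: "invG (bG n \<alpha>) = bG n \<alpha>"
  by (simp add: bG_def invG_sum invG_scaleR invG_power invG_tG)

section \<open>Functions that are smooth away from the origin\<close>

lemma epart_eq:
  assumes "(g has_derivative g') (at x)"
  shows "epart i g x = g' (axis i 1)"
proof -
  have "((\<lambda>t. x + t *\<^sub>R axis i 1) has_derivative (\<lambda>t. t *\<^sub>R axis i 1)) (at (0::real))"
    by (auto intro!: derivative_eq_intros)
  then have "((\<lambda>t. g (x + t *\<^sub>R axis i 1)) has_derivative (\<lambda>t. g' (t *\<^sub>R axis i 1))) (at 0)"
    using has_derivative_compose[of "\<lambda>t. x + t *\<^sub>R axis i 1" _ 0 UNIV g g'] assms by simp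
  moreover have "g' (t *\<^sub>R axis i 1) = g' (axis i 1) * t" for t
    using linear_scale[OF has_derivative_linear[OF assms]] by (simp add: mult.commute)
  ultimately show ?thesis
    unfolding epart_def by (intro DERIV_imp_deriv) (simp add: has_field_derivative_def)
qed

lemma differentiable_has_derivative_epart:
  fixes g :: "real^'m::finite \<Rightarrow> real"
  assumes "g differentiable (at x)"
  shows "(g has_derivative (\<lambda>v. \<Sum>i\<in>UNIV. v $ i * epart i g x)) (at x)"
proof -
  obtain g' where g': "(g has_derivative g') (at x)"
    using assms by (auto simp: differentiable_def)
  note lin = has_derivative_linear[OF g']
  have "g' v = (\<Sum>i\<in>UNIV. v $ i * epart i g x)" for v
  proof -
    have "g' v = g' (\<Sum>i\<in>UNIV. v $ i *\<^sub>R axis i 1)"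
      using basis_expansion[of v] by (simp add: scalar_mult_eq_scaleR)
    then show ?thesis
      by (simp add: linear_sum[OF lin] linear_scale[OF lin] epart_eq[OF g'])
  qed
  then have "g' = (\<lambda>v. \<Sum>i\<in>UNIV. v $ i * epart i g x)" by auto
  with g' show ?thesis by simp
qed

text \<open>The chain rule in the form that serves straight lines, radial lines and rotation orbits
  alike.\<close>

lemma DERIV_along_curve:
  fixes g :: "real^'m::finite \<Rightarrow> real"
  assumes "g differentiable (at (c 0))" "(c has_vector_derivative v) (at 0)"
  shows "((\<lambda>t. g (c t)) has_real_derivative (\<Sum>i\<in>UNIV. v $ i * epart i g (c 0))) (at 0)"
proof -
  have "((\<lambda>t. g (c t)) has_derivative (\<lambda>t. \<Sum>i\<in>UNIV. (t *\<^sub>R v) $ i * epart i g (c 0))) (at 0)"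
    using has_derivative_compose[of c _ 0 UNIV g] assms differentiable_has_derivative_epart
    unfolding has_vector_derivative_def by blast
  moreover have "(\<lambda>t. \<Sum>i\<in>UNIV. (t *\<^sub>R v) $ i * epart i g (c 0)) = (*) (\<Sum>i\<in>UNIV. v $ i * epart i g (c 0))"
    by (auto simp: sum_distrib_left mult_ac)
  ultimately show ?thesis by (simp add: has_field_derivative_def)
qed

section \<open>Calculus off the origin\<close>

text \<open>At the origin \<open>deriv\<close> and \<open>inverse\<close> may return default values,
  so differentiation rules are claimed elsewhere only. Since the complement of the origin is open,
  this relation is preserved by partial, radial and rotational derivatives and can be
  iterated.\<close>

definition agree0 :: "(real^'m::finite \<Rightarrow> real) \<Rightarrow> (real^'m \<Rightarrow> real) \<Rightarrow> bool" where
  "agree0 g h \<longleftrightarrow> (\<forall>x. x \<noteq> 0 \<longrightarrow> g x = h x)"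

lemma agree0_trans [trans]: "agree0 f g \<Longrightarrow> agree0 g h \<Longrightarrow> agree0 f h"
  by (simp add: agree0_def)

lemma eventually_line_nonzero:
  fixes x v :: "real^'m::finite"
  assumes "x \<noteq> 0"
  shows "\<forall>\<^sub>F t in nhds 0. x + t *\<^sub>R v \<noteq> 0"
proof -
  have "((\<lambda>t. x + t *\<^sub>R v) \<longlongrightarrow> x + 0 *\<^sub>R v) (nhds 0)"
    by (intro tendsto_intros filterlim_ident)
  then have "((\<lambda>t. x + t *\<^sub>R v) \<longlongrightarrow> x) (nhds 0)" by simp
  then show ?thesis
    by (rule tendsto_imp_eventually_ne) (rule assms)
qed

lemma epart_cong:
  assumes "agree0 g h" "x \<noteq> 0"
  shows "epart i g x = epart i h x"
proof -
  have "\<forall>\<^sub>F t in nhds 0. g (x + t *\<^sub>R axis i 1) = h (x + t *\<^sub>R axis i 1)"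
    using eventually_line_nonzero[OF assms(2), of "axis i 1"] by (rule eventually_mono) (use assms(1) in \<open>simp add: agree0_def\<close>)
  then show ?thesis unfolding epart_def by (rule deriv_cong_ev) simp
qed

lemma differentiable_agree0:
  assumes "agree0 g h" "x \<noteq> 0" "g differentiable (at x)"
  shows "h differentiable (at x)"
proof -
  obtain g' where g': "(g has_derivative g') (at x)" using assms(3) by (auto simp: differentiable_def)
  have "(h has_derivative g') (at x)"
    by (rule has_derivative_transform_within_open[OF g', of "- {0}"])
       (use assms in \<open>auto simp: agree0_def\<close>)
  then show ?thesis by (auto simp: differentiable_def)
qed

text \<open>Recursion on the order instead of on a list of directions makes closure under products a
  plain induction. Excluding the origin admits 1/|x|^2 to the class.\<close>

fun diffk :: "nat \<Rightarrow> (real^'m::finite \<Rightarrow> real) \<Rightarrow> bool" where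
  "diffk 0 g \<longleftrightarrow> (\<forall>x. x \<noteq> 0 \<longrightarrow> g differentiable (at x))"
| "diffk (Suc k) g \<longleftrightarrow> (\<forall>x. x \<noteq> 0 \<longrightarrow> g differentiable (at x)) \<and> (\<forall>i. diffk k (epart i g))"

definition smooth0 :: "(real^'m::finite \<Rightarrow> real) \<Rightarrow> bool" where
  "smooth0 g \<longleftrightarrow> (\<forall>k. diffk k g)"

lemma diffk_cong: "agree0 g h \<Longrightarrow> diffk k g \<Longrightarrow> diffk k h"
proof (induction k arbitrary: g h)
  case 0
  then show ?case by (auto intro: differentiable_agree0)
next
  case (Suc k)
  have "agree0 (epart i g) (epart i h)" for i
    using Suc.prems(1) epart_cong by (auto simp: agree0_def)
  then have "diffk k (epart i h)" for i
    using Suc.IH Suc.prems(2) by (meson diffk.simps(2))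
  with Suc.prems show ?case by (auto intro: differentiable_agree0)
qed

lemma diffk_Suc_imp: "diffk (Suc k) g \<Longrightarrow> diffk k g"
  by (induction k arbitrary: g) auto

lemma diffk_imp_differentiable: "diffk k g \<Longrightarrow> x \<noteq> 0 \<Longrightarrow> g differentiable (at x)"
  by (cases k) auto

lemma epart_add:
  assumes "g differentiable (at x)" "h differentiable (at x)"
  shows "epart i (\<lambda>x. g x + h x) x = epart i g x + epart i h x"
proof -
  obtain g' h' where d: "(g has_derivative g') (at x)" "(h has_derivative h') (at x)"
    using assms by (auto simp: differentiable_def)
  show ?thesis
    using epart_eq[OF has_derivative_add[OF d]] by (simp add: epart_eq[OF d(1)] epart_eq[OF d(2)])
qed

lemma epart_diff:
  assumes "g differentiable (at x)" "h differentiable (at x)"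
  shows "epart i (\<lambda>x. g x - h x) x = epart i g x - epart i h x"
proof -
  obtain g' h' where d: "(g has_derivative g') (at x)" "(h has_derivative h') (at x)"
    using assms by (auto simp: differentiable_def)
  show ?thesis
    using epart_eq[OF has_derivative_diff[OF d]] by (simp add: epart_eq[OF d(1)] epart_eq[OF d(2)])
qed

lemma epart_mult:
  assumes "g differentiable (at x)" "h differentiable (at x)"
  shows "epart i (\<lambda>x. g x * h x) x = epart i g x * h x + g x * epart i h x"
proof -
  obtain g' h' where d: "(g has_derivative g') (at x)" "(h has_derivative h') (at x)"
    using assms by (auto simp: differentiable_def)
  show ?thesis
    using epart_eq[OF has_derivative_mult[OF d]] by (simp add: epart_eq[OF d(1)] epart_eq[OF d(2)])
qed

lemma epart_const: "epart i (\<lambda>x. c) x = 0"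
  using epart_eq[of "\<lambda>x. c" "\<lambda>_. 0"] by simp

lemma epart_coord: "epart i (\<lambda>x. x $ j) x = (if i = j then 1 else 0)"
  using epart_eq[OF bounded_linear_imp_has_derivative[OF bounded_linear_vec_nth], of i j x]
  by (simp add: axis_def eq_commute)

lemma diffk_const: "diffk k (\<lambda>x::real^'m::finite. c)"
proof (induction k arbitrary: c)
  case (Suc k)
  have "epart i (\<lambda>x::real^'m. c) = (\<lambda>x. 0)" for i by (auto simp: epart_const)
  with Suc show ?case by simp
qed simp

lemma differentiable_coord: "(\<lambda>x::real^'m::finite. x $ j) differentiable (at x)"
  by (auto simp: differentiable_def intro!: bounded_linear_imp_has_derivative bounded_linear_vec_nth)

lemma diffk_coord: "diffk k (\<lambda>x::real^'m::finite. x $ j)"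
proof (cases k)
  case (Suc l)
  have "epart i (\<lambda>x::real^'m. x $ j) = (\<lambda>x. if i = j then 1 else 0)" for i by (auto simp: epart_coord)
  with Suc show ?thesis by (simp add: diffk_const differentiable_coord)
qed (simp add: differentiable_coord)

lemma diffk_add: "diffk k g \<Longrightarrow> diffk k h \<Longrightarrow> diffk k (\<lambda>x. g x + h x)"
proof (induction k arbitrary: g h)
  case (Suc k)
  have "agree0 (\<lambda>x. epart i g x + epart i h x) (epart i (\<lambda>x. g x + h x))" for i
    using Suc.prems by (auto simp: agree0_def epart_add)
  moreover have "diffk k (\<lambda>x. epart i g x + epart i h x)" for i
    using Suc by simp
  ultimately have "diffk k (epart i (\<lambda>x. g x + h x))" for i
    using diffk_cong by blast
  then show ?case using Suc.prems by simp
qed simp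

text \<open>In each term of the product rule one factor stays undifferentiated, so its order has to
  be lowered first by \<open>diffk_Suc_imp\<close>. The rule is available off the origin, whence the
  passage through \<open>agree0\<close>.\<close>

lemma diffk_mult: "diffk k g \<Longrightarrow> diffk k h \<Longrightarrow> diffk k (\<lambda>x. g x * h x)"
proof (induction k arbitrary: g h)
  case (Suc k)
  have "agree0 (\<lambda>x. epart i g x * h x + g x * epart i h x) (epart i (\<lambda>x. g x * h x))" for i
    using Suc.prems by (auto simp: agree0_def epart_mult)
  moreover have "diffk k (\<lambda>x. epart i g x * h x + g x * epart i h x)" for i
    using Suc.prems diffk_Suc_imp[OF Suc.prems(1)] diffk_Suc_imp[OF Suc.prems(2)]
    by (intro diffk_add Suc.IH) auto
  ultimately have "diffk k (epart i (\<lambda>x. g x * h x))" for i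
    using diffk_cong by blast
  then show ?case using Suc.prems by simp
qed simp

lemma has_derivative_inverse_inner:
  fixes x :: "real^'m::finite"
  assumes "x \<noteq> 0"
  shows "((\<lambda>x. inverse (x \<bullet> x)) has_derivative (\<lambda>v. - 2 * (x \<bullet> v) * (inverse (x \<bullet> x) * inverse (x \<bullet> x)))) (at x)"
  using assms by (auto intro!: derivative_eq_intros simp: inner_commute algebra_simps)

lemma epart_inverse_inner:
  fixes x :: "real^'m::finite"
  assumes "x \<noteq> 0"
  shows "epart i (\<lambda>x. inverse (x \<bullet> x)) x = - 2 * (x $ i) * (inverse (x \<bullet> x) * inverse (x \<bullet> x))"
  using epart_eq[OF has_derivative_inverse_inner[OF assms], of i] by (simp add: inner_axis)

text \<open>Its partial derivatives are products of a coordinate, a constant and the function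
  itself, so the induction closes.\<close>

lemma diffk_inverse_inner: "diffk k (\<lambda>x::real^'m::finite. inverse (x \<bullet> x))"
proof (induction k)
  case 0
  then show ?case using has_derivative_inverse_inner by (auto simp: differentiable_def)
next
  case (Suc k)
  have "agree0 (\<lambda>x::real^'m. - 2 * (x $ i) * (inverse (x \<bullet> x) * inverse (x \<bullet> x)))
      (epart i (\<lambda>x. inverse (x \<bullet> x)))" for i
    by (auto simp: agree0_def epart_inverse_inner)
  moreover have "diffk k (\<lambda>x::real^'m. - 2 * (x $ i) * (inverse (x \<bullet> x) * inverse (x \<bullet> x)))" for i
    by (intro diffk_mult diffk_const diffk_coord Suc.IH)
  ultimately have "diffk k (epart i (\<lambda>x::real^'m. inverse (x \<bullet> x)))" for i
    using diffk_cong by blast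
  then show ?case using has_derivative_inverse_inner by (auto simp: differentiable_def)
qed

lemma smooth0_differentiable: "smooth0 g \<Longrightarrow> x \<noteq> 0 \<Longrightarrow> g differentiable (at x)"
  by (meson diffk_imp_differentiable smooth0_def)

lemma smooth0_epart: "smooth0 g \<Longrightarrow> smooth0 (epart i g)"
  unfolding smooth0_def by (metis diffk.simps(2))

lemma smooth0_cong: "agree0 g h \<Longrightarrow> smooth0 g \<Longrightarrow> smooth0 h"
  by (auto simp: smooth0_def intro: diffk_cong)

lemma smooth0_const: "smooth0 (\<lambda>x. c)"
  by (simp add: smooth0_def diffk_const)

lemma smooth0_coord: "smooth0 (\<lambda>x. x $ i)"
  by (simp add: smooth0_def diffk_coord)

lemma smooth0_inverse_inner: "smooth0 (\<lambda>x. inverse (x \<bullet> x))"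
  by (simp add: smooth0_def diffk_inverse_inner)

lemma smooth0_add: "smooth0 g \<Longrightarrow> smooth0 h \<Longrightarrow> smooth0 (\<lambda>x. g x + h x)"
  by (simp add: smooth0_def diffk_add)

lemma smooth0_mult: "smooth0 g \<Longrightarrow> smooth0 h \<Longrightarrow> smooth0 (\<lambda>x. g x * h x)"
  by (simp add: smooth0_def diffk_mult)

lemma smooth0_diff: "smooth0 g \<Longrightarrow> smooth0 h \<Longrightarrow> smooth0 (\<lambda>x. g x - h x)"
  using smooth0_add[of g "\<lambda>x. (-1) * h x"] smooth0_mult[OF smooth0_const, of h "-1"] by simp

lemma smooth0_sum: "(\<And>i. i \<in> I \<Longrightarrow> smooth0 (g i)) \<Longrightarrow> smooth0 (\<lambda>x. \<Sum>i\<in>I. g i x)"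
  by (induction I rule: infinite_finite_induct) (simp_all add: smooth0_const smooth0_add)

lemma iterp_append: "iterp (ks @ ls) g = iterp ks (iterp ls g)"
  by (induction ks) simp_all

lemma smooth_coeff_imp_smooth0:
  assumes "smooth_coeff g"
  shows "smooth0 g"
proof -
  have "smooth_coeff g \<Longrightarrow> diffk k g" for k
  proof (induction k arbitrary: g)
    case 0
    then show ?case unfolding smooth_coeff_def by (metis diffk.simps(1) iterp.simps(1))
  next
    case (Suc k)
    \<comment> \<open>Appending i at the end of the list makes it the innermost derivative, so
      iterated derivatives of \<open>epart i g\<close> are iterated derivatives of g.\<close>
    have "smooth_coeff (epart i g)" for i
      using Suc.prems iterp_append[of _ "[i]" g] unfolding smooth_coeff_def by (metis iterp.simps)
    then show ?case using Suc unfolding smooth_coeff_def by (metis diffk.simps(2) iterp.simps(1))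
  qed
  then show ?thesis using assms by (simp add: smooth0_def)
qed

text \<open>Young's theorem: the second difference quotient along two axes tends to either of the mixed
  partial derivatives.\<close>

lemma second_difference_quotient_limit:
  fixes g :: "real^'m::finite \<Rightarrow> real"
  assumes d: "d > 0" and diff: "\<And>y. dist x y < d \<Longrightarrow> g differentiable (at y)"
    and dh: "epart i g differentiable (at x)"
  shows "((\<lambda>t. (g (x + t *\<^sub>R axis i 1 + t *\<^sub>R axis j 1) - g (x + t *\<^sub>R axis i 1)
            - g (x + t *\<^sub>R axis j 1) + g x) / t\<^sup>2) \<longlongrightarrow> epart j (epart i g) x) (at_right 0)"
proof (rule tendstoI)
  fix e :: real
  assume "e > 0"
  define ei ej :: "real^'m" where "ei = axis i 1" and "ej = axis j 1"
  have [simp]: "norm ei = 1" "norm ej = 1" by (simp_all add: ei_def ej_def)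
  define h where "h = epart i g"
  obtain h' where h': "(h has_derivative h') (at x)"
    using dh by (auto simp: differentiable_def h_def)
  note lin = has_derivative_linear[OF h']
  \<comment> \<open>With e/4 the errors at the two points used below, at distance at most 2t and t
    from x, add up to at most 3/4 e t, strictly less than e t.\<close>
  obtain \<delta> where \<delta>: "\<delta> > 0" "\<And>y. norm (y - x) < \<delta> \<Longrightarrow> norm (h y - h x - h' (y - x)) \<le> e / 4 * norm (y - x)"
  proof -
    have "\<forall>e>0. \<exists>\<delta>>0. \<forall>y. norm (y - x) < \<delta> \<longrightarrow> norm (h y - h x - h' (y - x)) \<le> e * norm (y - x)"
      using h' by (simp add: has_derivative_at_alt)
    moreover have "e / 4 > 0" using \<open>e > 0\<close> by simp
    ultimately show ?thesis using that by blast
  qed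
  have "\<bar>(g (x + t *\<^sub>R ei + t *\<^sub>R ej) - g (x + t *\<^sub>R ei) - g (x + t *\<^sub>R ej) + g x) / t\<^sup>2 - h' ej\<bar> < e"
    if t: "0 < t" "t < min \<delta> d / 2" for t
  proof -
    \<comment> \<open>The second difference equals \<phi> t - \<phi> 0. The mean value theorem
      applied to \<phi> replaces g by its partial derivative h, for which differentiability at the
      single point x is then enough.\<close>
    define \<phi> where "\<phi> s = g (x + s *\<^sub>R ei + t *\<^sub>R ej) - g (x + s *\<^sub>R ei)" for s
    have line: "((\<lambda>s. g (z + s *\<^sub>R ei)) has_real_derivative h (z + s *\<^sub>R ei)) (at s)"
      if "dist x (z + s *\<^sub>R ei) < d" for z s
    proof -
      have "((\<lambda>u. g ((z + s *\<^sub>R ei) + u *\<^sub>R ei)) has_real_derivative h (z + s *\<^sub>R ei)) (at 0)"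
      proof -
        have "((\<lambda>u. (z + s *\<^sub>R ei) + u *\<^sub>R ei) has_vector_derivative ei) (at 0)"
          by (auto intro!: derivative_eq_intros)
        from DERIV_along_curve[OF _ this, of g] diff[OF that] show ?thesis
          by (simp add: ei_def axis_def h_def if_distrib[where f = "\<lambda>y. y * _"] sum.delta cong: if_cong)
      qed
      then have "((\<lambda>u. g (z + (u + s) *\<^sub>R ei)) has_real_derivative h (z + s *\<^sub>R ei)) (at 0)"
        by (simp add: algebra_simps)
      then show ?thesis
        using DERIV_shift[of "\<lambda>s. g (z + s *\<^sub>R ei)" _ 0 s] by simp
    qed
    have D1: "dist x (x + t *\<^sub>R ej + s *\<^sub>R ei) < d" if "0 \<le> s" "s \<le> t" for s
    proof -
      have "norm (t *\<^sub>R ej + s *\<^sub>R ei) \<le> norm (t *\<^sub>R ej) + norm (s *\<^sub>R ei)" by (rule norm_triangle_ineq)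
      also have "\<dots> = t + s" using that t by simp
      finally have "norm (t *\<^sub>R ej + s *\<^sub>R ei) < d" using that t by simp
      then show ?thesis by (metis add.assoc add_diff_cancel_left' dist_commute dist_norm)
    qed
    have D2: "dist x (x + s *\<^sub>R ei) < d" if "0 \<le> s" "s \<le> t" for s
      using that t by (simp add: dist_norm)
    have "(\<phi> has_real_derivative (h (x + s *\<^sub>R ei + t *\<^sub>R ej) - h (x + s *\<^sub>R ei))) (at s)"
      if "0 \<le> s" "s \<le> t" for s
      unfolding \<phi>_def
      using DERIV_diff[OF line[OF D1[OF that]] line[OF D2[OF that]]] by (simp add: add_ac)
    from MVT2[OF t(1) this]
    obtain \<tau> where \<tau>: "0 < \<tau>" "\<tau> < t"
      and eq: "\<phi> t - \<phi> 0 = t * (h (x + \<tau> *\<^sub>R ei + t *\<^sub>R ej) - h (x + \<tau> *\<^sub>R ei))"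
      by auto
    define err where "err v = h (x + v) - h x - h' v" for v
    have err: "\<bar>err v\<bar> \<le> e / 4 * norm v" if "norm v < \<delta>" for v
      using \<delta>(2)[of "x + v"] that by (simp add: err_def)
    have n1: "norm (\<tau> *\<^sub>R ei + t *\<^sub>R ej) \<le> \<tau> + t"
      using norm_triangle_ineq[of "\<tau> *\<^sub>R ei" "t *\<^sub>R ej"] t \<tau> by simp
    have "norm (\<tau> *\<^sub>R ei + t *\<^sub>R ej) < \<delta>" using n1 \<tau> t by linarith
    then have "\<bar>err (\<tau> *\<^sub>R ei + t *\<^sub>R ej)\<bar> \<le> e / 4 * norm (\<tau> *\<^sub>R ei + t *\<^sub>R ej)" by (rule err)
    also have "\<dots> \<le> e / 4 * (2 * t)" using n1 \<tau> \<open>e > 0\<close> by (intro mult_left_mono) auto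
    finally have e1: "\<bar>err (\<tau> *\<^sub>R ei + t *\<^sub>R ej)\<bar> \<le> e / 4 * (2 * t)" .
    have "norm (\<tau> *\<^sub>R ei) < \<delta>" using \<tau> t by simp
    then have "\<bar>err (\<tau> *\<^sub>R ei)\<bar> \<le> e / 4 * norm (\<tau> *\<^sub>R ei)" by (rule err)
    also have "\<dots> \<le> e / 4 * t" using \<tau> \<open>e > 0\<close> by (intro mult_left_mono) auto
    finally have e2: "\<bar>err (\<tau> *\<^sub>R ei)\<bar> \<le> e / 4 * t" .
    have \<phi>: "\<phi> t - \<phi> 0 = t * (t * h' ej + err (\<tau> *\<^sub>R ei + t *\<^sub>R ej) - err (\<tau> *\<^sub>R ei))"
      unfolding eq by (simp add: err_def linear_add[OF lin] linear_scale[OF lin] add.assoc)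
    have "(\<phi> t - \<phi> 0) / t\<^sup>2 - h' ej = (err (\<tau> *\<^sub>R ei + t *\<^sub>R ej) - err (\<tau> *\<^sub>R ei)) / t"
      unfolding \<phi> using t(1) by (simp add: power2_eq_square field_simps)
    moreover have "\<bar>err (\<tau> *\<^sub>R ei + t *\<^sub>R ej) - err (\<tau> *\<^sub>R ei)\<bar> < e * t"
      using e1 e2 mult_pos_pos[OF \<open>e > 0\<close> t(1)] by argo
    ultimately have "\<bar>(\<phi> t - \<phi> 0) / t\<^sup>2 - h' ej\<bar> < e"
      using t(1) by (simp add: abs_divide divide_less_eq)
    then show ?thesis by (simp add: \<phi>_def algebra_simps)
  qed
  moreover have "epart j (epart i g) x = h' ej"
    using epart_eq[OF h'] by (simp add: h_def ej_def)
  moreover have "min \<delta> d / 2 > 0" using \<delta>(1) d by simp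
  ultimately show "\<forall>\<^sub>F t in at_right 0. dist ((g (x + t *\<^sub>R axis i 1 + t *\<^sub>R axis j 1) - g (x + t *\<^sub>R axis i 1)
            - g (x + t *\<^sub>R axis j 1) + g x) / t\<^sup>2) (epart j (epart i g) x) < e"
    unfolding eventually_at_right_field dist_real_def ei_def ej_def
    by (intro exI[of _ "min \<delta> d / 2"]) auto
qed

lemma epart_commute:
  fixes g :: "real^'m::finite \<Rightarrow> real"
  assumes "smooth0 g" "x \<noteq> 0"
  shows "epart i (epart j g) x = epart j (epart i g) x"
proof -
  have d: "norm x > 0" using assms by simp
  \<comment> \<open>The open ball about x of radius |x| misses the origin.\<close>
  have diff: "g differentiable (at y)" if "dist x y < norm x" for y
    using that assms by (intro smooth0_differentiable) auto
  have dh: "epart l g differentiable (at x)" for l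
    using assms by (intro smooth0_differentiable smooth0_epart)
  let ?q = "\<lambda>i j t. (g (x + t *\<^sub>R axis i 1 + t *\<^sub>R axis j 1) - g (x + t *\<^sub>R axis i 1)
            - g (x + t *\<^sub>R axis j 1) + g x) / t\<^sup>2"
  \<comment> \<open>The quotient is symmetric in the two axes, so uniqueness of its limit identifies
    the two mixed partial derivatives.\<close>
  have "?q i j = ?q j i" by (auto simp: algebra_simps)
  then show ?thesis
    using second_difference_quotient_limit[OF d diff dh, of i j] second_difference_quotient_limit[OF d diff dh, of j i]
    by (metis (no_types, lifting) tendsto_unique trivial_limit_at_right_real)
qed

section \<open>The radial derivative\<close>

definition rD :: "(real^'m::finite \<Rightarrow> real) \<Rightarrow> real^'m \<Rightarrow> real" where
  "rD g x = deriv (\<lambda>t. g (x + t *\<^sub>R ((1 / norm x) *\<^sub>R x))) 0 / (2 * norm x)"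

lemma Dr_pow_eq: "(Dr ^^ j) f x S = (rD ^^ j) (\<lambda>y. f y S) x"
proof (induction j arbitrary: x)
  case (Suc j)
  then show ?case by (simp add: Dr_def rD_def)
qed simp

lemma rD_cong: "agree0 g h \<Longrightarrow> agree0 (rD g) (rD h)"
  unfolding agree0_def rD_def
proof (intro allI impI)
  fix x :: "real^'a"
  assume a: "\<forall>x. x \<noteq> 0 \<longrightarrow> g x = h x" "x \<noteq> 0"
  have "deriv (\<lambda>t. g (x + t *\<^sub>R ((1 / norm x) *\<^sub>R x))) 0 = deriv (\<lambda>t. h (x + t *\<^sub>R ((1 / norm x) *\<^sub>R x))) 0"
  proof (rule deriv_cong_ev)
    show "\<forall>\<^sub>F t in nhds 0. g (x + t *\<^sub>R ((1 / norm x) *\<^sub>R x)) = h (x + t *\<^sub>R ((1 / norm x) *\<^sub>R x))"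
      using eventually_line_nonzero[OF a(2), of "(1 / norm x) *\<^sub>R x"] by (rule eventually_mono) (use a(1) in simp)
  qed simp
  then show "deriv (\<lambda>t. g (x + t *\<^sub>R ((1 / norm x) *\<^sub>R x))) 0 / (2 * norm x)
      = deriv (\<lambda>t. h (x + t *\<^sub>R ((1 / norm x) *\<^sub>R x))) 0 / (2 * norm x)" by simp
qed

lemma rD_pow_cong: "agree0 g h \<Longrightarrow> agree0 ((rD ^^ j) g) ((rD ^^ j) h)"
  by (induction j) (simp_all add: rD_cong)

text \<open>The unit radial derivative is the Euler field divided by |x|; the factor 1/(2|x|) of the
  operator then gives the Euler field over 2|x|^2. In this form algebraic rules apply.\<close>

lemma rD_eq:
  fixes g :: "real^'m::finite \<Rightarrow> real"
  assumes "g differentiable (at x)"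
  shows "rD g x = (\<Sum>i\<in>UNIV. x $ i * epart i g x) * inverse (x \<bullet> x) / 2"
proof -
  have "((\<lambda>t. x + t *\<^sub>R v) has_vector_derivative v) (at 0)" for v
    by (auto intro!: derivative_eq_intros)
  from DERIV_along_curve[OF _ this, of g]
  have "((\<lambda>t. g (x + t *\<^sub>R v)) has_real_derivative (\<Sum>i\<in>UNIV. v $ i * epart i g x)) (at 0)" for v
    using assms by simp
  from this[of "(1 / norm x) *\<^sub>R x"]
  have "rD g x = (\<Sum>i\<in>UNIV. (x $ i / norm x) * epart i g x) / (2 * norm x)"
    unfolding rD_def by (subst DERIV_imp_deriv) auto
  also have "\<dots> = (\<Sum>i\<in>UNIV. x $ i * epart i g x) / norm x / (2 * norm x)"
    by (simp add: sum_divide_distrib)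
  also have "\<dots> = (\<Sum>i\<in>UNIV. x $ i * epart i g x) * inverse (x \<bullet> x) / 2"
    by (simp add: dot_square_norm power2_eq_square divide_simps)
  finally show ?thesis .
qed

lemma smooth0_rD: "smooth0 g \<Longrightarrow> smooth0 (rD g)"
  for g :: "real^'m::finite \<Rightarrow> real"
proof -
  assume g: "smooth0 g"
  have "agree0 (\<lambda>x. (\<Sum>i\<in>UNIV. x $ i * epart i g x) * inverse (x \<bullet> x) * (1 / 2)) (rD g)"
    using g by (auto simp: agree0_def rD_eq smooth0_differentiable)
  moreover have "smooth0 (\<lambda>x. (\<Sum>i\<in>UNIV. x $ i * epart i g x) * inverse (x \<bullet> x) * (1 / 2))"
    by (intro smooth0_mult smooth0_sum smooth0_coord smooth0_epart g smooth0_inverse_inner smooth0_const)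
  ultimately show ?thesis by (rule smooth0_cong)
qed

lemma smooth0_rD_pow: "smooth0 g \<Longrightarrow> smooth0 ((rD ^^ j) g)"
  by (induction j) (simp_all add: smooth0_rD)

lemma rD_mult:
  assumes "smooth0 g" "smooth0 h" "x \<noteq> 0"
  shows "rD (\<lambda>x. g x * h x) x = rD g x * h x + g x * rD h x"
  using assms smooth0_mult[of g h]
  by (simp add: rD_eq smooth0_differentiable epart_mult algebra_simps sum.distrib
      sum_distrib_left sum_distrib_right add_divide_distrib sum_divide_distrib)

lemma rD_add:
  assumes "smooth0 g" "smooth0 h" "x \<noteq> 0"
  shows "rD (\<lambda>x. g x + h x) x = rD g x + rD h x"
  using assms smooth0_add[of g h]
  by (simp add: rD_eq smooth0_differentiable epart_add algebra_simps sum.distrib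
      sum_distrib_left sum_distrib_right add_divide_distrib sum_divide_distrib)

lemma rD_const: "rD (\<lambda>x. c) x = 0"
  by (simp add: rD_def)

lemma rD_sum:
  assumes "\<And>i. i \<in> I \<Longrightarrow> smooth0 (g i)" "x \<noteq> 0"
  shows "rD (\<lambda>x. \<Sum>i\<in>I. c i * g i x) x = (\<Sum>i\<in>I. c i * rD (g i) x)"
  using assms
proof (induction I rule: infinite_finite_induct)
  case (insert i I)
  have "rD (\<lambda>x. c i * g i x + (\<Sum>i\<in>I. c i * g i x)) x
      = rD (\<lambda>x. c i * g i x) x + rD (\<lambda>x. \<Sum>i\<in>I. c i * g i x) x"
    using insert.prems by (intro rD_add smooth0_sum smooth0_mult smooth0_const) auto
  moreover have "rD (\<lambda>x. c i * g i x) x = c i * rD (g i) x"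
    using rD_mult[OF smooth0_const, of "g i" x "c i"] insert.prems by (simp add: rD_const)
  ultimately show ?case using insert by simp
qed (simp_all add: rD_const)

lemma rD_pow_sum:
  assumes "\<And>i. i \<in> I \<Longrightarrow> smooth0 (g i)"
  shows "agree0 ((rD ^^ j) (\<lambda>x. \<Sum>i\<in>I. c i * g i x)) (\<lambda>x. \<Sum>i\<in>I. c i * (rD ^^ j) (g i) x)"
proof (induction j)
  case (Suc j)
  have "agree0 (rD (\<lambda>x. \<Sum>i\<in>I. c i * (rD ^^ j) (g i) x)) (\<lambda>x. \<Sum>i\<in>I. c i * rD ((rD ^^ j) (g i)) x)"
    using assms by (simp add: agree0_def rD_sum smooth0_rD_pow)
  with rD_cong[OF Suc] show ?case by (simp add: agree0_def)
qed (simp add: agree0_def)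

lemma rD_inverse_inner:
  fixes x :: "real^'m::finite"
  assumes "x \<noteq> 0"
  shows "rD (\<lambda>x. inverse (x \<bullet> x)) x = - (inverse (x \<bullet> x) * inverse (x \<bullet> x))"
proof -
  define q where "q x = inverse (x \<bullet> x)" for x :: "real^'m"
  have "(\<Sum>i\<in>UNIV. x $ i * epart i q x) = (\<Sum>i\<in>UNIV. x $ i * x $ i) * (- 2 * (q x * q x))"
    using epart_inverse_inner[OF assms, folded q_def]
    by (simp add: sum_distrib_left sum_distrib_right mult_ac sum_negf)
  also have "(\<Sum>i\<in>UNIV. x $ i * x $ i) = x \<bullet> x" by (simp add: inner_vec_def)
  also have "x \<bullet> x * (- 2 * (q x * q x)) = - 2 * (x \<bullet> x * q x) * q x" by simp
  also have "x \<bullet> x * q x = 1" using assms by (simp add: q_def)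
  finally have "rD q x = - (q x * q x)"
    using smooth0_differentiable[OF smooth0_inverse_inner assms]
    by (simp add: q_def[abs_def] rD_eq)
  then show ?thesis by (simp add: q_def[abs_def])
qed

text \<open>A weight w of degree 2 a contributes the binomial coefficients of exponent a, since the
  operator \<^const>\<open>rD\<close> is differentiation with respect to the squared radius.\<close>

lemma rD_pow_weight_mult:
  fixes w h :: "real^'m::finite \<Rightarrow> real"
  assumes "smooth0 w" "smooth0 h" "agree0 (rD w) (\<lambda>x. \<alpha> * w x * inverse (x \<bullet> x))" "x \<noteq> 0"
  shows "(rD ^^ j) (\<lambda>x. w x * h x) x / fact j
      = (\<Sum>k\<le>j. (\<alpha> gchoose k) * w x * inverse (x \<bullet> x) ^ k * (rD ^^ (j - k)) h x / fact (j - k))"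
  using assms
proof (induction j arbitrary: w h \<alpha>)
  case (Suc j)
  note w = Suc.prems(1) and h = Suc.prems(2) and hom = Suc.prems(3) and x = Suc.prems(4)
  define q where "q x = inverse (x \<bullet> x)" for x :: "real^'m"
  have sq: "smooth0 q" unfolding q_def by (rule smooth0_inverse_inner)
  have rq: "rD q x = - (q x * q x)" if "x \<noteq> 0" for x
    using rD_inverse_inner[OF that] by (simp add: q_def[abs_def])
  have swq: "smooth0 (\<lambda>x. w x * q x)" using w sq by (rule smooth0_mult)
  \<comment> \<open>The radial derivative of w is \<alpha> w q, and w q is a weight of exponent
    \<alpha> - 1; hence the induction has to vary w and \<alpha>.\<close>
  have homq: "agree0 (rD (\<lambda>x. w x * q x)) (\<lambda>x. (\<alpha> - 1) * (w x * q x) * inverse (x \<bullet> x))"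
    using hom w sq by (auto simp: agree0_def rD_mult rq) (simp add: q_def algebra_simps)
  let ?D = "\<lambda>i. (rD ^^ i) h x"
  \<comment> \<open>The product rule is written as a sum over two truth values so that
    \<open>rD_pow_sum\<close> distributes the remaining j derivatives.\<close>
  have "agree0 (rD (\<lambda>x. w x * h x)) (\<lambda>x. \<Sum>b\<in>{True, False}. (if b then \<alpha> else 1) * (if b then w x * q x * h x else w x * rD h x))"
    using w h hom by (auto simp: agree0_def rD_mult q_def algebra_simps)
  then have "agree0 ((rD ^^ j) (rD (\<lambda>x. w x * h x)))
      ((rD ^^ j) (\<lambda>x. \<Sum>b\<in>{True, False}. (if b then \<alpha> else 1) * (if b then w x * q x * h x else w x * rD h x)))"
    by (rule rD_pow_cong)
  also have "agree0 ((rD ^^ j) (\<lambda>x. \<Sum>b\<in>{True, False}. (if b then \<alpha> else 1) * (if b then w x * q x * h x else w x * rD h x)))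
     (\<lambda>x. \<Sum>b\<in>{True, False}. (if b then \<alpha> else 1) * (rD ^^ j) (\<lambda>x. if b then w x * q x * h x else w x * rD h x) x)"
  proof (rule rD_pow_sum[where g = "\<lambda>b x. if b then w x * q x * h x else w x * rD h x"])
    fix b
    show "smooth0 (\<lambda>x. if b then w x * q x * h x else w x * rD h x)"
      using smooth0_mult[OF swq h] smooth0_mult[OF w smooth0_rD[OF h]] by (cases b) simp_all
  qed
  finally have "(rD ^^ Suc j) (\<lambda>x. w x * h x) x
      = \<alpha> * (rD ^^ j) (\<lambda>x. w x * q x * h x) x + (rD ^^ j) (\<lambda>x. w x * rD h x) x"
    using x by (simp add: agree0_def funpow_swap1)
  then have "(rD ^^ Suc j) (\<lambda>x. w x * h x) x / fact j
      = \<alpha> * ((rD ^^ j) (\<lambda>x. w x * q x * h x) x / fact j) + (rD ^^ j) (\<lambda>x. w x * rD h x) x / fact j"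
    by (simp add: add_divide_distrib)
  also have "\<dots> = \<alpha> * (\<Sum>k\<le>j. (\<alpha> - 1 gchoose k) * (w x * q x) * q x ^ k * ?D (j - k) / fact (j - k))
        + (\<Sum>k\<le>j. (\<alpha> gchoose k) * w x * q x ^ k * ?D (Suc j - k) / fact (j - k))"
    unfolding Suc.IH[OF swq h homq x, folded q_def] Suc.IH[OF w smooth0_rD[OF h] hom x, folded q_def]
    by (simp add: Suc_diff_le funpow_swap1)
  \<comment> \<open>Absorption: \<alpha> times (\<alpha> - 1 choose k) is k + 1 times (\<alpha>
    choose k + 1).\<close>
  also have "\<alpha> * (\<Sum>k\<le>j. (\<alpha> - 1 gchoose k) * (w x * q x) * q x ^ k * ?D (j - k) / fact (j - k))
      = (\<Sum>k\<le>j. real (Suc k) * (\<alpha> gchoose Suc k) * w x * q x ^ Suc k * ?D (Suc j - Suc k) / fact (Suc j - Suc k))"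
    using Suc_times_gbinomial[of _ "\<alpha> - 1"] by (simp add: sum_distrib_left mult_ac)
  \<comment> \<open>The added term k = 0 vanishes by its factor k; in the second sum, extended to
    the same range, the term k = j + 1 vanishes by its factor j + 1 - k.\<close>
  also have "\<dots> = (\<Sum>k\<le>Suc j. real k * ((\<alpha> gchoose k) * w x * q x ^ k * ?D (Suc j - k) / fact (Suc j - k)))"
    by (subst sum.atMost_Suc_shift) (simp add: mult_ac del: sum.atMost_Suc)
  also have "(\<Sum>k\<le>j. (\<alpha> gchoose k) * w x * q x ^ k * ?D (Suc j - k) / fact (j - k))
      = (\<Sum>k\<le>Suc j. real (Suc j - k) * ((\<alpha> gchoose k) * w x * q x ^ k * ?D (Suc j - k) / fact (Suc j - k)))"
  proof -
    have "real (Suc i) * (z / fact (Suc i)) = z / fact i" for i z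
      by (simp del: of_nat_Suc)
    then have "(\<Sum>k\<le>j. (\<alpha> gchoose k) * w x * q x ^ k * ?D (Suc j - k) / fact (j - k))
        = (\<Sum>k\<le>j. real (Suc j - k) * ((\<alpha> gchoose k) * w x * q x ^ k * ?D (Suc j - k) / fact (Suc j - k)))"
      by (intro sum.cong) (simp_all only: atMost_iff Suc_diff_le)
    then show ?thesis by simp
  qed
  \<comment> \<open>The factors k and j + 1 - k add up to j + 1, which is the quotient of the
    factorials of j + 1 and j.\<close>
  also have "(\<Sum>k\<le>Suc j. real k * ((\<alpha> gchoose k) * w x * q x ^ k * ?D (Suc j - k) / fact (Suc j - k)))
      + (\<Sum>k\<le>Suc j. real (Suc j - k) * ((\<alpha> gchoose k) * w x * q x ^ k * ?D (Suc j - k) / fact (Suc j - k)))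
      = (\<Sum>k\<le>Suc j. real (Suc j) * ((\<alpha> gchoose k) * w x * q x ^ k * ?D (Suc j - k) / fact (Suc j - k)))"
    unfolding sum.distrib[symmetric]
  proof (rule sum.cong)
    fix k
    assume "k \<in> {..Suc j}"
    then have "real (Suc j) = real k + real (Suc j - k)" by simp
    then show "real k * ((\<alpha> gchoose k) * w x * q x ^ k * ?D (Suc j - k) / fact (Suc j - k))
        + real (Suc j - k) * ((\<alpha> gchoose k) * w x * q x ^ k * ?D (Suc j - k) / fact (Suc j - k))
        = real (Suc j) * ((\<alpha> gchoose k) * w x * q x ^ k * ?D (Suc j - k) / fact (Suc j - k))"
      by (simp only: distrib_right)
  qed simp
  finally have "(rD ^^ Suc j) (\<lambda>x. w x * h x) x / fact j
      = (\<Sum>k\<le>Suc j. real (Suc j) * ((\<alpha> gchoose k) * w x * q x ^ k * ?D (Suc j - k) / fact (Suc j - k)))" .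
  then show ?case
    unfolding sum_distrib_left[symmetric] q_def by (simp add: field_simps del: sum.atMost_Suc of_nat_Suc)
qed simp

lemma rD_coord: "x \<noteq> 0 \<Longrightarrow> rD (\<lambda>x. x $ i) x = 1 / 2 * x $ i * inverse (x \<bullet> x)"
  by (simp add: rD_eq differentiable_coord epart_coord if_distrib[where f = "\<lambda>y. _ * y"] cong: if_cong)

lemma rD_coord_weight: "agree0 (rD (\<lambda>x. x $ i)) (\<lambda>x. 1 / 2 * x $ i * inverse (x \<bullet> x))"
  by (simp add: agree0_def rD_coord)

section \<open>Rotations\<close>

definition rotD :: "'m::finite \<Rightarrow> 'm \<Rightarrow> (real^'m \<Rightarrow> real) \<Rightarrow> real^'m \<Rightarrow> real" where
  "rotD a b g x = x $ a * epart b g x - x $ b * epart a g x"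

lemma DERIV_rot:
  assumes "g differentiable (at x)"
  shows "((\<lambda>t. g (rot a b t x)) has_real_derivative rotD a b g x) (at 0)"
proof (cases "a = b")
  case True
  then have "rot a b t x = x" for t by (simp add: rot_def vec_eq_iff)
  then show ?thesis using True by (simp add: rotD_def)
next
  case False
  \<comment> \<open>u is the component of x in the plane of rotation and v is u turned by a right
    angle, that is, the initial velocity of the orbit.\<close>
  define u where "u = x $ a *\<^sub>R axis a 1 + x $ b *\<^sub>R axis b (1::real)"
  define v where "v = x $ a *\<^sub>R axis b 1 - x $ b *\<^sub>R axis a (1::real)"
  have eq: "rot a b t x = x + (cos t - 1) *\<^sub>R u + sin t *\<^sub>R v" for t
    using False by (auto simp: rot_def vec_eq_iff u_def v_def axis_def algebra_simps)
  have "((\<lambda>t. x + (cos t - 1) *\<^sub>R u + sin t *\<^sub>R v) has_vector_derivative v) (at 0)"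
    by (auto intro!: derivative_eq_intros)
  from DERIV_along_curve[OF _ this, of g] assms
  have "((\<lambda>t. g (rot a b t x)) has_real_derivative (\<Sum>i\<in>UNIV. v $ i * epart i g x)) (at 0)"
    by (simp add: eq)
  moreover have "(\<Sum>i\<in>UNIV. v $ i * epart i g x) = rotD a b g x"
  proof -
    have "(\<Sum>i\<in>UNIV. v $ i * epart i g x)
        = (\<Sum>i\<in>UNIV. if i = b then x $ a * epart i g x else 0) - (\<Sum>i\<in>UNIV. if i = a then x $ b * epart i g x else 0)"
      unfolding sum_subtractf[symmetric] by (rule sum.cong) (auto simp: v_def axis_def algebra_simps)
    then show ?thesis by (simp add: rotD_def)
  qed
  ultimately show ?thesis by simp
qed

lemma smooth0_rotD: "smooth0 g \<Longrightarrow> smooth0 (rotD a b g)"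
  using smooth0_diff[OF smooth0_mult[OF smooth0_coord smooth0_epart] smooth0_mult[OF smooth0_coord smooth0_epart]]
  by (simp add: rotD_def[abs_def])

lemma rotD_cong: "agree0 g h \<Longrightarrow> agree0 (rotD a b g) (rotD a b h)"
  using epart_cong[of g h] by (simp add: agree0_def rotD_def)

lemma epart_sum:
  assumes "\<And>k. k \<in> I \<Longrightarrow> g k differentiable (at x)" "finite I"
  shows "epart i (\<lambda>x. \<Sum>k\<in>I. g k x) x = (\<Sum>k\<in>I. epart i (g k) x)"
  using assms(2,1)
proof (induction I rule: finite_induct)
  case (insert k I)
  then show ?case
    using epart_add[of "g k" x "\<lambda>x. \<Sum>k\<in>I. g k x" i] by (simp add: differentiable_sum)
qed (simp add: epart_const)

text \<open>A rotation field commutes with the Euler field E and annihilates functions of |x|; the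
  radial operator is E multiplied by such a function q.\<close>

lemma rD_rotD_commute:
  fixes g :: "real^'m::finite \<Rightarrow> real"
  assumes g: "smooth0 g"
  shows "agree0 (rD (rotD a b g)) (rotD a b (rD g))"
  unfolding agree0_def
proof (intro allI impI)
  fix x :: "real^'m"
  assume x: "x \<noteq> 0"
  define E where "E x = (\<Sum>i\<in>UNIV. x $ i * epart i g x)" for x
  define q where "q x = inverse (x \<bullet> x) * (1 / 2)" for x :: "real^'m"
  have sE: "smooth0 E" unfolding E_def by (intro smooth0_sum smooth0_mult smooth0_coord smooth0_epart g)
  have sq: "smooth0 q" unfolding q_def by (intro smooth0_mult smooth0_inverse_inner smooth0_const)
  note d = smooth0_differentiable[OF _ x]
  have dp: "epart i g differentiable (at x)" for i by (intro d smooth0_epart g)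
  have delta: "(\<Sum>i\<in>UNIV. (if c = i then 1 else 0) * f i) = f c" for c and f :: "'m \<Rightarrow> real"
    by (simp add: if_distrib[where f = "\<lambda>y. y * _"] cong: if_cong)
  have eE: "epart c E x = epart c g x + (\<Sum>i\<in>UNIV. x $ i * epart c (epart i g) x)" for c
    unfolding E_def
    by (subst epart_sum) (simp_all add: differentiable_coord dp epart_mult epart_coord sum.distrib delta)
  have eq: "epart c q x = x $ c * (- inverse (x \<bullet> x) * inverse (x \<bullet> x))" for c
    unfolding q_def
    by (subst epart_mult) (simp_all add: x epart_inverse_inner epart_const d smooth0_inverse_inner)
  have "agree0 (rD g) (\<lambda>x. E x * q x)"
    using g by (simp add: agree0_def rD_eq smooth0_differentiable E_def q_def)
  then have "rotD a b (rD g) x = rotD a b (\<lambda>x. E x * q x) x"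
    using rotD_cong[of "rD g" "\<lambda>x. E x * q x"] x by (simp add: agree0_def)
  \<comment> \<open>The derivative of q along axis c is proportional to the coordinate x_c, so the
    terms that differentiate q cancel.\<close>
  also have "\<dots> = (x $ a * epart b E x - x $ b * epart a E x) * q x"
    unfolding rotD_def by (simp add: epart_mult d sE sq eq algebra_simps)
  also have "\<dots> = (x $ a * epart b g x - x $ b * epart a g x
      + (\<Sum>i\<in>UNIV. x $ i * (x $ a * epart b (epart i g) x - x $ b * epart a (epart i g) x))) * q x"
    by (simp add: eE algebra_simps sum_distrib_left sum_subtractf)
  finally have R: "rotD a b (rD g) x = \<dots>" .
  have er: "epart i (rotD a b g) x
      = (if a = i then 1 else 0) * epart b g x + x $ a * epart i (epart b g) x
        - ((if b = i then 1 else 0) * epart a g x + x $ b * epart i (epart a g) x)" for i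
  proof -
    have "epart i (\<lambda>x. x $ a * epart b g x - x $ b * epart a g x) x
        = epart i (\<lambda>x. x $ a * epart b g x) x - epart i (\<lambda>x. x $ b * epart a g x) x"
      by (intro epart_diff differentiable_mult differentiable_coord dp)
    then show ?thesis
      by (simp add: rotD_def[abs_def] epart_mult differentiable_coord dp epart_coord eq_commute)
  qed
  have "rD (rotD a b g) x = (\<Sum>i\<in>UNIV. x $ i * epart i (rotD a b g) x) * q x"
    by (simp add: rD_eq d smooth0_rotD g q_def)
  also have "(\<Sum>i\<in>UNIV. x $ i * epart i (rotD a b g) x)
     = (\<Sum>i\<in>UNIV. (if a = i then 1 else 0) * (x $ i * epart b g x)) - (\<Sum>i\<in>UNIV. (if b = i then 1 else 0) * (x $ i * epart a g x))
      + (\<Sum>i\<in>UNIV. x $ i * (x $ a * epart i (epart b g) x - x $ b * epart i (epart a g) x))"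
    unfolding sum_subtractf[symmetric] sum.distrib[symmetric]
    by (rule sum.cong) (simp_all add: er algebra_simps)
  \<comment> \<open>First-order terms agree already; the second-order ones agree by symmetry of
    mixed partial derivatives.\<close>
  also have "\<dots> * q x = rotD a b (rD g) x"
    unfolding R delta by (simp add: epart_commute[OF g x, of _ a] epart_commute[OF g x, of _ b])
  finally show "rD (rotD a b g) x = rotD a b (rD g) x" .
qed

lemma rD_pow_rotD_commute:
  assumes "smooth0 g"
  shows "agree0 ((rD ^^ j) (rotD a b g)) (rotD a b ((rD ^^ j) g))"
proof (induction j)
  case (Suc j)
  have "agree0 (rD ((rD ^^ j) (rotD a b g))) (rD (rotD a b ((rD ^^ j) g)))"
    by (rule rD_cong[OF Suc])
  with rD_rotD_commute[OF smooth0_rD_pow[OF assms], of a b j] show ?case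
    by (simp add: agree0_def)
qed (simp add: agree0_def)

section \<open>The pullback to the supersphere\<close>

definition smooth_sfun :: "nat \<Rightarrow> 'm::finite sfun \<Rightarrow> bool" where
  "smooth_sfun n f \<longleftrightarrow> (\<forall>S\<subseteq>{1..2*n}. smooth0 (\<lambda>x. f x S))"

definition PiG :: "nat \<Rightarrow> 'm::finite sfun \<Rightarrow> real^'m \<Rightarrow> grassmann" where
  "PiG n f \<xi> = (\<Sum>j\<le>n. tG n ^ j * ((1 / fact j) *\<^sub>R mkG n ((Dr ^^ j) f \<xi>)))"

lemma mkG_pi_sharp: "mkG n (pi_sharp n f \<xi>) = PiG n f \<xi>"
proof -
  have "((-1) ^ j / fact j) *\<^sub>R ((- tG n) ^ j * a) = tG n ^ j * ((1 / fact j) *\<^sub>R a)" for j a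
    by (cases "even j") simp_all
  then show ?thesis
    by (simp only: pi_sharp_def PiG_def mkG_sum mkG_scale mkG_gmul mkG_gpow_theta2)
qed

lemma sf_smooth_imp_smooth_sfun: "sf_smooth n f \<Longrightarrow> smooth_sfun n f"
  by (simp add: sf_smooth_def smooth_sfun_def smooth_coeff_imp_smooth0)

lemma PiG_cong:
  assumes "\<And>x S. x \<noteq> 0 \<Longrightarrow> S \<subseteq> {1..2*n} \<Longrightarrow> f x S = g x S" "\<xi> \<noteq> 0"
  shows "PiG n f \<xi> = PiG n g \<xi>"
proof -
  have "(Dr ^^ j) f \<xi> S = (Dr ^^ j) g \<xi> S" if "S \<subseteq> {1..2*n}" for j S
  proof -
    have "agree0 (\<lambda>y. f y S) (\<lambda>y. g y S)" using assms(1) that by (simp add: agree0_def)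
    from rD_pow_cong[OF this, of j] show ?thesis using assms(2) by (simp add: Dr_pow_eq agree0_def)
  qed
  then show ?thesis unfolding PiG_def by (metis (mono_tags, lifting) mkG_eqI)
qed

lemma PiG_sum:
  assumes "\<And>i. i \<in> I \<Longrightarrow> smooth_sfun n (f i)" "\<xi> \<noteq> 0"
  shows "PiG n (\<lambda>x S. \<Sum>i\<in>I. c i * f i x S) \<xi> = (\<Sum>i\<in>I. c i *\<^sub>R PiG n (f i) \<xi>)"
proof -
  have "(Dr ^^ j) (\<lambda>x S. \<Sum>i\<in>I. c i * f i x S) \<xi> S = (\<Sum>i\<in>I. c i * (Dr ^^ j) (f i) \<xi> S)"
    if "S \<subseteq> {1..2*n}" for j S
    using rD_pow_sum[of I "\<lambda>i y. f i y S" j c] assms that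
    by (simp add: Dr_pow_eq agree0_def smooth_sfun_def)
  then have "mkG n ((Dr ^^ j) (\<lambda>x S. \<Sum>i\<in>I. c i * f i x S) \<xi>)
      = mkG n (\<lambda>S. \<Sum>i\<in>I. c i * (Dr ^^ j) (f i) \<xi> S)" for j
    by (rule mkG_eqI)
  then have "PiG n (\<lambda>x S. \<Sum>i\<in>I. c i * f i x S) \<xi>
      = (\<Sum>j\<le>n. \<Sum>i\<in>I. c i *\<^sub>R (tG n ^ j * ((1 / fact j) *\<^sub>R mkG n ((Dr ^^ j) (f i) \<xi>))))"
    by (simp add: PiG_def mkG_sum mkG_scale scaleR_sum_right sum_distrib_left mult_ac)
  also have "\<dots> = (\<Sum>i\<in>I. c i *\<^sub>R PiG n (f i) \<xi>)"
    unfolding PiG_def scaleR_sum_right by (rule sum.swap)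
  finally show ?thesis .
qed

lemma PiG_lincomb:
  assumes "smooth_sfun n f" "smooth_sfun n g" "\<xi> \<noteq> 0"
  shows "PiG n (\<lambda>x S. c * f x S + d * g x S) \<xi> = c *\<^sub>R PiG n f \<xi> + d *\<^sub>R PiG n g \<xi>"
  using PiG_sum[of "{True, False}" n "\<lambda>b. if b then f else g" \<xi> "\<lambda>b. if b then c else d"] assms by simp

lemma PiG_diff:
  assumes "smooth_sfun n f" "smooth_sfun n g" "\<xi> \<noteq> 0"
  shows "PiG n (\<lambda>x S. f x S - g x S) \<xi> = PiG n f \<xi> - PiG n g \<xi>"
  using PiG_lincomb[OF assms, of 1 "-1"] by simp

text \<open>On the unit sphere the powers of 1/|x|^2 in \<open>rD_pow_weight_mult\<close> become 1,
  and what remains are the coefficients of a Cauchy product with the binomial series.\<close>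

lemma PiG_weight_mult:
  fixes f :: "'m::finite sfun"
  assumes "smooth0 w" "smooth_sfun n f" "agree0 (rD w) (\<lambda>x. \<alpha> * w x * inverse (x \<bullet> x))" "norm \<xi> = 1"
  shows "PiG n (\<lambda>x S. w x * f x S) \<xi> = w \<xi> *\<^sub>R (bG n \<alpha> * PiG n f \<xi>)"
proof -
  have \<xi>: "\<xi> \<noteq> 0" "\<xi> \<bullet> \<xi> = 1" using assms(4) by (auto simp: dot_square_norm)
  have "(1 / fact j) *\<^sub>R mkG n ((Dr ^^ j) (\<lambda>x S. w x * f x S) \<xi>)
      = (\<Sum>k\<le>j. (\<alpha> gchoose k) *\<^sub>R ((w \<xi> / fact (j - k)) *\<^sub>R mkG n ((Dr ^^ (j - k)) f \<xi>)))" for j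
  proof -
    have "(1 / fact j) *\<^sub>R mkG n ((Dr ^^ j) (\<lambda>x S. w x * f x S) \<xi>)
        = mkG n (\<lambda>S. (1 / fact j) * (Dr ^^ j) (\<lambda>x S. w x * f x S) \<xi> S)"
      by (simp only: mkG_scale)
    also have "\<dots> = mkG n (\<lambda>S. \<Sum>k\<le>j. (\<alpha> gchoose k) * ((w \<xi> / fact (j - k)) * (Dr ^^ (j - k)) f \<xi> S))"
    proof (rule mkG_eqI)
      fix S :: "nat set"
      assume "S \<subseteq> {1..2*n}"
      then have "smooth0 (\<lambda>y. f y S)" using assms(2) by (simp add: smooth_sfun_def)
      from rD_pow_weight_mult[OF assms(1) this assms(3) \<xi>(1), of j]
      show "(1 / fact j) * (Dr ^^ j) (\<lambda>x S. w x * f x S) \<xi> S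
          = (\<Sum>k\<le>j. (\<alpha> gchoose k) * ((w \<xi> / fact (j - k)) * (Dr ^^ (j - k)) f \<xi> S))"
        by (simp add: Dr_pow_eq \<xi>(2) mult_ac)
    qed
    finally show ?thesis by (simp only: mkG_sum mkG_scale)
  qed
  then have "PiG n (\<lambda>x S. w x * f x S) \<xi>
      = bG n \<alpha> * (\<Sum>j\<le>n. tG n ^ j * ((w \<xi> / fact j) *\<^sub>R mkG n ((Dr ^^ j) f \<xi>)))"
    unfolding PiG_def bG_def truncated_Cauchy_product by simp
  also have "\<dots> = w \<xi> *\<^sub>R (bG n \<alpha> * PiG n f \<xi>)"
    by (simp add: PiG_def scaleR_sum_right sum_distrib_left divide_inverse)
  finally show ?thesis .
qed

lemma PiG_coord_mult:
  "smooth_sfun n f \<Longrightarrow> norm \<xi> = 1 \<Longrightarrow> PiG n (\<lambda>x S. x $ i * f x S) \<xi> = \<xi> $ i *\<^sub>R (bG n (1/2) * PiG n f \<xi>)"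
  by (rule PiG_weight_mult[OF smooth0_coord _ rD_coord_weight])

lemma rD_coord_inverse_weight:
  "agree0 (rD (\<lambda>x. x $ i * inverse (x \<bullet> x))) (\<lambda>x. (-1/2) * (x $ i * inverse (x \<bullet> x)) * inverse (x \<bullet> x))"
  for i :: "'m::finite"
  unfolding agree0_def
proof (intro allI impI)
  fix x :: "real^'m"
  assume x: "x \<noteq> 0"
  show "rD (\<lambda>x. x $ i * inverse (x \<bullet> x)) x = (-1/2) * (x $ i * inverse (x \<bullet> x)) * inverse (x \<bullet> x)"
    using rD_mult[OF smooth0_coord smooth0_inverse_inner x] x
    by (simp add: rD_coord rD_inverse_inner)
qed

lemma PiG_coord_inverse_mult:
  "smooth_sfun n f \<Longrightarrow> norm \<xi> = 1 \<Longrightarrow>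
    PiG n (\<lambda>x S. x $ i * inverse (x \<bullet> x) * f x S) \<xi> = \<xi> $ i *\<^sub>R (bG n (-1/2) * PiG n f \<xi>)"
  using PiG_weight_mult[OF smooth0_mult[OF smooth0_coord smooth0_inverse_inner] _ rD_coord_inverse_weight, of n f \<xi> i]
  by (simp add: dot_square_norm)

section \<open>Operators on the Grassmann factor and odd derivatives of the pullback\<close>

text \<open>The operator is given by a constant real matrix on the finitely many meaningful
  coefficients. As the matrix does not depend on the point, the operator commutes with the radial
  derivative.\<close>

definition coeff_linear :: "nat \<Rightarrow> (grass \<Rightarrow> grass) \<Rightarrow> bool" where
  "coeff_linear n \<Phi> \<longleftrightarrow> (\<exists>M. \<forall>a. \<forall>S\<subseteq>{1..2*n}. \<Phi> a S = (\<Sum>T\<in>Pow {1..2*n}. M S T * a T))"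

lemma coeff_linear_gder:
  assumes "l \<in> {1..2*n}"
  shows "coeff_linear n (gder l)"
  unfolding coeff_linear_def
proof (intro exI allI impI)
  fix a and S :: "nat set"
  assume S: "S \<subseteq> {1..2*n}"
  have "(\<Sum>T\<in>Pow {1..2*n}. (if T = insert l S \<and> l \<notin> S then sign_below l S else 0) * a T)
      = (\<Sum>T\<in>Pow {1..2*n}. if T = insert l S then (if l \<notin> S then sign_below l S else 0) * a T else 0)"
    by (rule sum.cong) auto
  then show "gder l a S = (\<Sum>T\<in>Pow {1..2*n}. (if T = insert l S \<and> l \<notin> S then sign_below l S else 0) * a T)"
    using S assms by (simp add: gder_eq)
qed

lemma coeff_linear_gmul: "coeff_linear n (gmul c)"
  unfolding coeff_linear_def
proof (intro exI allI impI)
  fix a and S :: "nat set"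
  assume S: "S \<subseteq> {1..2*n}"
  \<comment> \<open>Passing to complements indexes the sum by the argument set of a, so that the
    matrix entries can be read off.\<close>
  have "gmul c a S = (\<Sum>T\<in>Pow S. gsign (S - T) T * c (S - T) * a T)"
    unfolding gmul_def
    by (rule sum.reindex_bij_witness[of _ "\<lambda>T. S - T" "\<lambda>T. S - T"]) (auto simp: double_diff)
  also have "\<dots> = (\<Sum>T\<in>Pow {1..2*n}. (if T \<subseteq> S then gsign (S - T) T * c (S - T) else 0) * a T)"
    by (rule sum.mono_neutral_cong_left) (use S in auto)
  finally show "gmul c a S = \<dots>" .
qed

lemma smooth_sfun_coeff_linear: "coeff_linear n \<Phi> \<Longrightarrow> smooth_sfun n f \<Longrightarrow> smooth_sfun n (\<lambda>x. \<Phi> (f x))"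
  unfolding coeff_linear_def smooth_sfun_def
  by (auto intro!: smooth0_sum smooth0_mult smooth0_const)

lemma Dr_pow_coeff_linear:
  assumes "coeff_linear n \<Phi>" "smooth_sfun n f" "x \<noteq> 0" "S \<subseteq> {1..2*n}"
  shows "(Dr ^^ j) (\<lambda>x. \<Phi> (f x)) x S = \<Phi> ((Dr ^^ j) f x) S"
proof -
  obtain M where M: "\<And>a S. S \<subseteq> {1..2*n} \<Longrightarrow> \<Phi> a S = (\<Sum>T\<in>Pow {1..2*n}. M S T * a T)"
    using assms(1) unfolding coeff_linear_def by blast
  show ?thesis
    using rD_pow_sum[of "Pow {1..2*n}" "\<lambda>T y. f y T" j "M S"] assms(2-4)
    by (simp add: Dr_pow_eq M agree0_def smooth_sfun_def)
qed

lemma PiG_coeff_linear: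
  assumes "coeff_linear n \<Phi>" "smooth_sfun n f" "\<xi> \<noteq> 0"
  shows "PiG n (\<lambda>x. \<Phi> (f x)) \<xi> = (\<Sum>j\<le>n. tG n ^ j * ((1 / fact j) *\<^sub>R mkG n (\<Phi> ((Dr ^^ j) f \<xi>))))"
  unfolding PiG_def
  using Dr_pow_coeff_linear[OF assms] by (metis (mono_tags, lifting) mkG_eqI)

lemma PiG_ggen_mult:
  assumes "q \<in> {1..2*n}" "smooth_sfun n f" "\<xi> \<noteq> 0"
  shows "PiG n (\<lambda>x. gmul (ggen q) (f x)) \<xi> = yG q * PiG n f \<xi>"
proof -
  have "PiG n (\<lambda>x. gmul (ggen q) (f x)) \<xi>
      = (\<Sum>j\<le>n. tG n ^ j * yG q * ((1 / fact j) *\<^sub>R mkG n ((Dr ^^ j) f \<xi>)))"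
    unfolding PiG_coeff_linear[OF coeff_linear_gmul assms(2,3)]
    by (simp add: mkG_gmul mkG_ggen[OF assms(1)] mult.assoc)
  then show ?thesis
    by (simp add: PiG_def sum_distrib_left mult.assoc flip: yG_tG_power_commute)
qed

definition gdup :: "nat \<Rightarrow> grass \<Rightarrow> grass" where
  "gdup q a = (if odd q then (\<lambda>S. 2 * gder (q + 1) a S) else (\<lambda>S. - 2 * gder (q - 1) a S))"

definition dupG :: "nat \<Rightarrow> grassmann \<Rightarrow> grassmann" where
  "dupG q a = (if odd q then 2 *\<^sub>R dG (q + 1) a else - 2 *\<^sub>R dG (q - 1) a)"

lemma partner_index:
  fixes q n :: nat
  assumes "q \<in> {1..2*n}"
  shows "odd q \<Longrightarrow> q + 1 \<in> {1..2*n}" "even q \<Longrightarrow> q - 1 \<in> {1..2*n}"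
  using assms by (simp_all del: One_nat_def) presburger+

lemma mkG_gdup:
  assumes "q \<in> {1..2*n}"
  shows "mkG n (gdup q a) = dupG q (mkG n a)"
proof (cases "odd q")
  case True
  then show ?thesis
    using mkG_scale[of n 2] mkG_gder[OF partner_index(1)[OF assms]] by (simp add: gdup_def dupG_def)
next
  case False
  then show ?thesis
    using mkG_scale[of n "-2"] mkG_gder[OF partner_index(2)[OF assms]] by (simp add: gdup_def dupG_def)
qed

lemma coeff_linear_scale: "coeff_linear n \<Phi> \<Longrightarrow> coeff_linear n (\<lambda>a S. c * \<Phi> a S)"
proof -
  assume "coeff_linear n \<Phi>"
  then obtain M where M: "\<forall>a. \<forall>S\<subseteq>{1..2*n}. \<Phi> a S = (\<Sum>T\<in>Pow {1..2*n}. M S T * a T)"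
    unfolding coeff_linear_def by blast
  then show ?thesis unfolding coeff_linear_def
    by (intro exI[of _ "\<lambda>S T. c * M S T"]) (simp add: sum_distrib_left mult.assoc)
qed

lemma coeff_linear_gdup:
  assumes "q \<in> {1..2*n}"
  shows "coeff_linear n (gdup q)"
proof (cases "odd q")
  case True
  then show ?thesis
    using coeff_linear_scale[OF coeff_linear_gder[OF partner_index(1)[OF assms]], of 2]
    by (simp add: gdup_def[abs_def])
next
  case False
  then show ?thesis
    using coeff_linear_scale[OF coeff_linear_gder[OF partner_index(2)[OF assms]], of "-2"]
    by (simp add: gdup_def[abs_def])
qed

text \<open>t is even, so the Leibniz rule has no sign; only the pair of generators containing l
  contributes, with a minus sign when l comes second in it.\<close>

lemma dG_tG_mult:
  assumes "l \<in> {1..2*n}"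
  shows "dG l (tG n * a) = (if odd l then yG (l + 1) * a else - (yG (l - 1) * a)) + tG n * dG l a"
proof -
  have "dG l (tG n * a) = (\<Sum>k=1..n. (if l = 2*k-1 then yG (2*k) * a else 0)
      - (if l = 2*k then yG (2*k-1) * a else 0) + yG (2*k-1) * yG (2*k) * dG l a)"
    unfolding tG_def sum_distrib_right dG_sum
    by (rule sum.cong) (simp_all add: mult.assoc dG_yG_mult right_diff_distrib)
  also have "\<dots> = (\<Sum>k=1..n. if l = 2*k-1 then yG (2*k) * a else 0)
      - (\<Sum>k=1..n. if l = 2*k then yG (2*k-1) * a else 0) + tG n * dG l a"
    by (simp add: sum.distrib sum_subtractf tG_def sum_distrib_right)
  also have "(\<Sum>k=1..n. if l = 2*k-1 then yG (2*k) * a else 0) = (if odd l then yG (l + 1) * a else 0)"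
  proof (cases "odd l")
    case True
    then have "(\<Sum>k=1..n. if l = 2*k-1 then yG (2*k) * a else 0)
        = (\<Sum>k=1..n. if k = (l + 1) div 2 then yG (l + 1) * a else 0)"
      by (intro sum.cong) (auto elim!: oddE)
    then show ?thesis using True assms by (auto elim!: oddE)
  next
    case False
    then show ?thesis by (auto intro!: sum.neutral)
  qed
  also have "(\<Sum>k=1..n. if l = 2*k then yG (2*k-1) * a else 0) = (if even l then yG (l - 1) * a else 0)"
  proof (cases "even l")
    case True
    then have "(\<Sum>k=1..n. if l = 2*k then yG (2*k-1) * a else 0)
        = (\<Sum>k=1..n. if k = l div 2 then yG (l - 1) * a else 0)"
      by (intro sum.cong) auto
    then show ?thesis using True assms by auto
  next
    case False
    then show ?thesis by (auto intro!: sum.neutral)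
  qed
  finally show ?thesis by auto
qed

lemma dupG_tG_mult:
  assumes "q \<in> {1..2*n}"
  shows "dupG q (tG n * a) = tG n * dupG q a - 2 *\<^sub>R (yG q * a)"
  using assms partner_index[OF assms]
  by (auto simp: dupG_def dG_tG_mult algebra_simps)

text \<open>At j = 0 the truncated exponent \<open>j - 1\<close> is harmless because its coefficient
  is zero.\<close>

lemma dupG_tG_power_mult:
  assumes "q \<in> {1..2*n}"
  shows "dupG q (tG n ^ j * a) = tG n ^ j * dupG q a - (2 * real j) *\<^sub>R (yG q * (tG n ^ (j - 1) * a))"
proof (induction j)
  case (Suc j)
  have "dupG q (tG n ^ Suc j * a) = tG n * dupG q (tG n ^ j * a) - 2 *\<^sub>R (yG q * (tG n ^ j * a))"
    using dupG_tG_mult[OF assms, of "tG n ^ j * a"] by (simp add: mult.assoc)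
  also have "tG n * dupG q (tG n ^ j * a) = tG n ^ Suc j * dupG q a - (2 * real j) *\<^sub>R (yG q * (tG n ^ j * a))"
  proof (cases j)
    case (Suc i)
    have "tG n * (yG q * (tG n ^ i * a)) = yG q * (tG n * (tG n ^ i * a))"
      by (metis mult.assoc yG_tG_commute)
    then show ?thesis using Suc.IH Suc by (simp add: right_diff_distrib mult.assoc)
  qed simp
  finally show ?case by (simp add: algebra_simps)
qed simp

lemma dupG_sum: "dupG q (\<Sum>i\<in>I. a i) = (\<Sum>i\<in>I. dupG q (a i))"
  by (simp add: dupG_def dG_sum scaleR_sum_right)

lemma dupG_scaleR: "dupG q (r *\<^sub>R a) = r *\<^sub>R dupG q a"
  by (simp add: dupG_def dG_scaleR)

text \<open>This is the chain rule for f evaluated at squared radius 1 - theta^2: the derivative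
  acts on the odd coordinates of f, or on the squared radius, whose derivative is -2 y_q.\<close>

lemma dupG_PiG:
  assumes q: "q \<in> {1..2*n}" and f: "smooth_sfun n f" and \<xi>: "\<xi> \<noteq> 0"
  shows "dupG q (PiG n f \<xi>) = PiG n (\<lambda>x. gdup q (f x)) \<xi> - 2 *\<^sub>R (yG q * PiG n (Dr f) \<xi>)"
proof -
  define h where "h j = mkG n ((Dr ^^ j) f \<xi>)" for j
  have "dupG q (PiG n f \<xi>) = (\<Sum>j\<le>n. tG n ^ j * ((1 / fact j) *\<^sub>R dupG q (h j)))
      - (\<Sum>j\<le>n. (2 * real j) *\<^sub>R (yG q * (tG n ^ (j - 1) * ((1 / fact j) *\<^sub>R h j))))"
    by (simp only: PiG_def dupG_sum dupG_tG_power_mult[OF q] dupG_scaleR sum_subtractf h_def)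
  also have "(\<Sum>j\<le>n. tG n ^ j * ((1 / fact j) *\<^sub>R dupG q (h j))) = PiG n (\<lambda>x. gdup q (f x)) \<xi>"
    by (simp add: PiG_coeff_linear[OF coeff_linear_gdup[OF q] f \<xi>] mkG_gdup[OF q] h_def)
  also have "(\<Sum>j\<le>n. (2 * real j) *\<^sub>R (yG q * (tG n ^ (j - 1) * ((1 / fact j) *\<^sub>R h j))))
      = 2 *\<^sub>R (yG q * PiG n (Dr f) \<xi>)"
  proof -
    let ?F = "\<lambda>j. 2 *\<^sub>R (yG q * (tG n ^ j * ((1 / fact j) *\<^sub>R h (Suc j))))"
    have "(\<Sum>j\<le>n. (2 * real j) *\<^sub>R (yG q * (tG n ^ (j - 1) * ((1 / fact j) *\<^sub>R h j)))) = (\<Sum>j<n. ?F j)"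
    proof (cases n)
      case (Suc m)
      show ?thesis
        unfolding Suc
        by (subst sum.atMost_Suc_shift) (simp add: lessThan_Suc_atMost field_simps del: sum.atMost_Suc of_nat_Suc)
    qed simp
    \<comment> \<open>Lowering the exponent has cost one term; the missing one, j = n, contains y_q
      t^n = 0.\<close>
    also have "\<dots> = (\<Sum>j\<le>n. ?F j)"
      using yG_tG_power_eq_0[OF q] by (simp add: lessThan_Suc_atMost[symmetric] flip: mult.assoc)
    also have "\<dots> = 2 *\<^sub>R (yG q * PiG n (Dr f) \<xi>)"
      by (simp add: PiG_def h_def sum_distrib_left scaleR_sum_right funpow_swap1)
    finally show ?thesis .
  qed
  finally show ?thesis .
qed

section \<open>Rotations and even derivatives of the pullback\<close>

text \<open>The flow moves \<xi> only and leaves theta fixed, so differentiation is termwise;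
  rotations then pass through the powers of the radial derivative.\<close>

lemma sphL_pi_sharp:
  assumes f: "smooth_sfun n f" and \<xi>: "\<xi> \<noteq> 0" and S: "S \<subseteq> {1..2*n}"
  shows "sphL a b (pi_sharp n f) \<xi> S = pi_sharp n (\<lambda>x S. rotD a b (\<lambda>y. f y S) x) \<xi> S"
proof -
  have "((\<lambda>t. pi_sharp n f (rot a b t \<xi>) S) has_real_derivative
      (\<Sum>j\<le>n. ((-1) ^ j / fact j) * (\<Sum>A\<in>Pow S. gsign A (S - A) * gpow (theta2 n) j A
         * rotD a b ((rD ^^ j) (\<lambda>y. f y (S - A))) \<xi>))) (at 0)"
    unfolding pi_sharp_def gmul_def Dr_pow_eq
  proof (intro DERIV_sum DERIV_cmult DERIV_rot smooth0_differentiable smooth0_rD_pow \<xi>)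
    fix A
    assume "A \<in> Pow S"
    then have "S - A \<subseteq> {1..2*n}" using S by auto
    then show "smooth0 (\<lambda>y. f y (S - A))" using f by (simp add: smooth_sfun_def)
  qed
  then have "sphL a b (pi_sharp n f) \<xi> S
      = (\<Sum>j\<le>n. ((-1) ^ j / fact j) * (\<Sum>A\<in>Pow S. gsign A (S - A) * gpow (theta2 n) j A
         * rotD a b ((rD ^^ j) (\<lambda>y. f y (S - A))) \<xi>))"
    unfolding sphL_def by (rule DERIV_imp_deriv)
  also have "\<dots> = pi_sharp n (\<lambda>x S. rotD a b (\<lambda>y. f y S) x) \<xi> S"
    unfolding pi_sharp_def gmul_def Dr_pow_eq
  proof (intro sum.cong refl arg_cong2[where f = "(*)"])
    fix j A
    assume "A \<in> Pow S"
    then have "S - A \<subseteq> {1..2*n}" using S by auto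
    then have "smooth0 (\<lambda>y. f y (S - A))" using f by (simp add: smooth_sfun_def)
    from rD_pow_rotD_commute[OF this, of j a b] \<xi>
    show "rotD a b ((rD ^^ j) (\<lambda>y. f y (S - A))) \<xi> = (rD ^^ j) (\<lambda>x. rotD a b (\<lambda>y. f y (S - A)) x) \<xi>"
      by (simp add: agree0_def)
  qed
  finally show ?thesis .
qed

lemma mkG_sphL_pi_sharp:
  assumes "smooth_sfun n f" "\<xi> \<noteq> 0"
  shows "mkG n (sphL a b (pi_sharp n f) \<xi>) = PiG n (\<lambda>x S. rotD a b (\<lambda>y. f y S) x) \<xi>"
  unfolding mkG_pi_sharp[symmetric] by (rule mkG_eqI) (rule sphL_pi_sharp[OF assms])

lemma smooth_sfun_rotD: "smooth_sfun n f \<Longrightarrow> smooth_sfun n (\<lambda>x S. rotD a b (\<lambda>y. f y S) x)"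
  unfolding smooth_sfun_def using smooth0_rotD by blast

lemma smooth_sfun_epart: "smooth_sfun n f \<Longrightarrow> smooth_sfun n (\<lambda>x S. epart a (\<lambda>y. f y S) x)"
  unfolding smooth_sfun_def using smooth0_epart by blast

lemma smooth_sfun_Dr: "smooth_sfun n f \<Longrightarrow> smooth_sfun n (Dr f)"
  unfolding smooth_sfun_def using smooth0_rD[of "\<lambda>y. f y _"] by (simp add: Dr_def rD_def[abs_def])

lemma smooth_sfun_mult: "smooth0 w \<Longrightarrow> smooth_sfun n f \<Longrightarrow> smooth_sfun n (\<lambda>x S. w x * f x S)"
  unfolding smooth_sfun_def using smooth0_mult by blast

text \<open>With E the Euler field, the sum of x_l (x_l d_a - x_a d_l) over l is |x|^2 d_a - x_a E.
  Dividing by |x|^2 and writing E as 2|x|^2 times the radial operator gives the splitting.\<close>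

lemma epart_radial_tangential:
  fixes g :: "real^'m::finite \<Rightarrow> real"
  assumes "smooth0 g" "x \<noteq> 0"
  shows "epart a g x = 2 * (x $ a * rD g x) + (\<Sum>l\<in>UNIV. x $ l * inverse (x \<bullet> x) * rotD l a g x)"
proof -
  define E where "E = (\<Sum>i\<in>UNIV. x $ i * epart i g x)"
  have xx: "x \<bullet> x = (\<Sum>l\<in>UNIV. x $ l * x $ l)" by (simp add: inner_vec_def)
  have "(\<Sum>l\<in>UNIV. x $ l * inverse (x \<bullet> x) * rotD l a g x)
      = inverse (x \<bullet> x) * ((\<Sum>l\<in>UNIV. x $ l * x $ l) * epart a g x - x $ a * E)"
    by (simp add: rotD_def E_def sum_distrib_left sum_distrib_right sum_subtractf algebra_simps)
  also have "\<dots> = epart a g x - x $ a * E * inverse (x \<bullet> x)"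
    using assms(2) by (simp add: xx[symmetric] algebra_simps)
  finally show ?thesis
    using rD_eq[OF smooth0_differentiable[OF assms]] by (simp add: E_def)
qed

text \<open>The weights x_a and x_l/|x|^2 have degrees 1 and -1, hence exponents 1/2 and -1/2. This
  is the origin of the square root and of its inverse in the mixed field J.\<close>

lemma PiG_epart:
  fixes f :: "'m::finite sfun"
  assumes f: "smooth_sfun n f" and \<xi>: "norm \<xi> = 1"
  shows "PiG n (\<lambda>x S. epart a (\<lambda>y. f y S) x) \<xi> = (2 * \<xi> $ a) *\<^sub>R (bG n (1/2) * PiG n (Dr f) \<xi>)
    + (\<Sum>l\<in>UNIV. \<xi> $ l *\<^sub>R (bG n (-1/2) * PiG n (\<lambda>x S. rotD l a (\<lambda>y. f y S) x) \<xi>))"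
proof -
  have \<xi>0: "\<xi> \<noteq> 0" using \<xi> by auto
  have s1: "smooth_sfun n (\<lambda>x S. x $ a * Dr f x S)"
    by (intro smooth_sfun_mult smooth0_coord smooth_sfun_Dr f)
  have s2: "smooth_sfun n (\<lambda>x S. x $ l * inverse (x \<bullet> x) * rotD l a (\<lambda>y. f y S) x)" for l
    by (intro smooth_sfun_mult smooth0_mult smooth0_coord smooth0_inverse_inner smooth_sfun_rotD f)
  have s3: "smooth_sfun n (\<lambda>x S. \<Sum>l\<in>UNIV. 1 * (x $ l * inverse (x \<bullet> x) * rotD l a (\<lambda>y. f y S) x))"
    using s2 by (auto simp: smooth_sfun_def intro!: smooth0_sum)
  \<comment> \<open>The factors 1 bring the expression into the shape of \<open>PiG_lincomb\<close>
    and \<open>PiG_sum\<close>.\<close>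
  have "PiG n (\<lambda>x S. epart a (\<lambda>y. f y S) x) \<xi>
      = PiG n (\<lambda>x S. 2 * (x $ a * Dr f x S) + 1 * (\<Sum>l\<in>UNIV. 1 * (x $ l * inverse (x \<bullet> x) * rotD l a (\<lambda>y. f y S) x))) \<xi>"
  proof (rule PiG_cong[OF _ \<xi>0])
    fix x :: "real^'m" and S :: "nat set"
    assume "x \<noteq> 0" "S \<subseteq> {1..2*n}"
    then show "epart a (\<lambda>y. f y S) x
        = 2 * (x $ a * Dr f x S) + 1 * (\<Sum>l\<in>UNIV. 1 * (x $ l * inverse (x \<bullet> x) * rotD l a (\<lambda>y. f y S) x))"
      using epart_radial_tangential[of "\<lambda>y. f y S" x a] f by (simp add: smooth_sfun_def Dr_def rD_def)
  qed
  also have "\<dots> = 2 *\<^sub>R PiG n (\<lambda>x S. x $ a * Dr f x S) \<xi>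
      + PiG n (\<lambda>x S. \<Sum>l\<in>UNIV. 1 * (x $ l * inverse (x \<bullet> x) * rotD l a (\<lambda>y. f y S) x)) \<xi>"
    using PiG_lincomb[OF s1 s3 \<xi>0, of 2 1] by simp
  also have "\<dots> = 2 *\<^sub>R PiG n (\<lambda>x S. x $ a * Dr f x S) \<xi>
      + (\<Sum>l\<in>UNIV. PiG n (\<lambda>x S. x $ l * inverse (x \<bullet> x) * rotD l a (\<lambda>y. f y S) x) \<xi>)"
    using PiG_sum[of UNIV n "\<lambda>l x S. x $ l * inverse (x \<bullet> x) * rotD l a (\<lambda>y. f y S) x" \<xi> "\<lambda>_. 1"] s2 \<xi>0 by simp
  also have "\<dots> = (2 * \<xi> $ a) *\<^sub>R (bG n (1/2) * PiG n (Dr f) \<xi>)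
    + (\<Sum>l\<in>UNIV. \<xi> $ l *\<^sub>R (bG n (-1/2) * PiG n (\<lambda>x S. rotD l a (\<lambda>y. f y S) x) \<xi>))"
    by (simp add: PiG_coord_mult[OF smooth_sfun_Dr[OF f] \<xi>] PiG_coord_inverse_mult[OF smooth_sfun_rotD[OF f] \<xi>])
  finally show ?thesis .
qed

section \<open>Pushing forward the vector fields\<close>

lemma finite_Idx [simp]: "finite (Idx n :: ('m::finite + nat) set)"
  by (simp add: Idx_def)

lemma partner_Idx:
  assumes "Inr q \<in> (Idx n :: ('m::finite + nat) set)"
  shows "odd q \<Longrightarrow> Inr (q + 1) \<in> (Idx n :: ('m + nat) set)"
    and "even q \<Longrightarrow> Inr (q - 1) \<in> (Idx n :: ('m + nat) set)"
  using assms partner_index[of q n] by (auto simp: Idx_def)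

lemma sum_up_coef_Inl:
  fixes F :: "'m::finite + nat \<Rightarrow> 'b::real_vector"
  shows "(\<Sum>b\<in>Idx n. up_coef (Inl a) b *\<^sub>R F b) = F (Inl a)"
proof -
  have "(\<Sum>b\<in>Idx n. up_coef (Inl a) b *\<^sub>R F b) = (\<Sum>b\<in>Idx n. if b = Inl a then F b else 0)"
    by (rule sum.cong) (auto simp: up_coef_def)
  then show ?thesis by (simp add: Idx_def)
qed

lemma sum_up_coef_Inr:
  fixes F :: "'m::finite + nat \<Rightarrow> 'b::real_vector"
  assumes q: "q \<in> {1..2*n}"
  shows "(\<Sum>b\<in>Idx n. up_coef (Inr q) b *\<^sub>R F b)
    = (if odd q then 2 *\<^sub>R F (Inr (q + 1)) else - 2 *\<^sub>R F (Inr (q - 1)))"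
proof -
  have q': "Inr q \<in> (Idx n :: ('m + nat) set)" using q by (simp add: Idx_def)
  show ?thesis
  proof (cases "odd q")
    case True
    then have "(\<Sum>b\<in>Idx n. up_coef (Inr q) b *\<^sub>R F b)
        = (\<Sum>b\<in>Idx n. if b = Inr (q + 1) then 2 *\<^sub>R F b else 0)"
      by (intro sum.cong) (auto simp: up_coef_def)
    then show ?thesis using partner_Idx(1)[OF q' True] True by simp
  next
    case False
    then have "(\<Sum>b\<in>Idx n. up_coef (Inr q) b *\<^sub>R F b)
        = (\<Sum>b\<in>Idx n. if b = Inr (q - 1) then - 2 *\<^sub>R F b else 0)"
      by (intro sum.cong) (auto simp: up_coef_def)
    then show ?thesis using partner_Idx(2)[OF q'] False by simp
  qed
qed

lemma sum_upY:
  fixes F :: "nat \<Rightarrow> 'b::real_vector"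
  assumes q: "q \<in> {1..2*n}"
  shows "(\<Sum>l\<in>{1..2*n}. upY q l *\<^sub>R F l) = (if odd q then 2 *\<^sub>R F (q + 1) else - 2 *\<^sub>R F (q - 1))"
proof (cases "odd q")
  case True
  then have "(\<Sum>l\<in>{1..2*n}. upY q l *\<^sub>R F l) = (\<Sum>l\<in>{1..2*n}. if l = q + 1 then 2 *\<^sub>R F l else 0)"
    by (intro sum.cong) (auto simp: upY_def)
  then show ?thesis using partner_index(1)[OF q True] True by simp
next
  case False
  then have "(\<Sum>l\<in>{1..2*n}. upY q l *\<^sub>R F l) = (\<Sum>l\<in>{1..2*n}. if l = q - 1 then - 2 *\<^sub>R F l else 0)"
    by (intro sum.cong) (auto simp: upY_def)
  then show ?thesis using partner_index(2)[OF q] False by simp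
qed

lemma mkG_sf_coord:
  shows "mkG n (sf_coord (Inl a) x) = x $ a *\<^sub>R 1"
    and "p \<in> {1..2*n} \<Longrightarrow> mkG n (sf_coord (Inr p) x) = yG p"
  by (simp_all add: sf_coord_def mkG_gconst mkG_ggen)

lemma mkG_L_R:
  "mkG n (L_R i j b x) = up_coef j b *\<^sub>R mkG n (sf_coord i x)
     - ((-1) ^ (par i * par j) * up_coef i b) *\<^sub>R mkG n (sf_coord j x)"
  by (simp only: L_R_def mkG_diff mkG_scale)

definition sf_dup :: "'m::finite + nat \<Rightarrow> 'm sfun \<Rightarrow> 'm sfun" where
  "sf_dup b f = (case b of Inl i \<Rightarrow> (\<lambda>x S. epart i (\<lambda>y. f y S) x) | Inr q \<Rightarrow> (\<lambda>x. gdup q (f x)))"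

lemma sum_up_coef_sf_dlow:
  assumes "j \<in> Idx n"
  shows "(\<Sum>b\<in>Idx n. up_coef j b *\<^sub>R mkG n (sf_dlow b f x)) = mkG n (sf_dup j f x)"
proof (cases j)
  case (Inl a)
  then show ?thesis by (simp add: sum_up_coef_Inl sf_dlow_def sf_dup_def)
next
  case (Inr q)
  then have q: "q \<in> {1..2*n}" using assms by (auto simp: Idx_def)
  show ?thesis
    using mkG_gder[OF partner_index(1)[OF q]] mkG_gder[OF partner_index(2)[OF q]]
    by (auto simp: Inr sum_up_coef_Inr[OF q] sf_dlow_def sf_dup_def mkG_gdup[OF q] dupG_def)
qed

lemma mkG_vf_apply_L_R:
  assumes "i \<in> Idx n" "j \<in> Idx n"
  shows "mkG n (vf_apply n (L_R i j) f x) = mkG n (sf_coord i x) * mkG n (sf_dup j f x)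
    - (-1) ^ (par i * par j) *\<^sub>R (mkG n (sf_coord j x) * mkG n (sf_dup i f x))"
proof -
  have "mkG n (vf_apply n (L_R i j) f x)
      = (\<Sum>b\<in>Idx n. mkG n (sf_coord i x) * (up_coef j b *\<^sub>R mkG n (sf_dlow b f x))
        - (-1) ^ (par i * par j) *\<^sub>R (mkG n (sf_coord j x) * (up_coef i b *\<^sub>R mkG n (sf_dlow b f x))))"
    by (simp add: vf_apply_def mkG_sum mkG_gmul mkG_L_R left_diff_distrib)
  also have "\<dots> = mkG n (sf_coord i x) * (\<Sum>b\<in>Idx n. up_coef j b *\<^sub>R mkG n (sf_dlow b f x))
        - (-1) ^ (par i * par j) *\<^sub>R (mkG n (sf_coord j x) * (\<Sum>b\<in>Idx n. up_coef i b *\<^sub>R mkG n (sf_dlow b f x)))"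
    by (simp add: sum_subtractf sum_distrib_left scaleR_sum_right)
  finally show ?thesis by (simp only: sum_up_coef_sf_dlow assms)
qed

lemma PiG_cong_mkG:
  assumes "\<And>x. mkG n (f x) = mkG n (g x)" "\<xi> \<noteq> 0"
  shows "PiG n f \<xi> = PiG n g \<xi>"
  by (rule PiG_cong[OF _ assms(2)]) (rule mkG_eqD[OF assms(1)])

lemma smooth_sfun_sf_dup:
  assumes "j \<in> Idx n" "smooth_sfun n f"
  shows "smooth_sfun n (sf_dup j f)"
proof (cases j)
  case (Inl a)
  then show ?thesis using smooth_sfun_epart[OF assms(2)] by (simp add: sf_dup_def)
next
  case (Inr q)
  then have "q \<in> {1..2*n}" using assms(1) by (auto simp: Idx_def)
  from smooth_sfun_coeff_linear[OF coeff_linear_gdup[OF this] assms(2)] show ?thesis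
    by (simp add: Inr sf_dup_def)
qed

definition XiG :: "nat \<Rightarrow> real^'m::finite \<Rightarrow> 'm + nat \<Rightarrow> grassmann" where
  "XiG n \<xi> i = (case i of Inl a \<Rightarrow> \<xi> $ a *\<^sub>R bG n (1/2) | Inr p \<Rightarrow> yG p)"

lemma PiG_sf_coord_mult:
  assumes "i \<in> Idx n" "smooth_sfun n f" "norm \<xi> = 1"
  shows "PiG n (\<lambda>x. gmul (sf_coord i x) (f x)) \<xi> = XiG n \<xi> i * PiG n f \<xi>"
proof -
  have \<xi>0: "\<xi> \<noteq> 0" using assms(3) by auto
  show ?thesis
  proof (cases i)
    case (Inl a)
    have "PiG n (\<lambda>x. gmul (sf_coord i x) (f x)) \<xi> = PiG n (\<lambda>x S. x $ a * f x S) \<xi>"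
      by (rule PiG_cong_mkG[OF _ \<xi>0]) (simp add: Inl mkG_gmul mkG_sf_coord mkG_scale)
    then show ?thesis using PiG_coord_mult[OF assms(2,3)] by (simp add: Inl XiG_def)
  next
    case (Inr p)
    then have "p \<in> {1..2*n}" using assms(1) by (auto simp: Idx_def)
    from PiG_ggen_mult[OF this assms(2) \<xi>0] show ?thesis
      by (simp add: Inr XiG_def sf_coord_def)
  qed
qed

lemma smooth_sfun_cong: "(\<And>x S. S \<subseteq> {1..2*n} \<Longrightarrow> f x S = g x S) \<Longrightarrow> smooth_sfun n f \<Longrightarrow> smooth_sfun n g"
  by (simp add: smooth_sfun_def)

lemma smooth_sfun_sf_coord_mult:
  assumes "smooth_sfun n f"
  shows "smooth_sfun n (\<lambda>x. gmul (sf_coord i x) (f x))"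
proof (cases i)
  case (Inl a)
  have "smooth_sfun n (\<lambda>x S. x $ a * f x S)" by (intro smooth_sfun_mult smooth0_coord assms)
  then show ?thesis
    by (rule smooth_sfun_cong[rotated]) (auto simp: Inl sf_coord_def gmul_gconst_left dest: finite_subset)
next
  case (Inr p)
  then show ?thesis using smooth_sfun_coeff_linear[OF coeff_linear_gmul assms] by (simp add: sf_coord_def)
qed

lemma PiG_vf_apply_L_R:
  assumes "i \<in> Idx n" "j \<in> Idx n" "smooth_sfun n f" "norm \<xi> = 1"
  shows "PiG n (vf_apply n (L_R i j) f) \<xi> = XiG n \<xi> i * PiG n (sf_dup j f) \<xi>
    - (-1) ^ (par i * par j) *\<^sub>R (XiG n \<xi> j * PiG n (sf_dup i f) \<xi>)"
proof -
  have \<xi>0: "\<xi> \<noteq> 0" using assms(4) by auto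
  define s :: real where "s = - ((-1) ^ (par i * par j))"
  have "PiG n (vf_apply n (L_R i j) f) \<xi>
      = PiG n (\<lambda>x S. 1 * gmul (sf_coord i x) (sf_dup j f x) S + s * gmul (sf_coord j x) (sf_dup i f x) S) \<xi>"
    by (rule PiG_cong_mkG[OF _ \<xi>0])
       (simp only: mkG_vf_apply_L_R[OF assms(1,2)] mkG_add mkG_scale mkG_gmul, simp add: s_def)
  also have "\<dots> = XiG n \<xi> i * PiG n (sf_dup j f) \<xi> + s *\<^sub>R (XiG n \<xi> j * PiG n (sf_dup i f) \<xi>)"
    by (subst PiG_lincomb)
       (simp_all add: \<xi>0 PiG_sf_coord_mult smooth_sfun_sf_coord_mult smooth_sfun_sf_dup assms)
  finally show ?thesis by (simp add: s_def)
qed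

lemma mkG_sv_apply:
  "mkG n (sv_apply n V g \<xi>) = (\<Sum>a\<in>UNIV. \<Sum>b\<in>UNIV. mkG n (fst V a b \<xi>) * mkG n (sphL a b g \<xi>))
     + (\<Sum>l\<in>{1..2*n}. mkG n (snd V l \<xi>) * dG l (mkG n (g \<xi>)))"
  unfolding sv_apply_def mkG_add mkG_sum mkG_gmul by (simp add: mkG_gder)

lemma mkG_sv_apply_neg: "mkG n (sv_apply n (vfS_neg V) g \<xi>) = - mkG n (sv_apply n V g \<xi>)"
  by (simp add: mkG_sv_apply vfS_neg_def mkG_uminus sum_negf)

lemma sum_upY_dG:
  assumes "q \<in> {1..2*n}"
  shows "(\<Sum>l\<in>{1..2*n}. upY q l *\<^sub>R dG l a) = dupG q a"
  by (simp only: sum_upY[OF assms] dupG_def)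

text \<open>The odd part of J differentiates theta as well and leaves the extra term -2 \<xi>_a (1 -
  theta^2)^(1/2) y_q times the pullback of \<open>Dr f\<close>. Together with the rotational part of
  J it is -y_q times the pullback of the partial derivative along a, by
  \<open>PiG_epart\<close>.\<close>

lemma sv_apply_Jmixed:
  assumes q: "q \<in> {1..2*n}" and f: "smooth_sfun n f" and \<xi>: "norm \<xi> = 1"
  shows "mkG n (sv_apply n (Jmixed n a q) (pi_sharp n f) \<xi>) = PiG n (vf_apply n (L_R (Inl a) (Inr q)) f) \<xi>"
proof -
  have \<xi>0: "\<xi> \<noteq> 0" using \<xi> by auto
  have idx: "Inl a \<in> Idx n" "Inr q \<in> Idx n" using q by (auto simp: Idx_def)
  define R where "R c = PiG n (\<lambda>x S. rotD c a (\<lambda>y. f y S) x) \<xi>" for c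
  have "(\<Sum>c\<in>UNIV. \<Sum>d\<in>UNIV. mkG n (fst (Jmixed n a q) c d \<xi>) * mkG n (sphL c d (pi_sharp n f) \<xi>))
      = (\<Sum>c\<in>UNIV. (- \<xi> $ c) *\<^sub>R (yG q * bG n (-1/2) * R c))"
  proof (rule sum.cong[OF refl])
    fix c
    have "(\<Sum>d\<in>UNIV. mkG n (fst (Jmixed n a q) c d \<xi>) * mkG n (sphL c d (pi_sharp n f) \<xi>))
        = (\<Sum>d\<in>UNIV. if d = a then (- \<xi> $ c) *\<^sub>R (yG q * bG n (-1/2) * R c) else 0)"
    proof (rule sum.cong[OF refl])
      fix d
      show "mkG n (fst (Jmixed n a q) c d \<xi>) * mkG n (sphL c d (pi_sharp n f) \<xi>)
          = (if d = a then (- \<xi> $ c) *\<^sub>R (yG q * bG n (-1/2) * R c) else 0)"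
        using mkG_scale[of n "- \<xi> $ c" "gmul (ggen q) (invsqrt1m n)"]
        by (simp add: Jmixed_def mkG_zero mkG_gmul mkG_ggen[OF q] mkG_invsqrt1m R_def
            mkG_sphL_pi_sharp[OF f \<xi>0])
    qed
    then show "(\<Sum>d\<in>UNIV. mkG n (fst (Jmixed n a q) c d \<xi>) * mkG n (sphL c d (pi_sharp n f) \<xi>))
        = (- \<xi> $ c) *\<^sub>R (yG q * bG n (-1/2) * R c)" by simp
  qed
  also have "\<dots> = - (yG q * (\<Sum>c\<in>UNIV. \<xi> $ c *\<^sub>R (bG n (-1/2) * R c)))"
    by (simp add: sum_distrib_left sum_negf mult.assoc)
  finally have E: "(\<Sum>c\<in>UNIV. \<Sum>d\<in>UNIV. mkG n (fst (Jmixed n a q) c d \<xi>) * mkG n (sphL c d (pi_sharp n f) \<xi>))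
      = - (yG q * (\<Sum>c\<in>UNIV. \<xi> $ c *\<^sub>R (bG n (-1/2) * R c)))" .
  have "mkG n (snd (Jmixed n a q) l \<xi>) = upY q l *\<^sub>R (\<xi> $ a *\<^sub>R bG n (1/2))" for l
    by (simp add: Jmixed_def mkG_scale mkG_sqrt1m flip: mkG_scale)
       (simp only: mkG_scale mkG_sqrt1m scaleR_scaleR)
  then have "(\<Sum>l\<in>{1..2*n}. mkG n (snd (Jmixed n a q) l \<xi>) * dG l (mkG n (pi_sharp n f \<xi>)))
      = \<xi> $ a *\<^sub>R (bG n (1/2) * (\<Sum>l\<in>{1..2*n}. upY q l *\<^sub>R dG l (PiG n f \<xi>)))"
    by (simp add: mkG_pi_sharp sum_distrib_left scaleR_sum_right mult.commute)
  also have "\<dots> = \<xi> $ a *\<^sub>R (bG n (1/2) * (PiG n (\<lambda>x. gdup q (f x)) \<xi> - 2 *\<^sub>R (yG q * PiG n (Dr f) \<xi>)))"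
    by (simp only: sum_upY_dG[OF q] dupG_PiG[OF q f \<xi>0])
  finally have O: "(\<Sum>l\<in>{1..2*n}. mkG n (snd (Jmixed n a q) l \<xi>) * dG l (mkG n (pi_sharp n f \<xi>))) = \<dots>" .
  have "bG n (1/2) * (yG q * z) = yG q * (bG n (1/2) * z)" for z
    by (metis mult.assoc yG_bG_commute)
  then show ?thesis
    unfolding mkG_sv_apply E O PiG_vf_apply_L_R[OF idx f \<xi>]
    by (simp add: XiG_def sf_dup_def par_def PiG_epart[OF f \<xi>] R_def right_diff_distrib distrib_left scaleR_diff_right mult.commute)
qed

lemma sv_apply_Jsph:
  fixes f :: "'m::finite sfun"
  assumes i: "i \<in> Idx n" and j: "j \<in> Idx n" and f: "smooth_sfun n f" and \<xi>: "norm \<xi> = 1"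
  shows "mkG n (sv_apply n (Jsph n i j) (pi_sharp n f) \<xi>) = PiG n (vf_apply n (L_R i j) f) \<xi>"
proof -
  have \<xi>0: "\<xi> \<noteq> 0" using \<xi> by auto
  consider (EE) a b where "i = Inl a" "j = Inl b" | (EO) a q where "i = Inl a" "j = Inr q"
    | (OE) p b where "i = Inr p" "j = Inl b" | (OO) p q where "i = Inr p" "j = Inr q"
    by (meson sum.exhaust)
  then show ?thesis
  proof cases
    case EE
    have "mkG n (sv_apply n (Jsph n i j) (pi_sharp n f) \<xi>)
        = (\<Sum>c\<in>UNIV. \<Sum>d\<in>UNIV. if c = a \<and> d = b then mkG n (sphL c d (pi_sharp n f) \<xi>) else 0)"
      by (auto simp: mkG_sv_apply EE Jsph_def mkG_gconst intro!: sum.cong)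
    also have "\<dots> = (\<Sum>c\<in>UNIV. if c = a then mkG n (sphL a b (pi_sharp n f) \<xi>) else 0)"
    proof (rule sum.cong[OF refl])
      fix c
      show "(\<Sum>d\<in>UNIV. if c = a \<and> d = b then mkG n (sphL c d (pi_sharp n f) \<xi>) else 0)
          = (if c = a then mkG n (sphL a b (pi_sharp n f) \<xi>) else 0)"
        by (cases "c = a") simp_all
    qed
    also have "\<dots> = PiG n (\<lambda>x S. rotD a b (\<lambda>y. f y S) x) \<xi>"
      by (simp add: mkG_sphL_pi_sharp[OF f \<xi>0])
    also have "\<dots> = PiG n (vf_apply n (L_R i j) f) \<xi>"
      by (rule PiG_cong_mkG[OF _ \<xi>0], subst mkG_vf_apply_L_R[OF i j])
         (simp add: EE mkG_sf_coord sf_dup_def rotD_def mkG_diff mkG_scale par_def)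
    finally show ?thesis .
  next
    case EO
    then show ?thesis using sv_apply_Jmixed[OF _ f \<xi>, of q a] j by (auto simp: Jsph_def Idx_def)
  next
    case OE
    then have "p \<in> {1..2*n}" using i by (auto simp: Idx_def)
    from sv_apply_Jmixed[OF this f \<xi>, of b]
    \<comment> \<open>For opposite parities the sign (-1)^([i][j]) is 1, so both J and L are
      antisymmetric in their indices.\<close>
    have "mkG n (sv_apply n (Jsph n i j) (pi_sharp n f) \<xi>) = - PiG n (vf_apply n (L_R j i) f) \<xi>"
      by (simp add: OE Jsph_def mkG_sv_apply_neg)
    then show ?thesis
      by (simp add: PiG_vf_apply_L_R i j f \<xi>) (simp add: OE par_def)
  next
    case OO
    then have p: "p \<in> {1..2*n}" and q: "q \<in> {1..2*n}" using i j by (auto simp: Idx_def)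
    have snd: "mkG n (snd (Jsph n i j) l \<xi>) = upY q l *\<^sub>R yG p + upY p l *\<^sub>R yG q" for l
      by (simp add: OO Jsph_def mkG_add mkG_scale mkG_ggen p q)
         (simp only: mkG_add mkG_scale mkG_ggen[OF p] mkG_ggen[OF q])
    have "mkG n (sv_apply n (Jsph n i j) (pi_sharp n f) \<xi>)
        = yG p * (\<Sum>l\<in>{1..2*n}. upY q l *\<^sub>R dG l (PiG n f \<xi>)) + yG q * (\<Sum>l\<in>{1..2*n}. upY p l *\<^sub>R dG l (PiG n f \<xi>))"
      unfolding mkG_sv_apply snd
      by (simp add: OO Jsph_def mkG_gconst mkG_pi_sharp distrib_right sum.distrib sum_distrib_left)
    also have "\<dots> = yG p * (PiG n (\<lambda>x. gdup q (f x)) \<xi> - 2 *\<^sub>R (yG q * PiG n (Dr f) \<xi>))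
        + yG q * (PiG n (\<lambda>x. gdup p (f x)) \<xi> - 2 *\<^sub>R (yG p * PiG n (Dr f) \<xi>))"
      by (simp only: sum_upY_dG p q dupG_PiG[OF p f \<xi>0] dupG_PiG[OF q f \<xi>0])
    \<comment> \<open>The radial corrections carry y_p y_q + y_q y_p = 0.\<close>
    also have "\<dots> = yG p * PiG n (\<lambda>x. gdup q (f x)) \<xi> + yG q * PiG n (\<lambda>x. gdup p (f x)) \<xi>"
      by (simp add: right_diff_distrib yG_anticommute_left[of p q])
    also have "\<dots> = PiG n (vf_apply n (L_R i j) f) \<xi>"
      by (simp add: PiG_vf_apply_L_R i j f \<xi>) (simp add: OO par_def XiG_def sf_dup_def)
    finally show ?thesis .
  qed
qed

section \<open>The induced metric\<close>

lemma sum_low_coef_up_coef: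
  fixes a l :: "'m::finite + nat"
  assumes "a \<in> Idx n" "l \<in> Idx n"
  shows "(\<Sum>b\<in>Idx n. low_coef b a * up_coef l b) = (if a = l then 1 else 0)"
proof -
  have eq: "(\<Sum>b\<in>Idx n. low_coef b a * up_coef l b) = (\<Sum>b\<in>Idx n. up_coef l b *\<^sub>R low_coef b a)"
    by (simp add: mult.commute)
  show ?thesis
  proof (cases l)
    case (Inl c)
    show ?thesis unfolding eq unfolding Inl sum_up_coef_Inl by (simp add: low_coef_def)
  next
    case (Inr q)
    then have q: "q \<in> {1..2*n}" using assms by (auto simp: Idx_def)
    show ?thesis
      unfolding eq unfolding Inr sum_up_coef_Inr[OF q]
      using q by (cases "odd q") (simp_all add: low_coef_def)
  qed
qed

lemma sum_low_coef_L_R: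
  assumes "a \<in> Idx n" "k \<in> Idx n" "l \<in> Idx n"
  shows "(\<Sum>b\<in>Idx n. low_coef b a *\<^sub>R mkG n (L_R k l b x))
    = (if a = l then mkG n (sf_coord k x) else 0)
      - (-1) ^ (par k * par l) *\<^sub>R (if a = k then mkG n (sf_coord l x) else 0)"
proof -
  have "(\<Sum>b\<in>Idx n. low_coef b a *\<^sub>R mkG n (L_R k l b x))
      = (\<Sum>b\<in>Idx n. low_coef b a * up_coef l b) *\<^sub>R mkG n (sf_coord k x)
      - ((-1) ^ (par k * par l) * (\<Sum>b\<in>Idx n. low_coef b a * up_coef k b)) *\<^sub>R mkG n (sf_coord l x)"
    by (simp add: mkG_L_R scaleR_diff_right sum_subtractf scaleR_sum_left sum_distrib_left mult_ac)
  then show ?thesis using assms by (simp add: sum_low_coef_up_coef)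
qed

lemma invG_uminus: "invG (- a) = - invG a"
  using invG_scaleR[of "-1" a] by simp

lemma invG_diff: "invG (a - b) = invG a - invG b"
  using invG_add[of a "- b"] by (simp add: invG_uminus)

lemma invG_sf_coord:
  assumes "k \<in> Idx n"
  shows "(if par l = 1 then invG (mkG n (sf_coord k x)) else mkG n (sf_coord k x))
    = (-1) ^ (par k * par l) *\<^sub>R mkG n (sf_coord k x)"
  using assms by (cases k; cases l) (auto simp: par_def Idx_def mkG_sf_coord invG_scaleR invG_one invG_yG)

text \<open>Expressed in the frame with raised indices, the second field has components at l and k
  only, so the double sum collapses to the corresponding components of the first field.\<close>

lemma mkG_metric_L_R:
  fixes i j k l :: "'m::finite + nat"
  assumes "i \<in> Idx n" "j \<in> Idx n" "k \<in> Idx n" "l \<in> Idx n"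
  defines "X \<equiv> \<lambda>i x. mkG n (sf_coord i x)"
  shows "mkG n (metric_R n (L_R i j) (L_R k l) x)
    = (-1) ^ (par k * par l) *\<^sub>R ((up_coef j l *\<^sub>R X i x - ((-1) ^ (par i * par j) * up_coef i l) *\<^sub>R X j x) * X k x)
      - (up_coef j k *\<^sub>R X i x - ((-1) ^ (par i * par j) * up_coef i k) *\<^sub>R X j x) * X l x"
proof -
  define \<sigma> where "\<sigma> a z = (if par a = 1 then invG z else z)" for a :: "'m + nat" and z
  have \<sigma>_lin: "\<sigma> a (r *\<^sub>R y) = r *\<^sub>R \<sigma> a y" "\<sigma> a (y - z) = \<sigma> a y - \<sigma> a z" "\<sigma> a 0 = 0"
    "\<sigma> a (sum F I) = (\<Sum>b\<in>I. \<sigma> a (F b))" for a r y z F and I :: "('m + nat) set"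
    by (simp_all add: \<sigma>_def invG_scaleR invG_diff invG_zero invG_sum)
  define V where "V a = mkG n (L_R i j a x)" for a
  have "mkG n (if par a = 1 then ginv w else w) = \<sigma> a (mkG n w)" for a :: "'m + nat" and w
    by (simp add: \<sigma>_def mkG_ginv)
  then have "mkG n (metric_R n (L_R i j) (L_R k l) x)
      = (\<Sum>a\<in>Idx n. \<Sum>b\<in>Idx n. low_coef b a *\<^sub>R (V a * \<sigma> a (mkG n (L_R k l b x))))"
    by (simp only: metric_R_def mkG_sum mkG_scale mkG_gmul V_def)
  also have "\<dots> = (\<Sum>a\<in>Idx n. V a * \<sigma> a (\<Sum>b\<in>Idx n. low_coef b a *\<^sub>R mkG n (L_R k l b x)))"
    by (simp add: \<sigma>_lin sum_distrib_left)
  also have "\<dots> = (\<Sum>a\<in>Idx n. (if a = l then V a * \<sigma> a (X k x) else 0)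
      - (-1) ^ (par k * par l) *\<^sub>R (if a = k then V a * \<sigma> a (X l x) else 0))"
    by (intro sum.cong refl) (simp add: sum_low_coef_L_R assms(3,4) \<sigma>_lin X_def right_diff_distrib)
  also have "\<dots> = V l * \<sigma> l (X k x) - (-1) ^ (par k * par l) *\<^sub>R (V k * \<sigma> k (X l x))"
    using assms(3,4) by (simp add: sum_subtractf flip: scaleR_sum_right)
  also have "\<sigma> l (X k x) = (-1) ^ (par k * par l) *\<^sub>R X k x"
    unfolding \<sigma>_def X_def by (rule invG_sf_coord[OF assms(3)])
  also have "\<sigma> k (X l x) = (-1) ^ (par k * par l) *\<^sub>R X l x"
    unfolding \<sigma>_def X_def using invG_sf_coord[OF assms(4), of k x] by (simp add: mult.commute)
  finally have "mkG n (metric_R n (L_R i j) (L_R k l) x)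
      = (-1) ^ (par k * par l) *\<^sub>R (V l * X k x)
        - ((-1) ^ (par k * par l) * (-1) ^ (par k * par l)) *\<^sub>R (V k * X l x)" by simp
  \<comment> \<open>In the second term the sign in the definition of L meets the equal sign of
    graded bilinearity.\<close>
  also have "(-1::real) ^ (par k * par l) * (-1) ^ (par k * par l) = 1"
    by (simp flip: power_mult_distrib)
  finally show ?thesis
    by (simp only: V_def mkG_L_R X_def scaleR_one)
qed

section \<open>Pulling back the ambient metric\<close>

text \<open>The formula of \<open>mkG_metric_L_R\<close> with each coordinate replaced by its
  pullback: the common value to which both sides of the metric identity are reduced.\<close>

definition coord_metric :: "nat \<Rightarrow> real^'m::finite \<Rightarrow> 'm + nat \<Rightarrow> 'm + nat \<Rightarrow> 'm + nat \<Rightarrow> 'm + nat \<Rightarrow> grassmann" where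
  "coord_metric n \<xi> i j k l =
    (-1) ^ (par k * par l) *\<^sub>R ((up_coef j l *\<^sub>R XiG n \<xi> i - ((-1) ^ (par i * par j) * up_coef i l) *\<^sub>R XiG n \<xi> j) * XiG n \<xi> k)
      - (up_coef j k *\<^sub>R XiG n \<xi> i - ((-1) ^ (par i * par j) * up_coef i k) *\<^sub>R XiG n \<xi> j) * XiG n \<xi> l"

lemma PiG_const: "PiG n (\<lambda>x. c) \<xi> = mkG n c"
proof -
  have "(rD ^^ j) (\<lambda>y. r) x = (if j = 0 then r else 0)" for j r and x :: "real^'a"
  proof (induction j arbitrary: x)
    case (Suc j)
    then have "(rD ^^ j) (\<lambda>y::real^'a. r) = (\<lambda>x. if j = 0 then r else 0)" by auto
    then show ?case by (simp add: rD_const)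
  qed simp
  then have "(Dr ^^ j) (\<lambda>x::real^'a. c) \<xi> = (\<lambda>S. (if j = 0 then 1 else 0) * c S)" for j
    by (auto simp: Dr_pow_eq)
  then have "PiG n (\<lambda>x. c) \<xi> = (\<Sum>j\<le>n. if j = 0 then mkG n c else 0)"
    unfolding PiG_def by (intro sum.cong refl) (simp add: mkG_zero)
  then show ?thesis by simp
qed

lemma smooth_sfun_const: "smooth_sfun n (\<lambda>x. c)"
  by (simp add: smooth_sfun_def smooth0_const)

lemma smooth_sfun_sf_coord: "smooth_sfun n (sf_coord i)" for i :: "'a::finite + nat"
proof -
  have "smooth0 (\<lambda>x. if b then x $ a else 0)" for a :: 'a and b
    by (cases b) (simp_all add: smooth0_const smooth0_coord)
  then show ?thesis
    by (cases i) (simp_all add: smooth_sfun_def sf_coord_def gconst_def smooth0_const)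
qed

lemma PiG_sf_coord:
  assumes "i \<in> Idx n" "norm \<xi> = 1"
  shows "PiG n (sf_coord i) \<xi> = XiG n \<xi> i"
proof -
  have "\<xi> \<noteq> 0" using assms(2) by auto
  then have "PiG n (sf_coord i) \<xi> = PiG n (\<lambda>x. gmul (sf_coord i x) (gconst 1)) \<xi>"
    by (intro PiG_cong_mkG) (simp_all add: mkG_gmul mkG_gconst)
  also have "\<dots> = XiG n \<xi> i"
    using PiG_sf_coord_mult[OF assms(1) smooth_sfun_const assms(2), of "gconst 1"] by (simp add: PiG_const mkG_gconst)
  finally show ?thesis .
qed

lemma smooth_sfun_lincomb:
  assumes "smooth_sfun n f" "smooth_sfun n g"
  shows "smooth_sfun n (\<lambda>x S. c * f x S + d * g x S)"
  unfolding smooth_sfun_def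
proof (intro allI impI)
  fix S
  assume "S \<subseteq> {1..2*n}"
  then have "smooth0 (\<lambda>x. f x S)" "smooth0 (\<lambda>x. g x S)" using assms by (simp_all add: smooth_sfun_def)
  then show "smooth0 (\<lambda>x. c * f x S + d * g x S)"
    by (intro smooth0_add smooth0_mult smooth0_const)
qed

lemma PiG_metric_L_R:
  assumes "i \<in> Idx n" "j \<in> Idx n" "k \<in> Idx n" "l \<in> Idx n" "norm \<xi> = 1"
  shows "PiG n (metric_R n (L_R i j) (L_R k l)) \<xi> = coord_metric n \<xi> i j k l"
proof -
  have \<xi>0: "\<xi> \<noteq> 0" using assms(5) by auto
  define s where "s = (-1::real) ^ (par k * par l)"
  define s' where "s' = (-1::real) ^ (par i * par j)"
  define P where "P a b x = gmul (sf_coord a x) (sf_coord b x)" for a b :: "'a + nat" and x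
  have smP: "smooth_sfun n (P a b)" for a b
    unfolding P_def by (intro smooth_sfun_sf_coord_mult smooth_sfun_sf_coord)
  have PP: "PiG n (P a b) \<xi> = XiG n \<xi> a * XiG n \<xi> b" if "a \<in> Idx n" "b \<in> Idx n" for a b
    unfolding P_def using that assms(5) by (simp add: PiG_sf_coord_mult smooth_sfun_sf_coord PiG_sf_coord)
  define f1 where "f1 x S = (s * up_coef j l) * P i k x S + (- s * s' * up_coef i l) * P j k x S" for x S
  define f2 where "f2 x S = up_coef j k * P i l x S + (- s' * up_coef i k) * P j l x S" for x S
  have sm12: "smooth_sfun n f1" "smooth_sfun n f2"
    unfolding f1_def f2_def by (intro smooth_sfun_lincomb smP)+
  have "PiG n (metric_R n (L_R i j) (L_R k l)) \<xi> = PiG n (\<lambda>x S. f1 x S - f2 x S) \<xi>"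
    by (rule PiG_cong_mkG[OF _ \<xi>0])
       (simp only: mkG_metric_L_R[OF assms(1-4)] f1_def f2_def mkG_diff mkG_add mkG_scale P_def mkG_gmul,
        simp add: s_def s'_def algebra_simps)
  also have "\<dots> = PiG n f1 \<xi> - PiG n f2 \<xi>" by (rule PiG_diff[OF sm12 \<xi>0])
  also have "PiG n f1 \<xi> = (s * up_coef j l) *\<^sub>R (XiG n \<xi> i * XiG n \<xi> k) + (- s * s' * up_coef i l) *\<^sub>R (XiG n \<xi> j * XiG n \<xi> k)"
    unfolding f1_def using PiG_lincomb[OF smP smP \<xi>0] by (simp only: PP assms)
  also have "PiG n f2 \<xi> = up_coef j k *\<^sub>R (XiG n \<xi> i * XiG n \<xi> l) + (- s' * up_coef i k) *\<^sub>R (XiG n \<xi> j * XiG n \<xi> l)"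
    unfolding f2_def using PiG_lincomb[OF smP smP \<xi>0] by (simp only: PP assms)
  finally show ?thesis
    by (simp add: coord_metric_def s_def s'_def algebra_simps)
qed

section \<open>The metric of the supersphere\<close>

text \<open>The rotation fields are linearly dependent. Collecting them into one ambient vector with
  Grassmann components turns the fourfold sum of round metrics into a scalar product.\<close>

definition tangent :: "nat \<Rightarrow> 'm::finite vfS \<Rightarrow> real^'m \<Rightarrow> 'm \<Rightarrow> grassmann" where
  "tangent n V \<xi> e = (\<Sum>a\<in>UNIV. \<Sum>b\<in>UNIV. vecL a b \<xi> $ e *\<^sub>R mkG n (fst V a b \<xi>))"

text \<open>The metric on the odd frame with raised indices, in which the fields J are written;
  \<open>sum_upY_Gy\<close> derives it from the given one.\<close>

definition odd_metric :: "nat \<Rightarrow> nat \<Rightarrow> nat \<Rightarrow> grassmann" where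
  "odd_metric n q s = upY q s *\<^sub>R 1 + yG q * yG s * bG n (-1)"

definition odd_form :: "nat \<Rightarrow> (nat \<Rightarrow> grassmann) \<Rightarrow> (nat \<Rightarrow> grassmann) \<Rightarrow> grassmann" where
  "odd_form n v w = (\<Sum>k\<in>{1..2*n}. \<Sum>l\<in>{1..2*n}. v k * invG (w l) * mkG n (Gy n k l))"

lemma sum_round_metric:
  fixes V W :: "'m::finite \<Rightarrow> 'm \<Rightarrow> grassmann"
  shows "(\<Sum>a\<in>UNIV. \<Sum>b\<in>UNIV. \<Sum>c\<in>UNIV. \<Sum>d\<in>UNIV. round_metric a b c d \<xi> *\<^sub>R (V a b * W c d))
    = (\<Sum>e\<in>UNIV. (\<Sum>a\<in>UNIV. \<Sum>b\<in>UNIV. vecL a b \<xi> $ e *\<^sub>R V a b) * (\<Sum>c\<in>UNIV. \<Sum>d\<in>UNIV. vecL c d \<xi> $ e *\<^sub>R W c d))"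
proof -
  have pair: "(\<Sum>a\<in>UNIV. \<Sum>b\<in>UNIV. F a b) = (\<Sum>p\<in>UNIV. F (fst p) (snd p))" for F :: "'m \<Rightarrow> 'm \<Rightarrow> grassmann"
    by (simp add: sum.cartesian_product case_prod_unfold)
  define v where "v p e = vecL (fst p) (snd p) \<xi> $ e *\<^sub>R V (fst p) (snd p)" for p e
  define w where "w p e = vecL (fst p) (snd p) \<xi> $ e *\<^sub>R W (fst p) (snd p)" for p e
  have "round_metric (fst p) (snd p) (fst q) (snd q) \<xi> *\<^sub>R (V (fst p) (snd p) * W (fst q) (snd q))
      = (\<Sum>e\<in>UNIV. v p e * w q e)" for p q
    by (simp add: round_metric_def inner_vec_def v_def w_def scaleR_sum_left mult.commute)
  then have "(\<Sum>a\<in>UNIV. \<Sum>b\<in>UNIV. \<Sum>c\<in>UNIV. \<Sum>d\<in>UNIV. round_metric a b c d \<xi> *\<^sub>R (V a b * W c d))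
      = (\<Sum>p\<in>UNIV. \<Sum>q\<in>UNIV. \<Sum>e\<in>UNIV. v p e * w q e)"
    unfolding pair by simp
  also have "\<dots> = (\<Sum>p\<in>UNIV. \<Sum>e\<in>UNIV. \<Sum>q\<in>UNIV. v p e * w q e)"
    by (intro sum.cong refl sum.swap)
  also have "\<dots> = (\<Sum>e\<in>UNIV. \<Sum>p\<in>UNIV. \<Sum>q\<in>UNIV. v p e * w q e)"
    by (rule sum.swap)
  also have "\<dots> = (\<Sum>e\<in>UNIV. (\<Sum>p\<in>UNIV. v p e) * (\<Sum>q\<in>UNIV. w q e))"
    by (simp only: sum_product)
  finally show ?thesis unfolding pair v_def w_def .
qed

lemma mkG_sph_metric:
  "mkG n (sph_metric n V W \<xi>) = bG n 1 * (\<Sum>e\<in>UNIV. tangent n V \<xi> e * tangent n W \<xi> e)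
     + odd_form n (\<lambda>k. mkG n (snd V k \<xi>)) (\<lambda>l. mkG n (snd W l \<xi>))"
proof -
  have "mkG n (\<lambda>T. gmul v w T * r) = r *\<^sub>R (mkG n v * mkG n w)" for v w r
    using mkG_scale[of n r "gmul v w"] by (simp add: mkG_gmul mult.commute)
  then show ?thesis
    by (simp add: sph_metric_def mkG_add mkG_gmul mkG_diff mkG_gconst mkG_theta2 bG_1 mkG_sum
        sum_round_metric tangent_def odd_form_def mkG_ginv)
qed

definition yupG :: "nat \<Rightarrow> grassmann" where
  "yupG k = (if odd k then (1/2) *\<^sub>R yG (k + 1) else (-1/2) *\<^sub>R yG (k - 1))"

lemma mkG_yup:
  assumes "k \<in> {1..2*n}"
  shows "mkG n (yup k) = yupG k"
proof (cases "odd k")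
  case True
  then show ?thesis
    using mkG_scale[of n "1/2"] mkG_ggen[OF partner_index(1)[OF assms]] by (simp add: yup_def yupG_def)
next
  case False
  then show ?thesis
    using mkG_scale[of n "-1/2"] mkG_ggen[OF partner_index(2)[OF assms]] by (simp add: yup_def yupG_def)
qed

lemma mkG_Gy:
  assumes "k \<in> {1..2*n}" "l \<in> {1..2*n}"
  shows "mkG n (Gy n k l) = Jmat l k *\<^sub>R 1 + yupG k * yupG l * bG n (-1)"
  unfolding Gy_def mkG_add mkG_scale mkG_gmul mkG_gconst mkG_inv1m
  by (simp only: mkG_yup[OF assms(1)] mkG_yup[OF assms(2)] scaleR_one)

lemma sum_upY_yupG:
  assumes "q \<in> {1..2*n}"
  shows "(\<Sum>k\<in>{1..2*n}. upY q k *\<^sub>R yupG k) = - yG q"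
  unfolding sum_upY[OF assms] using assms by (auto simp: yupG_def)

text \<open>\<open>Jmat\<close> is the inverse matrix of \<open>upY\<close>, so the inner sum is a
  Kronecker delta.\<close>

lemma sum_upY_Jmat:
  assumes "q \<in> {1..2*n}" "s \<in> {1..2*n}"
  shows "(\<Sum>k\<in>{1..2*n}. \<Sum>l\<in>{1..2*n}. upY q k * (upY s l * Jmat l k)) = upY q s"
proof -
  have "(\<Sum>k\<in>{1..2*n}. \<Sum>l\<in>{1..2*n}. upY q k * (upY s l * Jmat l k))
      = (\<Sum>k\<in>{1..2*n}. upY q k *\<^sub>R (\<Sum>l\<in>{1..2*n}. upY s l *\<^sub>R Jmat l k))"
    by (simp add: sum_distrib_left)
  also have "\<dots> = upY q s"
    unfolding sum_upY[OF assms(1)] sum_upY[OF assms(2)]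
    using assms by (auto simp: upY_def Jmat_def elim!: oddE evenE)
  finally show ?thesis .
qed

lemma sum_upY_Gy:
  assumes "q \<in> {1..2*n}" "s \<in> {1..2*n}"
  shows "(\<Sum>k\<in>{1..2*n}. \<Sum>l\<in>{1..2*n}. (upY q k * upY s l) *\<^sub>R mkG n (Gy n k l)) = odd_metric n q s"
proof -
  have "(\<Sum>k\<in>{1..2*n}. \<Sum>l\<in>{1..2*n}. (upY q k * upY s l) *\<^sub>R mkG n (Gy n k l))
      = (\<Sum>k\<in>{1..2*n}. \<Sum>l\<in>{1..2*n}. (upY q k * (upY s l * Jmat l k)) *\<^sub>R 1
          + (upY q k *\<^sub>R yupG k) * (upY s l *\<^sub>R yupG l) * bG n (-1))"
    by (intro sum.cong refl) (simp add: mkG_Gy scaleR_add_right mult.assoc mult.commute)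
  also have "\<dots> = (\<Sum>k\<in>{1..2*n}. \<Sum>l\<in>{1..2*n}. upY q k * (upY s l * Jmat l k)) *\<^sub>R 1
      + (\<Sum>k\<in>{1..2*n}. upY q k *\<^sub>R yupG k) * (\<Sum>l\<in>{1..2*n}. upY s l *\<^sub>R yupG l) * bG n (-1)"
    by (subst sum_product) (simp only: sum.distrib scaleR_sum_left sum_distrib_right)
  also have "\<dots> = odd_metric n q s"
    by (simp only: sum_upY_Jmat[OF assms] sum_upY_yupG[OF assms(1)] sum_upY_yupG[OF assms(2)] odd_metric_def
        minus_mult_minus)
  finally show ?thesis .
qed

lemma odd_form_upY:
  assumes "q \<in> {1..2*n}" "s \<in> {1..2*n}"
  shows "odd_form n (\<lambda>k. upY q k *\<^sub>R a) (\<lambda>l. upY s l *\<^sub>R b) = a * invG b * odd_metric n q s"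
proof -
  have "odd_form n (\<lambda>k. upY q k *\<^sub>R a) (\<lambda>l. upY s l *\<^sub>R b)
     = (\<Sum>k\<in>{1..2*n}. \<Sum>l\<in>{1..2*n}. a * invG b * ((upY q k * upY s l) *\<^sub>R mkG n (Gy n k l)))"
    by (simp add: odd_form_def invG_scaleR mult.commute)
  then show ?thesis
    by (simp only: sum_upY_Gy[OF assms] flip: sum_distrib_left)
qed

lemma odd_form_add_left: "odd_form n (\<lambda>k. v k + v' k) w = odd_form n v w + odd_form n v' w"
  by (simp add: odd_form_def distrib_right sum.distrib)

lemma odd_form_add_right: "odd_form n v (\<lambda>l. w l + w' l) = odd_form n v w + odd_form n v w'"
  by (simp add: odd_form_def invG_add distrib_right distrib_left sum.distrib)

lemma odd_form_zero: "odd_form n (\<lambda>k. 0) w = 0" "odd_form n v (\<lambda>l. 0) = 0"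
  by (simp_all add: odd_form_def invG_zero)

lemma tangent_neg: "tangent n (vfS_neg V) \<xi> e = - tangent n V \<xi> e"
  by (simp add: tangent_def vfS_neg_def mkG_uminus sum_negf)

lemma sph_metric_neg:
  "mkG n (sph_metric n (vfS_neg V) W \<xi>) = - mkG n (sph_metric n V W \<xi>)"
  "mkG n (sph_metric n V (vfS_neg W) \<xi>) = - mkG n (sph_metric n V W \<xi>)"
proof -
  have s: "mkG n (snd (vfS_neg U) l \<xi>) = - mkG n (snd U l \<xi>)" for U :: "'a vfS" and l
    by (simp add: vfS_neg_def mkG_uminus)
  show "mkG n (sph_metric n (vfS_neg V) W \<xi>) = - mkG n (sph_metric n V W \<xi>)"
    "mkG n (sph_metric n V (vfS_neg W) \<xi>) = - mkG n (sph_metric n V W \<xi>)"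
    by (simp_all add: mkG_sph_metric tangent_neg s odd_form_def invG_uminus sum_negf)
qed

lemma tangent_even:
  "tangent n (Jsph n (Inl a) (Inl b)) \<xi> e = vecL a b \<xi> $ e *\<^sub>R 1"
proof -
  have "tangent n (Jsph n (Inl a) (Inl b)) \<xi> e
      = (\<Sum>c\<in>UNIV. \<Sum>d\<in>UNIV. if c = a \<and> d = b then vecL a b \<xi> $ e *\<^sub>R 1 else 0)"
    unfolding tangent_def by (intro sum.cong refl) (auto simp: Jsph_def mkG_gconst)
  also have "\<dots> = (\<Sum>c\<in>UNIV. if c = a then vecL a b \<xi> $ e *\<^sub>R 1 else 0)"
  proof (rule sum.cong[OF refl])
    fix c
    show "(\<Sum>d\<in>UNIV. if c = a \<and> d = b then vecL a b \<xi> $ e *\<^sub>R 1 else 0)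
        = (if c = a then vecL a b \<xi> $ e *\<^sub>R (1::grassmann) else 0)"
      by (cases "c = a") simp_all
  qed
  finally show ?thesis by simp
qed

text \<open>At a unit vector this combination of rotation fields is the orthogonal projection of the
  axis a onto the tangent space.\<close>

lemma sum_vecL:
  fixes \<xi> :: "real^'m::finite"
  assumes "norm \<xi> = 1"
  shows "(\<Sum>c\<in>UNIV. \<xi> $ c * vecL c a \<xi> $ e) = (if e = a then 1 else 0) - \<xi> $ a * \<xi> $ e"
proof -
  have one: "(\<Sum>c\<in>UNIV. \<xi> $ c * \<xi> $ c) = 1"
    using assms by (simp add: norm_eq_1 inner_vec_def)
  have "(\<Sum>c\<in>UNIV. \<xi> $ c * vecL c a \<xi> $ e)
      = (\<Sum>c\<in>UNIV. \<xi> $ c * \<xi> $ c) * (if e = a then 1 else 0) - (\<Sum>c\<in>UNIV. if e = c then \<xi> $ c * \<xi> $ a else 0)"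
    unfolding sum_distrib_right sum_subtractf[symmetric]
    by (rule sum.cong) (auto simp: vecL_def algebra_simps)
  then show ?thesis using one by (simp add: mult.commute)
qed

lemma tangent_mixed:
  assumes "q \<in> {1..2*n}" "norm \<xi> = 1"
  shows "tangent n (Jsph n (Inl a) (Inr q)) \<xi> e
    = (\<xi> $ a * \<xi> $ e - (if e = a then 1 else 0)) *\<^sub>R (yG q * bG n (-1/2))"
proof -
  have "mkG n (fst (Jmixed n a q) c d \<xi>) = (if d = a then (- \<xi> $ c) *\<^sub>R (yG q * bG n (-1/2)) else 0)" for c d
    using mkG_scale[of n "- \<xi> $ c" "gmul (ggen q) (invsqrt1m n)"]
    by (simp add: Jmixed_def mkG_zero mkG_gmul mkG_ggen[OF assms(1)] mkG_invsqrt1m)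
  then have "tangent n (Jsph n (Inl a) (Inr q)) \<xi> e
      = (\<Sum>c\<in>UNIV. \<Sum>d\<in>UNIV. if d = a then vecL c d \<xi> $ e *\<^sub>R (- \<xi> $ c) *\<^sub>R (yG q * bG n (-1/2)) else 0)"
    unfolding tangent_def Jsph_def by (intro sum.cong refl) simp
  also have "\<dots> = (- (\<Sum>c\<in>UNIV. \<xi> $ c * vecL c a \<xi> $ e)) *\<^sub>R (yG q * bG n (-1/2))"
    by (simp add: scaleR_sum_left sum_negf mult.commute)
  finally show ?thesis by (simp add: sum_vecL[OF assms(2)])
qed

lemma tangent_odd: "tangent n (Jsph n (Inr p) (Inr q)) \<xi> e = 0"
  by (simp add: tangent_def Jsph_def mkG_gconst)

lemma snd_Jsph:
  shows "mkG n (snd (Jsph n (Inl a) (Inl b)) l \<xi>) = 0"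
    and "mkG n (snd (Jsph n (Inl a) (Inr q)) l \<xi>) = upY q l *\<^sub>R (\<xi> $ a *\<^sub>R bG n (1/2))"
    and "p \<in> {1..2*n} \<Longrightarrow> q \<in> {1..2*n} \<Longrightarrow>
      mkG n (snd (Jsph n (Inr p) (Inr q)) l \<xi>) = upY q l *\<^sub>R yG p + upY p l *\<^sub>R yG q"
proof -
  show "mkG n (snd (Jsph n (Inl a) (Inl b)) l \<xi>) = 0"
    by (simp add: Jsph_def mkG_gconst)
  show "mkG n (snd (Jsph n (Inl a) (Inr q)) l \<xi>) = upY q l *\<^sub>R (\<xi> $ a *\<^sub>R bG n (1/2))"
    by (simp add: Jsph_def Jmixed_def mkG_scale[of n "upY q l * \<xi> $ a" "sqrt1m n"] mkG_sqrt1m)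
  show "mkG n (snd (Jsph n (Inr p) (Inr q)) l \<xi>) = upY q l *\<^sub>R yG p + upY p l *\<^sub>R yG q"
    if "p \<in> {1..2*n}" "q \<in> {1..2*n}"
    using mkG_scale[of n _ "ggen p"] mkG_scale[of n _ "ggen q"] that
    by (simp add: Jsph_def mkG_add mkG_ggen)
qed

lemma up_coef_simps:
  "up_coef (Inl a) (Inl b) = (if b = a then 1 else 0)"
  "up_coef (Inl a) (Inr q) = 0"
  "up_coef (Inr q) (Inl a) = 0"
  "up_coef (Inr p) (Inr q) = upY p q"
  by (auto simp: up_coef_def upY_def)

lemma par_simps: "par (Inl a) = 0" "par (Inr p) = 1"
  by (simp_all add: par_def)

lemma XiG_simps: "XiG n \<xi> (Inl a) = \<xi> $ a *\<^sub>R bG n (1/2)" "XiG n \<xi> (Inr p) = yG p"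
  by (simp_all add: XiG_def)

lemma yG_bG_commute_left: "yG p * (bG n \<alpha> * z) = bG n \<alpha> * (yG p * z)"
  by (metis mult.assoc yG_bG_commute)

lemma bG_mult_left: "bG n \<alpha> * (bG n \<beta> * z) = bG n (\<alpha> + \<beta>) * z"
  by (metis mult.assoc bG_mult)

lemma vecL_nth: "vecL a b \<xi> $ e = (if e = b then \<xi> $ a else 0) - (if e = a then \<xi> $ b else 0)"
  by (simp add: vecL_def)

lemma sum_vecL_coord:
  fixes \<xi> :: "real^'m::finite"
  shows "(\<Sum>e\<in>UNIV. vecL a b \<xi> $ e * w e) = \<xi> $ a * w b - \<xi> $ b * w a"
proof -
  have "(\<Sum>e\<in>UNIV. vecL a b \<xi> $ e * w e)
      = (\<Sum>e\<in>UNIV. if e = b then \<xi> $ a * w e else 0) - (\<Sum>e\<in>UNIV. if e = a then \<xi> $ b * w e else 0)"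
    unfolding sum_subtractf[symmetric] by (rule sum.cong) (auto simp: vecL_nth algebra_simps)
  then show ?thesis by simp
qed

text \<open>The factors are, up to sign, entries of the tangential projection, which is symmetric
  and idempotent.\<close>

lemma sum_projection:
  fixes \<xi> :: "real^'m::finite"
  assumes "norm \<xi> = 1"
  shows "(\<Sum>e\<in>UNIV. (\<xi> $ a * \<xi> $ e - (if e = a then 1 else 0)) * (\<xi> $ c * \<xi> $ e - (if e = c then 1 else 0)))
    = (if c = a then 1 else 0) - \<xi> $ a * \<xi> $ c"
proof -
  have one: "(\<Sum>e\<in>UNIV. \<xi> $ e * \<xi> $ e) = 1"
    using assms by (simp add: norm_eq_1 inner_vec_def)
  have "(\<Sum>e\<in>UNIV. (\<xi> $ a * \<xi> $ e - (if e = a then 1 else 0)) * (\<xi> $ c * \<xi> $ e - (if e = c then 1 else 0)))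
      = (\<Sum>e\<in>UNIV. \<xi> $ e * \<xi> $ e) * (\<xi> $ a * \<xi> $ c) - (\<Sum>e\<in>UNIV. if e = c then \<xi> $ a * \<xi> $ e else 0)
        - (\<Sum>e\<in>UNIV. if e = a then \<xi> $ c * \<xi> $ e else 0) + (\<Sum>e\<in>UNIV. if e = a then (if e = c then 1 else 0) else 0)"
    unfolding sum_distrib_right sum_subtractf[symmetric] sum.distrib[symmetric]
    by (rule sum.cong) (auto simp: algebra_simps)
  also have "\<dots> = (if c = a then 1 else 0) - \<xi> $ a * \<xi> $ c"
    using one by auto
  finally show ?thesis .
qed

section \<open>Comparison for each parity of the indices\<close>

text \<open>The factor 1 - theta^2 of the metric is the product of the two square roots in the
  pulled-back coordinates.\<close>

lemma sph_metric_even_even: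
  "mkG n (sph_metric n (Jsph n (Inl a) (Inl b)) (Jsph n (Inl c) (Inl d)) \<xi>)
    = coord_metric n \<xi> (Inl a) (Inl b) (Inl c) (Inl d)"
proof -
  have "(\<Sum>e\<in>UNIV. tangent n (Jsph n (Inl a) (Inl b)) \<xi> e * tangent n (Jsph n (Inl c) (Inl d)) \<xi> e)
      = (\<Sum>e\<in>UNIV. vecL a b \<xi> $ e * vecL c d \<xi> $ e) *\<^sub>R 1"
    by (simp add: tangent_even scaleR_sum_left mult.commute)
  also have "\<dots> = (\<xi> $ a * vecL c d \<xi> $ b - \<xi> $ b * vecL c d \<xi> $ a) *\<^sub>R 1"
    by (simp add: sum_vecL_coord)
  finally have T: "(\<Sum>e\<in>UNIV. tangent n (Jsph n (Inl a) (Inl b)) \<xi> e * tangent n (Jsph n (Inl c) (Inl d)) \<xi> e)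
      = \<dots>" .
  show ?thesis
    unfolding mkG_sph_metric snd_Jsph odd_form_zero coord_metric_def up_coef_simps par_simps XiG_simps T vecL_nth
    by (simp add: bG_mult algebra_simps)
qed

lemma sph_metric_even_mixed:
  assumes "s \<in> {1..2*n}" "norm \<xi> = 1"
  shows "mkG n (sph_metric n (Jsph n (Inl a) (Inl b)) (Jsph n (Inl c) (Inr s)) \<xi>)
    = coord_metric n \<xi> (Inl a) (Inl b) (Inl c) (Inr s)" (is ?A)
    and "mkG n (sph_metric n (Jsph n (Inl c) (Inr s)) (Jsph n (Inl a) (Inl b)) \<xi>)
    = coord_metric n \<xi> (Inl c) (Inr s) (Inl a) (Inl b)" (is ?B)
proof -
  \<comment> \<open>The normal part drops out, because a rotation field is orthogonal to
    \<xi>.\<close>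
  have "(\<Sum>e\<in>UNIV. vecL a b \<xi> $ e * (\<xi> $ c * \<xi> $ e - (if e = c then 1 else 0)))
      = - (\<xi> $ a * (if b = c then 1 else 0) - \<xi> $ b * (if a = c then 1 else 0))"
    unfolding sum_vecL_coord by (simp add: algebra_simps)
  then have T: "(\<Sum>e\<in>UNIV. tangent n (Jsph n (Inl a) (Inl b)) \<xi> e * tangent n (Jsph n (Inl c) (Inr s)) \<xi> e)
      = (- (\<xi> $ a * (if b = c then 1 else 0) - \<xi> $ b * (if a = c then 1 else 0))) *\<^sub>R (yG s * bG n (-1/2))"
    by (simp add: tangent_even tangent_mixed[OF assms] mult.commute flip: scaleR_sum_left)
  have T': "(\<Sum>e\<in>UNIV. tangent n (Jsph n (Inl c) (Inr s)) \<xi> e * tangent n (Jsph n (Inl a) (Inl b)) \<xi> e)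
      = (\<Sum>e\<in>UNIV. tangent n (Jsph n (Inl a) (Inl b)) \<xi> e * tangent n (Jsph n (Inl c) (Inr s)) \<xi> e)"
    by (simp add: tangent_even mult.commute)
  show ?A
    unfolding mkG_sph_metric snd_Jsph odd_form_zero coord_metric_def up_coef_simps par_simps XiG_simps T
    by (simp add: bG_mult_left bG_mult yG_bG_commute algebra_simps)
  show ?B
    unfolding mkG_sph_metric snd_Jsph odd_form_zero coord_metric_def up_coef_simps par_simps XiG_simps T' T
    by (simp add: bG_mult_left bG_mult yG_bG_commute algebra_simps)
qed

lemma sph_metric_even_odd:
  assumes "r \<in> {1..2*n}" "s \<in> {1..2*n}"
  shows "mkG n (sph_metric n (Jsph n (Inl a) (Inl b)) (Jsph n (Inr r) (Inr s)) \<xi>)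
    = coord_metric n \<xi> (Inl a) (Inl b) (Inr r) (Inr s)"
    and "mkG n (sph_metric n (Jsph n (Inr r) (Inr s)) (Jsph n (Inl a) (Inl b)) \<xi>)
    = coord_metric n \<xi> (Inr r) (Inr s) (Inl a) (Inl b)"
  by (simp_all add: mkG_sph_metric snd_Jsph odd_form_zero tangent_odd coord_metric_def up_coef_simps par_simps)

text \<open>The rotational part contributes -\<xi>_a \<xi>_c y_q y_s from the projection, the
  correction in the odd metric contributes the same with a plus sign; the Kronecker term and the
  constant odd term remain.\<close>

lemma sph_metric_mixed_mixed:
  assumes q: "q \<in> {1..2*n}" and s: "s \<in> {1..2*n}" and \<xi>: "norm \<xi> = 1"
  shows "mkG n (sph_metric n (Jsph n (Inl a) (Inr q)) (Jsph n (Inl c) (Inr s)) \<xi>)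
    = coord_metric n \<xi> (Inl a) (Inr q) (Inl c) (Inr s)"
proof -
  have T: "(\<Sum>e\<in>UNIV. tangent n (Jsph n (Inl a) (Inr q)) \<xi> e * tangent n (Jsph n (Inl c) (Inr s)) \<xi> e)
      = ((if c = a then 1 else 0) - \<xi> $ a * \<xi> $ c) *\<^sub>R (bG n (-1) * (yG q * yG s))"
    unfolding sum_projection[OF \<xi>, symmetric] tangent_mixed[OF q \<xi>] tangent_mixed[OF s \<xi>] scaleR_sum_left
    by (intro sum.cong refl) (simp add: yG_bG_commute yG_bG_commute_left bG_mult_left mult.assoc mult.commute)
  show ?thesis
    unfolding mkG_sph_metric snd_Jsph odd_form_upY[OF q s] coord_metric_def up_coef_simps par_simps XiG_simps T
    by (simp add: invG_scaleR invG_bG odd_metric_def bG_mult_left bG_mult yG_bG_commute yG_bG_commute_left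
        bG_0 mult.assoc algebra_simps)
qed

text \<open>The odd-odd field has no rotational part, and the cubic corrections, related by
  exchanging p and q, cancel by anticommutation.\<close>

lemma sph_metric_odd_mixed:
  assumes p: "p \<in> {1..2*n}" and q: "q \<in> {1..2*n}" and s: "s \<in> {1..2*n}" and \<xi>: "norm \<xi> = 1"
  shows "mkG n (sph_metric n (Jsph n (Inr p) (Inr q)) (Jsph n (Inl c) (Inr s)) \<xi>)
    = coord_metric n \<xi> (Inr p) (Inr q) (Inl c) (Inr s)" (is ?A)
    and "mkG n (sph_metric n (Jsph n (Inl c) (Inr s)) (Jsph n (Inr p) (Inr q)) \<xi>)
    = coord_metric n \<xi> (Inl c) (Inr s) (Inr p) (Inr q)" (is ?B)
proof -
  have c1: "yG p * (yG q * yG s) = - (yG q * (yG p * yG s))"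
    by (rule yG_anticommute_left)
  have c2: "yG p * (yG s * yG q) = - (yG q * (yG s * yG p))"
    using c1 by (metis yG_anticommute minus_minus mult_minus_right)
  show ?A
    unfolding mkG_sph_metric snd_Jsph(2) snd_Jsph(3)[OF p q] odd_form_add_left odd_form_upY[OF q s]
      odd_form_upY[OF p s] coord_metric_def up_coef_simps par_simps XiG_simps tangent_odd
    by (simp add: invG_scaleR invG_bG odd_metric_def bG_mult_left bG_mult yG_bG_commute yG_bG_commute_left
        mult.assoc distrib_left distrib_right c1 scaleR_add_right mult.commute)
  show ?B
    unfolding mkG_sph_metric snd_Jsph(2) snd_Jsph(3)[OF p q] odd_form_add_right odd_form_upY[OF s q]
      odd_form_upY[OF s p] coord_metric_def up_coef_simps par_simps XiG_simps tangent_odd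
    by (simp add: invG_yG odd_metric_def bG_mult_left bG_mult yG_bG_commute yG_bG_commute_left
        mult.assoc distrib_left c2 scaleR_add_right scaleR_diff_right)
qed

text \<open>The four quartic corrections cancel in pairs under exchange of p and q; the parity
  automorphism on y_r and y_s supplies the sign (-1)^([k][l]).\<close>

lemma sph_metric_odd_odd:
  assumes p: "p \<in> {1..2*n}" and q: "q \<in> {1..2*n}" and r: "r \<in> {1..2*n}" and s: "s \<in> {1..2*n}"
  shows "mkG n (sph_metric n (Jsph n (Inr p) (Inr q)) (Jsph n (Inr r) (Inr s)) \<xi>)
    = coord_metric n \<xi> (Inr p) (Inr q) (Inr r) (Inr s)"
proof -
  have c: "yG p * (yG r' * (yG q * yG s')) = - (yG q * (yG r' * (yG p * yG s')))" for r' s'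
    by (metis (no_types, lifting) yG_anticommute_left minus_minus mult_minus_right)
  show ?thesis
    unfolding mkG_sph_metric snd_Jsph(3)[OF p q] snd_Jsph(3)[OF r s] odd_form_add_left odd_form_add_right
      odd_form_upY[OF q s] odd_form_upY[OF q r] odd_form_upY[OF p s] odd_form_upY[OF p r]
      coord_metric_def up_coef_simps par_simps XiG_simps tangent_odd
    by (simp add: invG_yG odd_metric_def bG_mult_left bG_mult yG_bG_commute yG_bG_commute_left
        mult.assoc distrib_left distrib_right left_diff_distrib c scaleR_add_right scaleR_diff_right)
qed

lemma coord_metric_swap:
  "coord_metric n \<xi> (Inr p) (Inl b) k l = - coord_metric n \<xi> (Inl b) (Inr p) k l"
  "coord_metric n \<xi> i j (Inr p) (Inl b) = - coord_metric n \<xi> i j (Inl b) (Inr p)"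
  by (simp_all add: coord_metric_def par_simps algebra_simps)

lemma Jsph_swap: "Jsph n (Inr p) (Inl b) = vfS_neg (Jsph n (Inl b) (Inr p))"
  by (simp add: Jsph_def)

text \<open>Antisymmetry of both sides puts the even index of every mixed pair first, which leaves
  the parity cases treated above.\<close>

lemma sph_metric_Jsph:
  assumes i: "i \<in> Idx n" and j: "j \<in> Idx n" and k: "k \<in> Idx n" and l: "l \<in> Idx n" and \<xi>: "norm \<xi> = 1"
  shows "mkG n (sph_metric n (Jsph n i j) (Jsph n k l) \<xi>) = coord_metric n \<xi> i j k l"
proof -
  have idx: "p \<in> {1..2*n}" if "(Inr p :: 'a + nat) \<in> Idx n" for p
    using that by (auto simp: Idx_def)
  note facts = sph_metric_even_even sph_metric_even_mixed sph_metric_even_odd sph_metric_mixed_mixed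
    sph_metric_odd_mixed sph_metric_odd_odd
  show ?thesis
    using assms
    by (cases i; cases j; cases k; cases l)
       (simp_all only: facts idx Jsph_swap coord_metric_swap sph_metric_neg)
qed

theorem theorem5p5:
  fixes n :: nat
  shows "(\<forall>f :: 'm::finite sfun. sf_smooth n f \<longrightarrow>
            (\<forall>i\<in>Idx n. \<forall>j\<in>Idx n. \<forall>\<xi> :: real^'m. norm \<xi> = 1 \<longrightarrow>
               (\<forall>S\<subseteq>{1..2*n}.
                  sv_apply n (Jsph n i j) (pi_sharp n f) \<xi> S
                  = pi_sharp n (vf_apply n (L_R i j) f) \<xi> S)))
       \<and> (\<forall>i\<in>Idx n. \<forall>j\<in>Idx n. \<forall>k\<in>Idx n. \<forall>l\<in>Idx n. \<forall>\<xi> :: real^'m. norm \<xi> = 1 \<longrightarrow>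
            (\<forall>S\<subseteq>{1..2*n}.
               sph_metric n (Jsph n i j) (Jsph n k l) \<xi> S
               = pi_sharp n (metric_R n (L_R i j) (L_R k l)) \<xi> S))"
proof (intro conjI allI impI ballI)
  fix f :: "'m sfun" and i j :: "'m + nat" and \<xi> :: "real^'m" and S
  assume "sf_smooth n f" "i \<in> Idx n" "j \<in> Idx n" "norm \<xi> = 1" and S: "S \<subseteq> {1..2*n}"
  then have "mkG n (sv_apply n (Jsph n i j) (pi_sharp n f) \<xi>) = mkG n (pi_sharp n (vf_apply n (L_R i j) f) \<xi>)"
    by (simp add: sv_apply_Jsph sf_smooth_imp_smooth_sfun mkG_pi_sharp)
  then show "sv_apply n (Jsph n i j) (pi_sharp n f) \<xi> S = pi_sharp n (vf_apply n (L_R i j) f) \<xi> S"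
    using S by (rule mkG_eqD)
next
  fix i j k l :: "'m + nat" and \<xi> :: "real^'m" and S
  assume "i \<in> Idx n" "j \<in> Idx n" "k \<in> Idx n" "l \<in> Idx n" "norm \<xi> = 1" and S: "S \<subseteq> {1..2*n}"
  then have "mkG n (sph_metric n (Jsph n i j) (Jsph n k l) \<xi>)
      = mkG n (pi_sharp n (metric_R n (L_R i j) (L_R k l)) \<xi>)"
    by (simp add: sph_metric_Jsph PiG_metric_L_R mkG_pi_sharp)
  then show "sph_metric n (Jsph n i j) (Jsph n k l) \<xi> S = pi_sharp n (metric_R n (L_R i j) (L_R k l)) \<xi> S"
    using S by (rule mkG_eqD)
qed

end
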